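(* Assume the Basor–Widom sine-kernel determinant asymptotics: for real $\sigma<1$, as $s\to+\infty$, \[ \ln\det(I-\sigma K_s)=\frac{2s}\pi\ln(1-\sigma)+\frac{\ln^2(1-\sigma)}{2\pi^2}\ln(4s)+2\ln\bigl[\mathsf G(1+i\mathsf z)\mathsf G(1-i\mathsf z)\bigr]+O\!\Bigl(\frac{\ln s}{s}\Bigr),\qquad \mathsf z=-\frac{\ln(1-\sigma)}{2\pi}, \] with error term uniform for $\sigma$ in compact subsets of $(-\infty,1)$. Then for each fixed integer $m\ge1$, \[ \operatorname{Tr}\bigl((S_\ell-S_\ell^2)^m\bigr)=\frac{\beta_m}{\pi^2}\ln\ell+O_m(1)\qquad(\ell\ge1), \] where \[ \beta_m=B(m,m)=\frac{((m-1)!)^2}{(2m-1)!} \] (so $\beta_1=1$, $\beta_2=\frac16$, $\beta_3=\frac1{30}$), and the $O_m(1)$ term is bounded uniformly in $\ell\ge1$ for each fixed $m$ (by a constant that may depend on $m$).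
   Context: $K_s$ is the integral operator on $L^2(-1,1)$ with the sine kernel $\sin s(x-y)/(\pi(x-y))$; $\mathsf G$ is the Barnes $G$-function; $\det$ is the Fredholm determinant; $B(\cdot,\cdot)$ is the Beta function. Let $Q$ be the orthogonal projection of $L^2(\mathbb{R})$ onto functions with Fourier support in $(-\frac12,\frac12)$ (Fourier transform $\int f(x)e^{-2\pi i x\xi}dx$), i.e. the integral operator with kernel $\operatorname{sinc}(x-y)$, $\operatorname{sinc}(t)=\sin(\pi t)/(\pi t)$, $\operatorname{sinc}(0)=1$. For $\ell>0$ let $P$ be multiplication by the indicator of $(0,\ell)$ and $S_\ell=PQP$ on $L^2(0,\ell)$; it is a positive trace-class contraction. *)

theory Defs
  imports "HOL-Analysis.Analysis" "Jordan_Normal_Form.Determinant"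
begin

text \<open>The space \<open>L\<^sup>2(M)\<close> of complex-valued functions is represented by its measurable
  representatives; equality of elements is equality almost everywhere.\<close>

definition L2 :: "'a measure \<Rightarrow> ('a \<Rightarrow> complex) set" where
  "L2 M = {f \<in> borel_measurable M. integrable M (\<lambda>x. (norm (f x))\<^sup>2)}"

definition L2_inner :: "'a measure \<Rightarrow> ('a \<Rightarrow> complex) \<Rightarrow> ('a \<Rightarrow> complex) \<Rightarrow> complex" where
  "L2_inner M f g = (LINT x|M. cnj (f x) * g x)"

definition L2_norm :: "'a measure \<Rightarrow> ('a \<Rightarrow> complex) \<Rightarrow> real" where
  "L2_norm M f = sqrt (LINT x|M. (norm (f x))\<^sup>2)"

text \<open>Indexing by \<^typ>\<open>nat\<close> is adequate for separable infinite-dimensional \<open>L\<^sup>2(M)\<close>,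
  such as \<open>L\<^sup>2\<close> of an interval.\<close>

definition L2_orthonormal_basis :: "'a measure \<Rightarrow> (nat \<Rightarrow> 'a \<Rightarrow> complex) \<Rightarrow> bool" where
  "L2_orthonormal_basis M e \<longleftrightarrow>
     (\<forall>n. e n \<in> L2 M) \<and>
     (\<forall>i j. L2_inner M (e i) (e j) = (if i = j then 1 else 0)) \<and>
     (\<forall>f\<in>L2 M. (\<lambda>N. L2_norm M (\<lambda>x. f x - (\<Sum>n<N. L2_inner M (e n) f * e n x)))
                  \<longlonglongrightarrow> 0)"

text \<open>The trace is the common value of \<open>\<Sum>n. \<langle>e\<^sub>n, T e\<^sub>n\<rangle>\<close> over all orthonormal bases. It is
  meaningful when the sum converges to the same number for every basis, as it does for a
  trace-class operator \<open>T\<close>; otherwise the description is unspecified.\<close>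

definition op_trace :: "'a measure \<Rightarrow> (('a \<Rightarrow> complex) \<Rightarrow> ('a \<Rightarrow> complex)) \<Rightarrow> complex" where
  "op_trace M T =
     (THE t. \<forall>e. L2_orthonormal_basis M e \<longrightarrow> (\<lambda>n. L2_inner M (e n) (T (e n))) sums t)"

definition sinc_pi :: "real \<Rightarrow> real" where
  "sinc_pi t = (if t = 0 then 1 else sin (pi * t) / (pi * t))"

definition Q_op :: "(real \<Rightarrow> complex) \<Rightarrow> (real \<Rightarrow> complex)" where
  "Q_op f = (\<lambda>x. LINT y|lborel. of_real (sinc_pi (x - y)) * f y)"

definition P_op :: "real \<Rightarrow> (real \<Rightarrow> complex) \<Rightarrow> (real \<Rightarrow> complex)" where
  "P_op l f = (\<lambda>x. indicator {0<..<l} x * f x)"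

definition S_op :: "real \<Rightarrow> (real \<Rightarrow> complex) \<Rightarrow> (real \<Rightarrow> complex)" where
  "S_op l = P_op l \<circ> Q_op \<circ> P_op l"

definition S_minus_S2 :: "real \<Rightarrow> (real \<Rightarrow> complex) \<Rightarrow> (real \<Rightarrow> complex)" where
  "S_minus_S2 l f = (\<lambda>x. S_op l f x - S_op l (S_op l f) x)"

definition sine_kernel :: "real \<Rightarrow> real \<Rightarrow> real \<Rightarrow> real" where
  "sine_kernel s x y = (if x = y then s / pi else sin (s * (x - y)) / (pi * (x - y)))"

text \<open>Fredholm's series for \<open>det(I - K)\<close>, where \<open>K\<close> is the integral operator on
  \<open>L\<^sup>2(M)\<close> with (continuous) kernel \<open>k\<close>:
  \<open>\<Sum>n. (-1)\<^sup>n / n! \<integral> det (k(x\<^sub>i, x\<^sub>j))\<^bsub>i,j<n\<^esub> dx\<close>.\<close>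

definition fredholm_det :: "'a measure \<Rightarrow> ('a \<Rightarrow> 'a \<Rightarrow> real) \<Rightarrow> real" where
  "fredholm_det M k =
     (\<Sum>n. (-1) ^ n / fact n *
        (LINT x|PiM {..<n} (\<lambda>_. M). Determinant.det (mat n n (\<lambda>(i, j). k (x i) (x j)))))"

text \<open>Weierstrass product of the Barnes \<open>G\<close>-function,
  \<open>G(1 + z) = (2\<pi>)\<^bsup>z/2\<^esup> exp (-(z + z\<^sup>2(1 + \<gamma>))/2)
    \<Prod>k\<ge>1. (1 + z/k)\<^sup>k exp (z\<^sup>2/(2k) - z)\<close>, with \<open>k = n + 1\<close> below.\<close>

definition Barnes_G :: "complex \<Rightarrow> complex" where
  "Barnes_G w =
     (let z = w - 1 in
        of_real (2 * pi) powr (z / 2) * exp (- (z + z\<^sup>2 * (1 + euler_mascheroni)) / 2) *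
        (\<Prod>n. (1 + z / of_nat (Suc n)) ^ Suc n * exp (z\<^sup>2 / (2 * of_nat (Suc n)) - z)))"

end

theory Submission
  imports Defs "HOL-Real_Asymp.Real_Asymp"
begin

text \<open>
  Write \<open>t\<^sub>k = Tr S\<^sub>l\<^sup>k\<close> and \<open>s = \<pi>l/2\<close>. Dilation turns \<open>S\<^sub>l\<close> into the sine-kernel operator
  \<open>K\<^sub>s\<close> on \<open>(-1, 1)\<close>, and Plemelj's formula \<open>ln det(I - \<sigma>K\<^sub>s) = - \<Sum>\<^sub>k \<sigma>\<^sup>k t\<^sub>k / k\<close> for \<open>\<bar>\<sigma>\<bar> < 1\<close>
  makes the determinant asymptotics a statement about the generating function of the \<open>t\<^sub>k\<close>.
  Since \<open>ln(1 - \<sigma>) = - \<Sum>\<^sub>k \<sigma>\<^sup>k / k\<close> and \<open>ln\<^sup>2(1 - \<sigma>) = \<Sum>\<^sub>k 2 H\<^bsub>k-1\<^esub> \<sigma>\<^sup>k / k\<close>, comparing coefficients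
  suggests \<open>t\<^sub>k = l - (H\<^bsub>k-1\<^esub> / \<pi>\<^sup>2) ln l + O(1)\<close>. Expanding \<open>(S - S\<^sup>2)\<^sup>m\<close> binomially, the terms
  linear in \<open>l\<close> cancel, and the logarithms combine because
  \<open>\<Sum>\<^sub>j (-1)\<^sup>j (m choose j) H\<^bsub>m+j-1\<^esub> = - B(m, m)\<close>, an iterated difference (lemma
  \<open>alternating_harm\<close>).

  Comparing coefficients has to be justified, since the asymptotics are uniform only on real
  intervals (lemma \<open>traces_from_determinant_asymptotics\<close>). Let \<open>u\<^sub>k(s)\<close> be the difference between
  \<open>t\<^sub>k\<close> and its predicted main terms. The term of the asymptotics that is constant in \<open>s\<close> drops
  out of the difference of two instances, so for \<open>s \<le> t \<le> 2s\<close> the series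
  \<open>\<Sum>\<^sub>k (u\<^sub>k(t) - u\<^sub>k(s)) \<sigma>\<^sup>k / k\<close> is \<open>O(ln s / s)\<close> on \<open>[0, 1/2]\<close>, while its coefficients are \<open>O(s)\<close>,
  as \<open>S\<^sub>l\<close> is a contraction. On \<open>[0, s\<^bsup>-1/(4k)\<^esup>]\<close> a Taylor polynomial of fixed degree approximates the
  series to within \<open>O(1/s)\<close>, and the equivalence of norms on polynomials of that degree bounds the
  \<open>k\<close>-th coefficient by \<open>O(s\<^bsup>-1/4\<^esup>)\<close>. Summing this over dyadic scales shows that \<open>u\<^sub>k\<close> is bounded.

  Two facts connect this with the operators. Plemelj's formula follows from a recursion for the
  coefficients of Fredholm's series, obtained by splitting off the cycle through one chosen index
  in the Leibniz formula (lemmas \<open>det_integral_expand\<close> and \<open>fredholm_det_eq_exp\<close>). The traces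
  are computed from \<open>S\<^sub>l = F\<^sup>*F\<close>, where \<open>F\<close> restricts the Fourier transform to \<open>(-1/2, 1/2)\<close>:
  with the plane waves \<open>\<phi>\<^sub>\<xi>\<close> one has
  \<open>\<Sum>\<^sub>n \<langle>e\<^sub>n, S\<^bsup>j+1\<^esup> e\<^sub>n\<rangle> = \<integral> \<langle>\<phi>\<^sub>\<xi>, S\<^sup>j \<phi>\<^sub>\<xi>\<rangle> d\<xi>\<close> for every orthonormal basis by Parseval's
  identity (lemma \<open>basis_trace_sums\<close>), and the same integral is the trace of the iterated sinc
  kernel by Fubini's theorem (lemma \<open>kernel_trace_eq_band_trace\<close>). The bound \<open>\<parallel>S\<^sub>l\<parallel> \<le> 1\<close> comes
  from Bessel's inequality (lemma \<open>band_coeff_norm_le\<close>). As the trace is defined through all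
  orthonormal bases, it also has to be known that there is one; the cosines provide it.
\<close>

section \<open>Alternating binomial sums of harmonic numbers\<close>

text \<open>Pascal's rule makes the alternating binomial sum an iterated difference operator.\<close>

lemma alternating_binomial_Suc:
  fixes f :: "nat \<Rightarrow> 'a :: comm_ring_1"
  shows "(\<Sum>j\<le>Suc m. (-1) ^ j * of_nat (Suc m choose j) * f j) =
         (\<Sum>j\<le>m. (-1) ^ j * of_nat (m choose j) * f j)
       - (\<Sum>j\<le>m. (-1) ^ j * of_nat (m choose j) * f (Suc j))"
proof -
  have "(\<Sum>j\<le>Suc m. (-1) ^ j * of_nat (Suc m choose j) * f j)
      = f 0 + (\<Sum>j\<le>m. (-1) ^ Suc j * of_nat (Suc m choose Suc j) * f (Suc j))"
    by (subst sum.atMost_Suc_shift) simp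
  also have "\<dots> = f 0 + (\<Sum>j\<le>m. (-1) ^ Suc j * of_nat (m choose Suc j) * f (Suc j))
      - (\<Sum>j\<le>m. (-1) ^ j * of_nat (m choose j) * f (Suc j))"
    by (simp add: algebra_simps sum.distrib sum_subtractf sum_negf)
  also have "f 0 + (\<Sum>j\<le>m. (-1) ^ Suc j * of_nat (m choose Suc j) * f (Suc j))
      = (\<Sum>j\<le>Suc m. (-1) ^ j * of_nat (m choose j) * f j)"
    by (subst sum.atMost_Suc_shift) simp
  also have "\<dots> = (\<Sum>j\<le>m. (-1) ^ j * of_nat (m choose j) * f j)" by (simp add: binomial_eq_0)
  finally show ?thesis .
qed

text \<open>The \<open>m\<close>-th difference of \<open>n \<mapsto> H\<^sub>n\<close>. The first difference is \<open>-1/(n + 1)\<close>, and each further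
  one keeps the shape of the right-hand side, which is \<open>- B(m, n + 1)\<close>. The traces lead to the
  case \<open>n = m - 1\<close>.\<close>

lemma alternating_harm:
  assumes "m \<ge> 1"
  shows "(\<Sum>j\<le>m. (-1) ^ j * real (m choose j) * harm (n + j)) = - (fact (m - 1) * fact n / fact (n + m))"
  using assms
proof (induction m arbitrary: n rule: nat_induct_at_least)
  case base
  have "fact (n + 1) = real (n + 1) * (fact n :: real)" by simp
  then have "fact n / fact (n + 1) = inverse (real (n + 1))"
    by (simp only:) (simp add: inverse_eq_divide del: of_nat_add of_nat_Suc)
  then show ?case by (simp add: harm_Suc del: fact_Suc)
next
  case (Suc m)
  obtain k where k: "m = Suc k" using Suc.hyps by (cases m) auto
  have "(\<Sum>j\<le>Suc m. (-1) ^ j * real (Suc m choose j) * harm (n + j)) =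
      - (fact k * fact n / fact (n + m)) + fact k * fact (Suc n) / fact (Suc n + m)"
    using Suc.IH[of n] Suc.IH[of "Suc n"]
    by (subst alternating_binomial_Suc) (simp add: k)
  also have "\<dots> = - (fact m * fact n / fact (n + Suc m))"
    by (simp add: k divide_simps) (simp add: algebra_simps)
  finally show ?case by simp
qed

lemma alternating_binomial_sum: "m \<ge> 1 \<Longrightarrow> (\<Sum>j\<le>m. (-1) ^ j * real (m choose j)) = 0"
  using choose_alternating_sum[of m, where ?'a = real] by simp

lemma Beta_diagonal:
  assumes "m \<ge> 1"
  shows "Beta (real m) (real m) = (fact (m - 1))\<^sup>2 / fact (2 * m - 1)"
proof -
  obtain k where k: "m = Suc k" using assms by (cases m) auto
  have "Gamma (real m) = fact k" using Gamma_fact[of k, where ?'a = real] by (simp add: k add.commute)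
  moreover have "Gamma (real m + real m) = fact (2 * k + 1)"
    using Gamma_fact[of "2 * k + 1", where ?'a = real] by (simp add: k algebra_simps)
  ultimately show ?thesis by (simp add: Beta_def k power2_eq_square)
qed

section \<open>Power series and small values on an interval\<close>

lemma ln_one_minus_sums:
  fixes x :: real assumes "\<bar>x\<bar> < 1"
  shows "(\<lambda>i. x ^ Suc i / real (Suc i)) sums (- ln (1 - x))"
proof -
  have "(\<lambda>n. - (x ^ n / real n)) sums ln (1 - x)"
    using ln_series'[of "- x"] assms by simp
  then have "(\<lambda>n. x ^ n / real n) sums - ln (1 - x)"
    using sums_minus[of "\<lambda>n. - (x ^ n / real n)"] by simp
  then show ?thesis
    by (subst sums_Suc_iff) simp
qed

text \<open>Partial fractions: \<open>1/(ab) = (1/a + 1/b)/(a + b)\<close> with constant \<open>a + b = n + 2\<close>.\<close>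

lemma harm_convolution:
  "(\<Sum>i\<le>n. 1 / (real (Suc i) * real (Suc (n - i)))) = 2 * harm (Suc n) / real (n + 2)"
proof -
  have "(\<Sum>i\<le>n. 1 / (real (Suc i) * real (Suc (n - i))))
      = (\<Sum>i\<le>n. (inverse (real (Suc i)) + inverse (real (Suc (n - i)))) / real (n + 2))"
  proof (rule sum.cong)
    fix i assume "i \<in> {..n}"
    then have "real (n + 2) = real (Suc i) + real (Suc (n - i))" by auto
    then show "1 / (real (Suc i) * real (Suc (n - i)))
       = (inverse (real (Suc i)) + inverse (real (Suc (n - i)))) / real (n + 2)"
      by (simp only:) (simp add: divide_simps add.commute del: of_nat_Suc)
  qed simp
  also have "\<dots> = ((\<Sum>i\<le>n. inverse (real (Suc i))) + (\<Sum>i\<le>n. inverse (real (Suc (n - i))))) / real (n + 2)"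
    by (simp only: sum_divide_distrib[symmetric] sum.distrib)
  also have "(\<Sum>i\<le>n. inverse (real (Suc (n - i)))) = (\<Sum>i\<le>n. inverse (real (Suc i)))"
    using sum.nat_diff_reindex[of "\<lambda>i. inverse (real (Suc i))" "Suc n"]
    by (simp add: lessThan_Suc_atMost)
  also have "(\<Sum>i\<le>n. inverse (real (Suc i))) = harm (Suc n)"
    by (induction n) (simp_all add: harm_Suc harm_def)
  finally show ?thesis by simp
qed

lemma ln_squared_sums:
  fixes x :: real assumes "\<bar>x\<bar> < 1"
  shows "(\<lambda>i. 2 * harm i / real (Suc i) * x ^ Suc i) sums (ln (1 - x))\<^sup>2"
proof -
  let ?a = "\<lambda>i. x ^ Suc i / real (Suc i)"
  have 1: "summable (\<lambda>i. norm (?a i))"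
    using ln_one_minus_sums[of "\<bar>x\<bar>"] assms
    by (intro sums_summable[where l = "- ln (1 - \<bar>x\<bar>)"]) (simp add: abs_mult power_abs)
  have "(\<lambda>n. \<Sum>i\<le>n. ?a i * ?a (n - i)) sums ((\<Sum>i. ?a i) * (\<Sum>i. ?a i))"
    using Cauchy_product_sums[OF 1 1] .
  also have "(\<Sum>i. ?a i) = - ln (1 - x)" using ln_one_minus_sums[OF assms] by (simp add: sums_iff)
  also have "(\<lambda>n. \<Sum>i\<le>n. ?a i * ?a (n - i)) = (\<lambda>n. 2 * harm (Suc n) / real (Suc (Suc n)) * x ^ Suc (Suc n))"
  proof
    fix n
    have "(\<Sum>i\<le>n. ?a i * ?a (n - i)) = (\<Sum>i\<le>n. x ^ (n + 2) * (1 / (real (Suc i) * real (Suc (n - i)))))"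
      by (intro sum.cong) (auto simp: power_add[symmetric] simp del: power_Suc of_nat_Suc)
    also have "\<dots> = 2 * harm (Suc n) / real (Suc (Suc n)) * x ^ Suc (Suc n)"
      by (subst sum_distrib_left[symmetric], subst harm_convolution) simp
    finally show "(\<Sum>i\<le>n. ?a i * ?a (n - i)) = \<dots>" .
  qed
  finally have "(\<lambda>n. 2 * harm (Suc n) / real (Suc (Suc n)) * x ^ Suc (Suc n)) sums (ln (1 - x))\<^sup>2"
    by (simp add: power2_eq_square)
  then have "(\<lambda>i. 2 * harm i / real (Suc i) * x ^ Suc i) sums ((ln (1 - x))\<^sup>2 + 2 * harm 0 / real (Suc 0) * x ^ Suc 0)"
    by (subst (asm) sums_Suc_iff[of "\<lambda>i. 2 * harm i / real (Suc i) * x ^ Suc i"])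
  moreover have "harm 0 = (0::real)" by (simp add: harm_def)
  ultimately show ?thesis by (simp only: mult_zero_right mult_zero_left div_0 add_0_right)
qed

text \<open>The norm given by the largest coefficient and the supremum norm on \<open>[0, 1]\<close> are equivalent on
  polynomials of bounded degree. In the induction the dilated difference \<open>p(x) - 2\<^bsup>N+1\<^esup> p(x/2)\<close>
  has no term of top degree \<open>N + 1\<close> and changes every other coefficient by a factor of modulus at
  least \<open>1\<close>; the top coefficient is then recovered from \<open>p(1)\<close>.\<close>

lemma polynomial_coeff_bound:
  "\<exists>A\<ge>0. \<forall>c::nat \<Rightarrow> real. \<forall>\<epsilon>. (\<forall>x\<in>{0..1}. \<bar>\<Sum>k\<le>N. c k * x ^ k\<bar> \<le> \<epsilon>) \<longrightarrow> (\<forall>k\<le>N. \<bar>c k\<bar> \<le> A * \<epsilon>)"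
proof (induction N)
  case 0
  show ?case by (rule exI[of _ 1]) auto
next
  case (Suc N)
  then obtain A where A0: "A \<ge> 0" and A1: "\<forall>c::nat \<Rightarrow> real. \<forall>\<epsilon>.
    (\<forall>x\<in>{0..1}. \<bar>\<Sum>k\<le>N. c k * x ^ k\<bar> \<le> \<epsilon>) \<longrightarrow> (\<forall>k\<le>N. \<bar>c k\<bar> \<le> A * \<epsilon>)"
    by blast
  define B where "B = A * (1 + 2 ^ Suc N)"
  define D where "D = 1 + real (Suc N) * B"
  have B0: "B \<ge> 0" using A0 by (simp add: B_def)
  have "\<bar>c k\<bar> \<le> (B + D) * \<epsilon>"
    if c: "\<forall>x\<in>{0..1}. \<bar>\<Sum>k\<le>Suc N. c k * x ^ k\<bar> \<le> \<epsilon>" and k: "k \<le> Suc N" for c \<epsilon> k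
  proof -
    let ?p = "\<lambda>x. \<Sum>k\<le>Suc N. c k * x ^ k :: real"
    have e0: "\<epsilon> \<ge> 0" using order_trans[OF abs_ge_zero bspec[OF c, of 0]] by simp
    define d where "d k = c k * (1 - 2 ^ Suc N / 2 ^ k)" for k
    have *: "\<bar>\<Sum>k\<le>N. d k * x ^ k\<bar> \<le> (1 + 2 ^ Suc N) * \<epsilon>" if x: "x \<in> {0..1}" for x
    proof -
      have "?p x - 2 ^ Suc N * ?p (x / 2) = (\<Sum>k\<le>Suc N. d k * x ^ k)"
        unfolding d_def sum_distrib_left sum_subtractf[symmetric]
        by (intro sum.cong) (simp_all only: power_divide left_diff_distrib right_diff_distrib mult_1_right times_divide_eq_right times_divide_eq_left mult.assoc mult.left_commute mult.commute)
      also have "\<dots> = (\<Sum>k\<le>N. d k * x ^ k)" by (simp add: d_def)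
      finally have "\<bar>\<Sum>k\<le>N. d k * x ^ k\<bar> = \<bar>?p x - 2 ^ Suc N * ?p (x / 2)\<bar>" by (simp only:)
      also have "\<dots> \<le> \<bar>?p x\<bar> + \<bar>2 ^ Suc N * ?p (x / 2)\<bar>" by (rule abs_triangle_ineq4)
      also have "\<dots> = \<bar>?p x\<bar> + 2 ^ Suc N * \<bar>?p (x / 2)\<bar>"
        by (simp only: abs_mult power_abs abs_numeral)
      also have "\<dots> \<le> \<epsilon> + 2 ^ Suc N * \<epsilon>"
      proof (rule add_mono)
        show "\<bar>?p x\<bar> \<le> \<epsilon>" using c x by (rule bspec)
        have "\<bar>?p (x / 2)\<bar> \<le> \<epsilon>" by (rule bspec[OF c]) (use x in simp)
        then show "2 ^ Suc N * \<bar>?p (x / 2)\<bar> \<le> 2 ^ Suc N * \<epsilon>" by (rule mult_left_mono) simp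
      qed
      finally show ?thesis by (simp only: distrib_right mult_1_left)
    qed
    have low: "\<bar>c j\<bar> \<le> B * \<epsilon>" if "j \<le> N" for j
    proof -
      have "\<bar>d j\<bar> \<le> B * \<epsilon>" using A1[rule_format, of d, OF *] that by (simp add: B_def mult.assoc)
      moreover have "2 ^ Suc N / 2 ^ j \<ge> (2::real)"
        using power_increasing[OF that, of "2::real"] by (simp add: le_divide_eq)
      then have "\<bar>c j\<bar> * 1 \<le> \<bar>c j\<bar> * \<bar>1 - 2 ^ Suc N / 2 ^ j\<bar>" by (intro mult_left_mono) auto
      ultimately show ?thesis by (simp add: d_def abs_mult)
    qed
    show ?thesis
    proof (cases "k \<le> N")
      case True
      have "0 \<le> D * \<epsilon>" using e0 B0 by (simp add: D_def)
      with low[OF True] show ?thesis by (simp add: distrib_right)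
    next
      case False
      then have kN: "k = Suc N" using k by simp
      define t where "t = (\<Sum>k\<le>N. c k)"
      have p1: "?p 1 = c (Suc N) + t" by (simp add: t_def)
      have "\<bar>t\<bar> \<le> (\<Sum>k\<le>N. \<bar>c k\<bar>)" unfolding t_def by (rule sum_abs)
      moreover have "\<bar>c (Suc N)\<bar> \<le> \<bar>c (Suc N) + t\<bar> + \<bar>t\<bar>" by linarith
      ultimately have "\<bar>c (Suc N)\<bar> \<le> \<bar>?p 1\<bar> + (\<Sum>k\<le>N. \<bar>c k\<bar>)"
        unfolding p1 by linarith
      also have "\<dots> \<le> \<epsilon> + (\<Sum>k\<le>N. B * \<epsilon>)"
      proof (rule add_mono)
        show "\<bar>?p 1\<bar> \<le> \<epsilon>" using c by (rule bspec) simp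
        show "(\<Sum>k\<le>N. \<bar>c k\<bar>) \<le> (\<Sum>k\<le>N. B * \<epsilon>)" by (rule sum_mono) (simp add: low)
      qed
      also have "\<dots> = D * \<epsilon>" by (simp add: D_def distrib_right)
      also have "\<dots> \<le> (B + D) * \<epsilon>" using mult_nonneg_nonneg[OF B0 e0] by (simp add: distrib_right)
      finally show ?thesis by (simp add: kN)
    qed
  qed
  moreover have "B + D \<ge> 0" using B0 by (simp add: D_def)
  ultimately show ?case by (intro exI[of _ "B + D"] conjI allI impI)
qed

text \<open>Substituting \<open>x = h y\<close> and cutting the series off after degree \<open>N\<close> reduces the claim to
  polynomials on \<open>[0, 1]\<close>. The constant depends on \<open>N\<close> only, so \<open>h\<close> may be chosen to balance
  the values \<open>\<epsilon>\<close> on the interval against the size \<open>M\<close> of the coefficients.\<close>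

lemma power_series_coeff_bound:
  shows "\<exists>A\<ge>0. \<forall>(v::nat \<Rightarrow> real) M \<epsilon> h. 0 < h \<longrightarrow> h \<le> 1/2 \<longrightarrow> (\<forall>i. \<bar>v i\<bar> \<le> M) \<longrightarrow>
     (\<forall>x\<in>{0..h}. \<bar>\<Sum>i. v i * x ^ Suc i\<bar> \<le> \<epsilon>) \<longrightarrow>
     (\<forall>i<N. \<bar>v i\<bar> * h ^ Suc i \<le> A * (\<epsilon> + 2 * M * h ^ Suc N))"
proof -
  obtain A where A0: "A \<ge> 0" and A: "\<forall>c::nat \<Rightarrow> real. \<forall>\<epsilon>.
    (\<forall>x\<in>{0..1}. \<bar>\<Sum>k\<le>N. c k * x ^ k\<bar> \<le> \<epsilon>) \<longrightarrow> (\<forall>k\<le>N. \<bar>c k\<bar> \<le> A * \<epsilon>)"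
    using polynomial_coeff_bound[of N] by blast
  show ?thesis
  proof (intro exI[of _ A] conjI allI impI A0)
    fix v :: "nat \<Rightarrow> real" and M \<epsilon> h :: real and i
    assume h: "0 < h" "h \<le> 1/2" and v: "\<forall>i. \<bar>v i\<bar> \<le> M"
      and small: "\<forall>x\<in>{0..h}. \<bar>\<Sum>i. v i * x ^ Suc i\<bar> \<le> \<epsilon>" and i: "i < N"
    have M0: "M \<ge> 0" using v[rule_format, of 0] by linarith
    define c where "c k = (case k of 0 \<Rightarrow> 0 | Suc i \<Rightarrow> v i * h ^ Suc i)" for k
    have "\<bar>\<Sum>k\<le>N. c k * x ^ k\<bar> \<le> \<epsilon> + 2 * M * h ^ Suc N" if x: "x \<in> {0..1}" for x
    proof -
      define y where "y = h * x"
      have y: "y \<in> {0..h}" using x h by (auto simp: y_def mult_left_le)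
      then have y2: "0 \<le> y" "y \<le> 1/2" "y \<le> h" using h by auto
      have "summable (\<lambda>i. M * y ^ Suc i)"
        using y2 by (intro summable_mult) (simp add: summable_geometric)
      then have s: "summable (\<lambda>i. \<bar>v i * y ^ Suc i\<bar>)"
        by (rule summable_comparison_test')
           (use y2 v in \<open>auto simp: abs_mult intro!: mult_right_mono\<close>)
      have s2: "summable (\<lambda>i. \<bar>v (i + N) * y ^ Suc (i + N)\<bar>)"
        using s by (rule summable_ignore_initial_segment)
      have g: "(\<lambda>i. M * y ^ Suc N * y ^ i) sums (M * y ^ Suc N * (1 / (1 - y)))"
        using y2 by (intro sums_mult geometric_sums) auto
      have "\<bar>\<Sum>i. v (i + N) * y ^ Suc (i + N)\<bar> \<le> (\<Sum>i. \<bar>v (i + N) * y ^ Suc (i + N)\<bar>)"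
        by (rule summable_rabs[OF s2])
      also have "\<dots> \<le> (\<Sum>i. M * y ^ Suc N * y ^ i)"
      proof (rule suminf_le[OF _ s2 sums_summable[OF g]])
        fix i
        have "\<bar>v (i + N) * y ^ Suc (i + N)\<bar> = \<bar>v (i + N)\<bar> * y ^ Suc (i + N)"
          using y2 by (simp add: abs_mult)
        also have "\<dots> \<le> M * y ^ Suc (i + N)" using y2 v by (intro mult_right_mono) auto
        finally show "\<bar>v (i + N) * y ^ Suc (i + N)\<bar> \<le> M * y ^ Suc N * y ^ i"
          by (simp add: power_add mult_ac)
      qed
      also have "\<dots> = M * y ^ Suc N * (1 / (1 - y))" using g by (simp add: sums_iff)
      also have "\<dots> \<le> M * h ^ Suc N * 2"
        using y2 M0 by (intro mult_mono power_mono) (auto simp: divide_simps)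
      finally have tail: "\<bar>\<Sum>i. v (i + N) * y ^ Suc (i + N)\<bar> \<le> 2 * M * h ^ Suc N" by simp
      have "(\<Sum>k\<le>N. c k * x ^ k) = (\<Sum>i<N. v i * y ^ Suc i)"
        by (simp add: lessThan_Suc_atMost[symmetric] sum.lessThan_Suc_shift c_def y_def power_mult_distrib mult_ac
             del: sum.lessThan_Suc)
      also have "\<dots> = (\<Sum>i. v i * y ^ Suc i) - (\<Sum>i. v (i + N) * y ^ Suc (i + N))"
        using suminf_split_initial_segment[OF summable_rabs_cancel[OF s], of N] by simp
      finally show ?thesis using tail small[rule_format, OF y] by linarith
    qed
    then have "\<bar>c (Suc i)\<bar> \<le> A * (\<epsilon> + 2 * M * h ^ Suc N)" using A i by auto
    then show "\<bar>v i\<bar> * h ^ Suc i \<le> A * (\<epsilon> + 2 * M * h ^ Suc N)"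
      using h by (simp add: c_def abs_mult)
  qed
qed

text \<open>From \<open>s0\<close> every \<open>s\<close> is reached by doublings, and the increments form a geometric series.\<close>

lemma bounded_of_dyadic_decay:
  fixes f :: "real \<Rightarrow> real"
  assumes "s0 > 0" "p > 0" "D \<ge> 0"
    and step: "\<And>s t. s0 \<le> s \<Longrightarrow> s \<le> t \<Longrightarrow> t \<le> 2 * s \<Longrightarrow> \<bar>f t - f s\<bar> \<le> D * s powr (-p)"
  shows "\<exists>B. \<forall>s\<ge>s0. \<bar>f s\<bar> \<le> B"
proof -
  define r where "r = (2::real) powr (-p)"
  have r: "0 < r" "r < 1" using \<open>p > 0\<close> by (auto simp: r_def powr_minus inverse_less_1_iff)
  define D' where "D' = D * s0 powr (-p)"
  have D': "D' \<ge> 0" using assms by (simp add: D'_def)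
  have sr: "summable (\<lambda>i. r ^ i)" using r by (intro summable_geometric) auto
  have *: "\<bar>f s - f s0\<bar> \<le> D' * (\<Sum>i<n. r ^ i)" if "s0 \<le> s" "s \<le> 2 ^ n * s0" for s n
    using that
  proof (induction n arbitrary: s)
    case 0
    then have "s = s0" by simp
    then show ?case by simp
  next
    case (Suc n)
    have pr: "D * (2 ^ n * s0) powr (-p) = D' * r ^ n"
      using \<open>s0 > 0\<close> by (simp add: D'_def r_def powr_mult powr_realpow[symmetric] powr_powr mult_ac)
    show ?case
    proof (cases "s \<le> 2 ^ n * s0")
      case True
      have "D' * (\<Sum>i<n. r ^ i) \<le> D' * (\<Sum>i<Suc n. r ^ i)"
        using r D' by (intro mult_left_mono) auto
      then show ?thesis using Suc.IH[OF Suc.prems(1) True] by linarith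
    next
      case False
      have b: "s0 \<le> 2 ^ n * s0" using \<open>s0 > 0\<close> by simp
      have "\<bar>f s - f (2 ^ n * s0)\<bar> \<le> D' * r ^ n"
        using step[OF b, of s] False Suc.prems pr by simp
      moreover have "\<bar>f (2 ^ n * s0) - f s0\<bar> \<le> D' * (\<Sum>i<n. r ^ i)"
        by (rule Suc.IH[OF b]) simp
      ultimately show ?thesis by (simp add: distrib_left)
    qed
  qed
  have "\<bar>f s\<bar> \<le> \<bar>f s0\<bar> + D' * (\<Sum>i. r ^ i)" if "s \<ge> s0" for s
  proof -
    obtain n :: nat where "s / s0 < 2 ^ n" using real_arch_pow[of 2 "s / s0"] by auto
    then have "s \<le> 2 ^ n * s0" using \<open>s0 > 0\<close> by (simp add: field_simps)
    from *[OF that this] have "\<bar>f s - f s0\<bar> \<le> D' * (\<Sum>i<n. r ^ i)" .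
    also have "\<dots> \<le> D' * (\<Sum>i. r ^ i)"
      using D' r sr by (intro mult_left_mono sum_le_suminf) auto
    finally show ?thesis by linarith
  qed
  then show ?thesis by blast
qed

section \<open>Traces from determinant asymptotics\<close>

lemma harm_le_self: "harm n \<le> real n"
proof -
  have "harm n \<le> (\<Sum>k=1..n. 1::real)" unfolding harm_def
    by (intro sum_mono) (auto simp: inverse_le_1_iff)
  then show ?thesis by simp
qed

text \<open>The argument \<open>\<tau> i s\<close> stands for the trace of the \<open>(i + 1)\<close>-st power, and \<open>c \<sigma>\<close> for the part of
  the asymptotics that does not depend on \<open>s\<close>. Only the difference of the asymptotics at
  \<open>s\<close> and \<open>t\<close> is used, in which \<open>c\<close> cancels.\<close>

lemma traces_from_determinant_asymptotics:
  fixes \<tau> :: "nat \<Rightarrow> real \<Rightarrow> real" and c :: "real \<Rightarrow> complex"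
  assumes tau_le: "\<And>i s. s > 0 \<Longrightarrow> \<bar>\<tau> i s\<bar> \<le> 2 * s / pi"
    and asym: "\<forall>\<^sub>F s in at_top. \<forall>\<sigma>\<in>{0..1/2}.
      norm (complex_of_real (- (\<Sum>i. \<tau> i s / real (Suc i) * \<sigma> ^ Suc i))
        - (complex_of_real (2 * s / pi * ln (1 - \<sigma>) + (ln (1 - \<sigma>))\<^sup>2 / (2 * pi\<^sup>2) * ln (4 * s)) + c \<sigma>))
      \<le> C * (ln s / s)"
    and "s1 > 0"
  shows "\<exists>B. \<forall>s\<ge>s1. \<bar>\<tau> i s - 2 * s / pi + harm i / pi\<^sup>2 * ln (4 * s)\<bar> \<le> B"
proof -
  define u where "u i s = \<tau> i s - 2 * s / pi + harm i / pi\<^sup>2 * ln (4 * s)" for i s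
  let ?main = "\<lambda>\<sigma> s. 2 * s / pi * ln (1 - \<sigma>) + (ln (1 - \<sigma>))\<^sup>2 / (2 * pi\<^sup>2) * ln (4 * s)"
  have u_sums: "(\<lambda>i. u i s / real (Suc i) * \<sigma> ^ Suc i) sums
      ((\<Sum>i. \<tau> i s / real (Suc i) * \<sigma> ^ Suc i) + ?main \<sigma> s)"
    if \<sigma>: "\<sigma> \<in> {0..1/2}" and s: "s > 0" for \<sigma> s
  proof -
    have "\<bar>\<sigma>\<bar> < 1" using \<sigma> by auto
    note L = ln_one_minus_sums[OF this] ln_squared_sums[OF this]
    have "summable (\<lambda>i. 2 * s / pi * (1/2) ^ Suc i)"
      by (intro summable_mult) (simp add: summable_geometric)
    then have "summable (\<lambda>i. \<tau> i s / real (Suc i) * \<sigma> ^ Suc i)"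
    proof (rule summable_comparison_test')
      fix i
      have "norm (\<tau> i s / real (Suc i) * \<sigma> ^ Suc i) = \<bar>\<tau> i s\<bar> / real (Suc i) * \<sigma> ^ Suc i"
        using \<sigma> by (simp add: abs_mult)
      also have "\<dots> \<le> 2 * s / pi / 1 * (1/2) ^ Suc i"
        using \<sigma> tau_le[OF s, of i] s by (intro mult_mono frac_le power_mono) auto
      finally show "norm (\<tau> i s / real (Suc i) * \<sigma> ^ Suc i) \<le> 2 * s / pi * (1/2) ^ Suc i" by simp
    qed
    then have 1: "(\<lambda>i. \<tau> i s / real (Suc i) * \<sigma> ^ Suc i) sums (\<Sum>i. \<tau> i s / real (Suc i) * \<sigma> ^ Suc i)"
      by (rule summable_sums)
    have "(\<lambda>i. \<tau> i s / real (Suc i) * \<sigma> ^ Suc i - 2 * s / pi * (\<sigma> ^ Suc i / real (Suc i))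
          + ln (4 * s) / (2 * pi\<^sup>2) * (2 * harm i / real (Suc i) * \<sigma> ^ Suc i)) sums
       ((\<Sum>i. \<tau> i s / real (Suc i) * \<sigma> ^ Suc i) - 2 * s / pi * (- ln (1 - \<sigma>))
          + ln (4 * s) / (2 * pi\<^sup>2) * (ln (1 - \<sigma>))\<^sup>2)"
      by (intro sums_add sums_diff sums_mult 1 L)
    moreover have "\<tau> i s / real (Suc i) * \<sigma> ^ Suc i - 2 * s / pi * (\<sigma> ^ Suc i / real (Suc i))
          + ln (4 * s) / (2 * pi\<^sup>2) * (2 * harm i / real (Suc i) * \<sigma> ^ Suc i)
        = u i s / real (Suc i) * \<sigma> ^ Suc i" for i
      by (simp add: u_def divide_simps del: of_nat_Suc power_Suc) (simp add: algebra_simps del: of_nat_Suc power_Suc)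
    ultimately show ?thesis by (simp add: algebra_simps)
  qed
  have u_le: "\<bar>u i s / real (Suc i)\<bar> \<le> 3 * s" if "s \<ge> 1" for i s
  proof -
    have p3: "pi > 3" by (rule pi_gt3)
    have "0 \<le> ln (4 * s)" "ln (4 * s) \<le> 4 * s" using that ln_le_minus_one[of "4 * s"] by auto
    have "harm i * ln (4 * s) \<le> real (Suc i) * (4 * s)"
      using harm_le_self[of i] \<open>0 \<le> ln (4 * s)\<close> \<open>ln (4 * s) \<le> 4 * s\<close> that
      by (intro mult_mono) auto
    moreover have "4 \<le> pi\<^sup>2" using power_mono[of 2 pi 2] p3 by simp
    ultimately have "harm i * ln (4 * s) / pi\<^sup>2 \<le> real (Suc i) * (4 * s) / 4"
      using that by (intro frac_le) auto
    then have a: "harm i / pi\<^sup>2 * ln (4 * s) \<le> real (Suc i) * s" by simp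
    have b: "0 \<le> harm i / pi\<^sup>2 * ln (4 * s)" using harm_nonneg[of i, where ?'a = real] \<open>0 \<le> ln (4 * s)\<close> by simp
    have c: "2 * s / pi \<le> s" using p3 that by (simp add: divide_simps)
    have d: "s \<le> real (Suc i) * s" using that by simp
    have "\<bar>u i s\<bar> \<le> 3 * (real (Suc i) * s)"
      using a b c d tau_le[of s i] that unfolding u_def by linarith
    then show ?thesis by (simp add: abs_mult divide_simps mult_ac del: of_nat_Suc)
  qed
  \<comment> \<open>The interval has length \<open>h = s powr (- 1 / (4 K))\<close>, so dividing by \<open>h ^ K\<close> costs a factor
    \<open>s powr (1/4)\<close> only, while the cut-off at \<open>Suc N = 8 K\<close> leaves the tail \<open>O(s h ^ (8 K)) = O(1/s)\<close>.\<close>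
  define K where "K = Suc i"
  define N where "N = 8 * K - 1"
  have K: "K \<ge> 1" "Suc N = 8 * K" "i < N" by (auto simp: K_def N_def)
  obtain A where A0: "A \<ge> 0" and A: "\<forall>(v::nat \<Rightarrow> real) M \<epsilon> h. 0 < h \<longrightarrow> h \<le> 1/2 \<longrightarrow> (\<forall>i. \<bar>v i\<bar> \<le> M) \<longrightarrow>
     (\<forall>x\<in>{0..h}. \<bar>\<Sum>i. v i * x ^ Suc i\<bar> \<le> \<epsilon>) \<longrightarrow>
     (\<forall>i<N. \<bar>v i\<bar> * h ^ Suc i \<le> A * (\<epsilon> + 2 * M * h ^ Suc N))"
    using power_series_coeff_bound[of N] by (elim exE conjE)
  define C' where "C' = \<bar>C\<bar>"
  have "\<forall>\<^sub>F s::real in at_top. ln s / s \<le> s powr (-1/2)" by real_asymp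
  moreover have "\<forall>\<^sub>F s::real in at_top. s powr (- 1 / (4 * real K)) \<le> 1/2"
  proof -
    have "((\<lambda>s::real. s powr (- 1 / (4 * real K))) \<longlongrightarrow> 0) at_top"
      using K by (intro tendsto_neg_powr filterlim_ident) (simp add: divide_simps)
    from order_tendstoD(2)[OF this, of "1/2"] show ?thesis by (auto elim: eventually_mono)
  qed
  ultimately have "\<forall>\<^sub>F s in at_top. ln s / s \<le> s powr (-1/2) \<and> s powr (- 1 / (4 * real K)) \<le> 1/2 \<and>
      (\<forall>\<sigma>\<in>{0..1/2}.
      norm (complex_of_real (- (\<Sum>i. \<tau> i s / real (Suc i) * \<sigma> ^ Suc i))
        - (complex_of_real (?main \<sigma> s) + c \<sigma>)) \<le> C * (ln s / s))"
    using asym by (intro eventually_conj)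
  then obtain s0 where s0: "\<And>s. s \<ge> s0 \<Longrightarrow> ln s / s \<le> s powr (-1/2)"
      "\<And>s. s \<ge> s0 \<Longrightarrow> s powr (- 1 / (4 * real K)) \<le> 1/2"
      "\<And>s \<sigma>. s \<ge> s0 \<Longrightarrow> \<sigma>\<in>{0..1/2} \<Longrightarrow> 
      norm (complex_of_real (- (\<Sum>i. \<tau> i s / real (Suc i) * \<sigma> ^ Suc i))
        - (complex_of_real (?main \<sigma> s) + c \<sigma>)) \<le> C * (ln s / s)"
    unfolding eventually_at_top_linorder by blast
  define s2 where "s2 = max s0 1"
  define D where "D = real K * (A * (2 * C' + 18))"
  have D0: "D \<ge> 0" using A0 by (simp add: D_def C'_def)
  have "\<bar>u i t - u i s\<bar> \<le> D * s powr (- 1/4)" if s: "s2 \<le> s" "s \<le> t" "t \<le> 2 * s" for s t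
  proof -
    have s_ge: "s \<ge> s0" "s \<ge> 1" "t \<ge> s0" "t \<ge> 1" using s by (auto simp: s2_def)
    define h where "h = s powr (- 1 / (4 * real K))"
    have h: "0 < h" "h \<le> 1/2" using s0(2)[OF s_ge(1)] s_ge by (auto simp: h_def)
    define v where "v i = u i t / real (Suc i) - u i s / real (Suc i)" for i
    have v_le: "\<bar>v i\<bar> \<le> 9 * s" for i
      using u_le[OF s_ge(2), of i] u_le[OF s_ge(4), of i] s unfolding v_def by linarith
    have err: "\<bar>C * (ln r / r)\<bar> \<le> C' * s powr (-1/2)" if r: "r \<ge> s" for r
    proof -
      have "ln r / r \<le> r powr (-1/2)" using s0(1)[of r] r s_ge by linarith
      also have "\<dots> \<le> s powr (-1/2)" using r s_ge by (intro powr_mono2') auto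
      finally have "C' * \<bar>ln r / r\<bar> \<le> C' * s powr (-1/2)" using r s_ge by (intro mult_left_mono) (auto simp: C'_def)
      then show ?thesis by (simp add: abs_mult C'_def)
    qed
    have small: "\<bar>\<Sum>i. v i * \<sigma> ^ Suc i\<bar> \<le> 2 * C' * s powr (-1/2)" if \<sigma>: "\<sigma> \<in> {0..h}" for \<sigma>
    proof -
      have \<sigma>2: "\<sigma> \<in> {0..1/2}" using \<sigma> h by auto
      let ?F = "\<lambda>s. (\<Sum>i. \<tau> i s / real (Suc i) * \<sigma> ^ Suc i) + ?main \<sigma> s"
      have "(\<lambda>i. v i * \<sigma> ^ Suc i) sums (?F t - ?F s)"
        using sums_diff[OF u_sums[OF \<sigma>2, of t] u_sums[OF \<sigma>2, of s]] s_ge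
        unfolding v_def left_diff_distrib by auto
      then have eq: "(\<Sum>i. v i * \<sigma> ^ Suc i) = ?F t - ?F s" by (simp add: sums_iff)
      let ?G = "\<lambda>s. complex_of_real (- (\<Sum>i. \<tau> i s / real (Suc i) * \<sigma> ^ Suc i))
        - (complex_of_real (?main \<sigma> s) + c \<sigma>)"
      have "complex_of_real (?F t - ?F s) = ?G s - ?G t" by simp
      then have "\<bar>?F t - ?F s\<bar> = norm (?G s - ?G t)" by (simp only: norm_of_real[symmetric, where ?'a = complex])
      also have "\<dots> \<le> norm (?G s) + norm (?G t)" by (rule norm_triangle_ineq4)
      also have "\<dots> \<le> C * (ln s / s) + C * (ln t / t)"
        using s0(3)[OF s_ge(1) \<sigma>2] s0(3)[OF s_ge(3) \<sigma>2] by (rule add_mono)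
      also have "\<dots> \<le> 2 * C' * s powr (-1/2)" using err[of s] err[of t] s by linarith
      finally show ?thesis using eq by simp
    qed
    have "\<bar>v i\<bar> * h ^ Suc i \<le> A * (2 * C' * s powr (-1/2) + 2 * (9 * s) * h ^ Suc N)"
      using v_le small by (intro A[rule_format, OF h _ _ K(3)])
    also have "h ^ Suc i = s powr (-1/4)"
      using s_ge K by (simp add: h_def powr_realpow[symmetric] powr_powr K_def[symmetric] del: power_Suc)
    also have "h ^ Suc N = s powr (-2)"
      using s_ge K by (simp add: h_def powr_realpow[symmetric] powr_powr del: power_Suc)
    also have "2 * (9 * s) * s powr (-2) = 18 * s powr (-1)"
      using s_ge powr_mult_base[of s "-2"] by simp
    also have "A * (2 * C' * s powr (-1/2) + 18 * s powr (-1)) \<le> A * (2 * C' * s powr (-1/2) + 18 * s powr (-1/2))"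
      using s_ge A0 by (intro mult_left_mono add_mono powr_mono) (auto simp: C'_def)
    also have "\<dots> = A * (2 * C' + 18) * s powr (-1/4) * s powr (-1/4)"
      using s_ge by (simp add: powr_add[symmetric] algebra_simps)
    finally have "\<bar>v i\<bar> \<le> A * (2 * C' + 18) * s powr (-1/4)"
      using s_ge by (simp add: mult_le_cancel_right)
    then have "real K * \<bar>v i\<bar> \<le> D * s powr (-1/4)"
      unfolding D_def mult.assoc by (intro mult_left_mono) auto
    moreover have "real K * \<bar>v i\<bar> = \<bar>u i t - u i s\<bar>"
    proof -
      have "u i t - u i s = real K * v i" by (simp add: v_def K_def diff_divide_distrib[symmetric] del: of_nat_Suc)
      then show ?thesis by (simp add: abs_mult)
    qed
    ultimately show ?thesis by simp
  qed
  then have "\<bar>u i t - u i s\<bar> \<le> D * s powr - (1/4)" if "s2 \<le> s" "s \<le> t" "t \<le> 2 * s" for s t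
    using that by simp
  then have "\<exists>B. \<forall>s\<ge>s2. \<bar>u i s\<bar> \<le> B"
    by (rule bounded_of_dyadic_decay[of s2 "1/4" D "u i", rotated 3]) (auto simp: s2_def D0)
  then obtain B where B: "\<And>s. s \<ge> s2 \<Longrightarrow> \<bar>u i s\<bar> \<le> B" by blast
  \<comment> \<open>On the bounded range between \<open>s1\<close> and \<open>s2\<close> every term of \<open>u i s\<close> is bounded.\<close>
  have "\<bar>u i s\<bar> \<le> \<bar>B\<bar> + (4 * s2 / pi + harm i / pi\<^sup>2 * (\<bar>ln (4 * s1)\<bar> + \<bar>ln (4 * s2)\<bar>))" if s: "s \<ge> s1" for s
  proof (cases "s \<ge> s2")
    case True
    have "0 \<le> 4 * s2 / pi + harm i / pi\<^sup>2 * (\<bar>ln (4 * s1)\<bar> + \<bar>ln (4 * s2)\<bar>)"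
      using harm_nonneg[of i, where ?'a = real] by (auto simp: s2_def intro!: add_nonneg_nonneg)
    then show ?thesis using B[OF True] by linarith
  next
    case False
    have "ln (4 * s1) \<le> ln (4 * s)" "ln (4 * s) \<le> ln (4 * s2)" using False s \<open>s1 > 0\<close> by auto
    then have "\<bar>ln (4 * s)\<bar> \<le> \<bar>ln (4 * s1)\<bar> + \<bar>ln (4 * s2)\<bar>" by linarith
    then have "harm i / pi\<^sup>2 * \<bar>ln (4 * s)\<bar> \<le> harm i / pi\<^sup>2 * (\<bar>ln (4 * s1)\<bar> + \<bar>ln (4 * s2)\<bar>)"
      using harm_nonneg[of i, where ?'a = real] by (intro mult_left_mono) auto
    moreover have "\<bar>harm i / pi\<^sup>2 * ln (4 * s)\<bar> = harm i / pi\<^sup>2 * \<bar>ln (4 * s)\<bar>"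
      using harm_nonneg[of i, where ?'a = real] by (simp add: abs_mult)
    moreover have "2 * s / pi \<le> 2 * s2 / pi" using False by (intro divide_right_mono) auto
    moreover have "\<bar>\<tau> i s\<bar> \<le> 2 * s / pi" using tau_le[of s i] s \<open>s1 > 0\<close> by simp
    moreover have "0 \<le> 2 * s / pi" using s \<open>s1 > 0\<close> by simp
    ultimately show ?thesis unfolding u_def by linarith
  qed
  then show ?thesis unfolding u_def by blast
qed

section \<open>Plemelj's formula for Fredholm's determinant\<close>

definition bounded_kernel :: "'a measure \<Rightarrow> ('a \<Rightarrow> 'a \<Rightarrow> real) \<Rightarrow> bool" where
  "bounded_kernel M h \<longleftrightarrow> case_prod h \<in> borel_measurable (M \<Otimes>\<^sub>M M) \<and>
     (\<exists>B. \<forall>x\<in>space M. \<forall>y\<in>space M. \<bar>h x y\<bar> \<le> B)"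

definition kernel_comp :: "'a measure \<Rightarrow> ('a \<Rightarrow> 'a \<Rightarrow> real) \<Rightarrow> ('a \<Rightarrow> 'a \<Rightarrow> real) \<Rightarrow> 'a \<Rightarrow> 'a \<Rightarrow> real" where
  "kernel_comp M k h x y = (LINT z|M. k x z * h z y)"

primrec iterated_kernel :: "'a measure \<Rightarrow> ('a \<Rightarrow> 'a \<Rightarrow> real) \<Rightarrow> nat \<Rightarrow> 'a \<Rightarrow> 'a \<Rightarrow> real" where
  "iterated_kernel M k 0 = k"
| "iterated_kernel M k (Suc n) = kernel_comp M k (iterated_kernel M k n)"

definition kernel_trace :: "'a measure \<Rightarrow> ('a \<Rightarrow> 'a \<Rightarrow> real) \<Rightarrow> real" where
  "kernel_trace M h = (LINT x|M. h x x)"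

text \<open>The integral of one term of the Leibniz formula. The rows may carry different kernels, and the
  indices range over an arbitrary finite set, so that rows can be split off and merged without
  renumbering the variables.\<close>

definition perm_integral ::
  "'a measure \<Rightarrow> nat set \<Rightarrow> (nat \<Rightarrow> 'a \<Rightarrow> 'a \<Rightarrow> real) \<Rightarrow> (nat \<Rightarrow> nat) \<Rightarrow> real" where
  "perm_integral M S K p = (LINT x|PiM S (\<lambda>_. M). (\<Prod>i\<in>S. K i (x i) (x (p i))))"

definition det_integral :: "'a measure \<Rightarrow> nat set \<Rightarrow> (nat \<Rightarrow> 'a \<Rightarrow> 'a \<Rightarrow> real) \<Rightarrow> real" where
  "det_integral M S K = (\<Sum>p | p permutes S. of_int (sign p) * perm_integral M S K p)"

lemma bounded_kernelE:
  assumes "bounded_kernel M h"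
  obtains B where "B \<ge> 0" "\<And>x y. x \<in> space M \<Longrightarrow> y \<in> space M \<Longrightarrow> \<bar>h x y\<bar> \<le> B"
proof -
  from assms obtain B where "\<forall>x\<in>space M. \<forall>y\<in>space M. \<bar>h x y\<bar> \<le> B"
    by (auto simp: bounded_kernel_def)
  then show ?thesis by (intro that[of "\<bar>B\<bar>"]) fastforce+
qed

lemma bounded_kernel_measurable:
  "bounded_kernel M h \<Longrightarrow> case_prod h \<in> borel_measurable (M \<Otimes>\<^sub>M M)"
  by (simp add: bounded_kernel_def)

lemma bounded_kernel_measurable':
  assumes h: "bounded_kernel M h" and "f \<in> measurable N M" "g \<in> measurable N M"
  shows "(\<lambda>x. h (f x) (g x)) \<in> borel_measurable N"
  using measurable_compose[OF measurable_Pair[OF assms(2,3)] bounded_kernel_measurable[OF h]] by simp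

lemma (in finite_measure) bounded_kernel_comp:
  assumes k: "bounded_kernel M k" and h: "bounded_kernel M h"
  shows "bounded_kernel M (kernel_comp M k h)"
proof -
  obtain B where B: "B \<ge> 0" "\<And>x y. x \<in> space M \<Longrightarrow> y \<in> space M \<Longrightarrow> \<bar>k x y\<bar> \<le> B"
    using bounded_kernelE[OF k] by blast
  obtain C where C: "C \<ge> 0" "\<And>x y. x \<in> space M \<Longrightarrow> y \<in> space M \<Longrightarrow> \<bar>h x y\<bar> \<le> C"
    using bounded_kernelE[OF h] by blast
  have "(\<lambda>p. LINT z|M. k (fst p) z * h z (snd p)) \<in> borel_measurable (M \<Otimes>\<^sub>M M)"
  proof (rule borel_measurable_lebesgue_integral)
    have "(\<lambda>q. k (fst (fst q)) (snd q) * h (snd q) (snd (fst q))) \<in> borel_measurable ((M \<Otimes>\<^sub>M M) \<Otimes>\<^sub>M M)"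
      by (intro borel_measurable_times bounded_kernel_measurable'[OF k] bounded_kernel_measurable'[OF h]) simp_all
    then show "(\<lambda>(p, z). k (fst p) z * h z (snd p)) \<in> borel_measurable ((M \<Otimes>\<^sub>M M) \<Otimes>\<^sub>M M)"
      by (simp add: case_prod_beta')
  qed
  then have "case_prod (kernel_comp M k h) \<in> borel_measurable (M \<Otimes>\<^sub>M M)"
    by (simp add: kernel_comp_def case_prod_beta')
  moreover have "\<bar>kernel_comp M k h x y\<bar> \<le> B * C * measure M (space M)" if "x \<in> space M" "y \<in> space M" for x y
  proof -
    have "\<bar>k x z * h z y\<bar> \<le> B * C" if "z \<in> space M" for z
      unfolding abs_mult using B C that \<open>x \<in> space M\<close> \<open>y \<in> space M\<close> by (intro mult_mono) auto
    moreover have "integrable M (\<lambda>z. k x z * h z y)"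
      by (intro integrable_const_bound[where B = "B * C"] AE_I2 borel_measurable_times
          bounded_kernel_measurable'[OF k] bounded_kernel_measurable'[OF h])
         (use that calculation in auto)
    ultimately have "(LINT z|M. \<bar>k x z * h z y\<bar>) \<le> (LINT z|M. B * C)"
      by (intro integral_mono) auto
    then have "\<bar>LINT z|M. k x z * h z y\<bar> \<le> (LINT z|M. B * C)"
      using integral_abs_bound[of M "\<lambda>z. k x z * h z y"] by linarith
    then show ?thesis by (simp add: kernel_comp_def mult_ac)
  qed
  ultimately show ?thesis unfolding bounded_kernel_def by blast
qed

lemma (in finite_measure) bounded_iterated_kernel:
  "bounded_kernel M k \<Longrightarrow> bounded_kernel M (iterated_kernel M k n)"
  by (induction n) (simp_all add: bounded_kernel_comp)

lemma (in finite_measure) finite_measure_PiM: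
  assumes "finite S"
  shows "finite_measure (PiM S (\<lambda>_. M))"
proof -
  interpret product_sigma_finite "\<lambda>_. M" by unfold_locales
  show ?thesis
    by (rule finite_measureI)
       (simp add: space_PiM emeasure_PiM assms ennreal_prod_eq_top emeasure_finite less_top[symmetric] power_eq_top_ennreal)
qed

lemma (in finite_measure) integrable_perm_product:
  assumes "finite S" "p permutes S" "\<And>i. i \<in> S \<Longrightarrow> bounded_kernel M (K i)"
  shows "integrable (PiM S (\<lambda>_. M)) (\<lambda>x. \<Prod>i\<in>S. K i (x i) (x (p i)))"
proof -
  interpret P: finite_measure "PiM S (\<lambda>_. M)" using assms(1) by (rule finite_measure_PiM)
  have "\<forall>i\<in>S. \<exists>B. \<forall>x\<in>space M. \<forall>y\<in>space M. \<bar>K i x y\<bar> \<le> B"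
    using assms(3) by (auto simp: bounded_kernel_def)
  then obtain B where B: "\<And>i x y. i \<in> S \<Longrightarrow> x \<in> space M \<Longrightarrow> y \<in> space M \<Longrightarrow> \<bar>K i x y\<bar> \<le> B i"
    by metis
  show ?thesis
  proof (rule P.integrable_const_bound[where B = "\<Prod>i\<in>S. B i"], intro AE_I2)
    fix x assume "x \<in> space (PiM S (\<lambda>_. M))"
    then have "x i \<in> space M" if "i \<in> S" for i using that by (auto simp: space_PiM)
    then show "norm (\<Prod>i\<in>S. K i (x i) (x (p i))) \<le> (\<Prod>i\<in>S. B i)"
      unfolding real_norm_def abs_prod using permutes_in_image[OF assms(2)] by (intro prod_mono) (auto intro: B)
  next
    show "(\<lambda>x. \<Prod>i\<in>S. K i (x i) (x (p i))) \<in> borel_measurable (PiM S (\<lambda>_. M))"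
      using permutes_in_image[OF assms(2)]
      by (intro borel_measurable_prod bounded_kernel_measurable'[OF assms(3)] measurable_component_singleton) auto
  qed
qed

lemma (in finite_measure) perm_integral_fixpoint:
  assumes S: "finite S" "a \<notin> S" and q: "q permutes S"
    and k: "bounded_kernel M k" and h: "bounded_kernel M h"
  shows "perm_integral M (insert a S) ((\<lambda>_. k)(a := h)) q = kernel_trace M h * perm_integral M S (\<lambda>_. k) q"
proof -
  interpret product_sigma_finite "\<lambda>_. M" by unfold_locales
  have q': "q permutes insert a S" using q by (rule permutes_subset) auto
  have "perm_integral M (insert a S) ((\<lambda>_. k)(a := h)) q =
    (LINT x|PiM S (\<lambda>_. M). LINT y|M. (\<Prod>i\<in>insert a S. ((\<lambda>_. k)(a := h)) i ((x(a := y)) i) ((x(a := y)) (q i))))"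
    unfolding perm_integral_def
    by (rule product_integral_insert[OF S integrable_perm_product]) (use S q' k h in auto)
  also have "\<dots> = (LINT x|PiM S (\<lambda>_. M). kernel_trace M h * (\<Prod>i\<in>S. k (x i) (x (q i))))"
  proof (rule Bochner_Integration.integral_cong[OF refl])
    fix x
    have "(\<Prod>i\<in>insert a S. ((\<lambda>_. k)(a := h)) i ((x(a := y)) i) ((x(a := y)) (q i)))
        = h y y * (\<Prod>i\<in>S. k (x i) (x (q i)))" for y
    proof -
      have "q a = a" using q S by (simp add: permutes_not_in)
      moreover have "q i \<noteq> a" if "i \<in> S" for i using permutes_in_image[OF q] that S by metis
      ultimately show ?thesis using S by (auto intro!: prod.cong)
    qed
    then show "(LINT y|M. (\<Prod>i\<in>insert a S. ((\<lambda>_. k)(a := h)) i ((x(a := y)) i) ((x(a := y)) (q i))))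
      = kernel_trace M h * (\<Prod>i\<in>S. k (x i) (x (q i)))"
      by (simp add: kernel_trace_def)
  qed
  finally show ?thesis by (simp add: perm_integral_def)
qed

text \<open>If \<open>a\<close> lies on a cycle with other indices, say \<open>j \<mapsto> a \<mapsto> q j\<close>, then \<open>x\<^sub>a\<close> occurs only in
  \<open>k(x\<^sub>j, x\<^sub>a) h(x\<^sub>a, x\<^bsub>q j\<^esub>)\<close>. Integrating it out removes \<open>a\<close> from the cycle and puts the
  composed kernel into row \<open>j\<close>.\<close>

lemma (in finite_measure) perm_integral_contract:
  assumes S: "finite S" "a \<notin> S" and q: "q permutes S" and j: "j \<in> S"
    and k: "bounded_kernel M k" and h: "bounded_kernel M h"
  shows "perm_integral M (insert a S) ((\<lambda>_. k)(a := h)) (Transposition.transpose a (q j) \<circ> q)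
       = perm_integral M S ((\<lambda>_. k)(j := kernel_comp M k h)) q"
proof -
  interpret product_sigma_finite "\<lambda>_. M" by unfold_locales
  let ?p = "Transposition.transpose a (q j) \<circ> q"
  have qS: "q i \<in> S" if "i \<in> S" for i using permutes_in_image[OF q] that by simp
  have p: "?p permutes insert a S"
    by (rule permutes_compose[OF permutes_subset[OF q] permutes_swap_id]) (use qS j in auto)
  have qa: "q a = a" using q S by (simp add: permutes_not_in)
  have pa: "?p a = q j" by (simp add: qa)
  have pj: "?p j = a" by simp
  have p_other: "?p i = q i" if "i \<in> S - {j}" for i
  proof -
    have "q i \<noteq> q j" using that permutes_inj[OF q] by (auto dest: injD)
    moreover have "q i \<noteq> a" using qS[of i] that S by auto
    ultimately show ?thesis by (simp add: transpose_apply_other)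
  qed
  have "perm_integral M (insert a S) ((\<lambda>_. k)(a := h)) ?p =
    (LINT x|PiM S (\<lambda>_. M). LINT y|M. (\<Prod>i\<in>insert a S. ((\<lambda>_. k)(a := h)) i ((x(a := y)) i) ((x(a := y)) (?p i))))"
    unfolding perm_integral_def
    by (rule product_integral_insert[OF S integrable_perm_product[OF _ p]]) (use S k h in auto)
  also have "\<dots> = perm_integral M S ((\<lambda>_. k)(j := kernel_comp M k h)) q"
    unfolding perm_integral_def
  proof (rule Bochner_Integration.integral_cong[OF refl])
    fix x
    let ?R = "\<Prod>i\<in>S - {j}. k (x i) (x (q i))"
    have "(\<Prod>i\<in>insert a S. ((\<lambda>_. k)(a := h)) i ((x(a := y)) i) ((x(a := y)) (?p i)))
        = (k (x j) y * h y (x (q j))) * ?R" for y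
    proof -
      have "(\<Prod>i\<in>insert a S. ((\<lambda>_. k)(a := h)) i ((x(a := y)) i) ((x(a := y)) (?p i)))
         = h y ((x(a := y)) (?p a)) * (\<Prod>i\<in>S. k (x i) ((x(a := y)) (?p i)))"
        using S by (auto intro!: prod.cong)
      also have "(x(a := y)) (?p a) = x (q j)" unfolding pa using qS[OF j] S by auto
      also have "(\<Prod>i\<in>S. k (x i) ((x(a := y)) (?p i)))
          = k (x j) y * (\<Prod>i\<in>S - {j}. k (x i) ((x(a := y)) (?p i)))"
        by (subst prod.remove[OF S(1) j]) (simp add: pj del: comp_apply)
      also have "(\<Prod>i\<in>S - {j}. k (x i) ((x(a := y)) (?p i))) = ?R"
      proof (rule prod.cong[OF refl])
        fix i assume i: "i \<in> S - {j}"
        have "q i \<noteq> a" using qS[of i] i S by auto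
        then show "k (x i) ((x(a := y)) (?p i)) = k (x i) (x (q i))" using p_other[OF i] by simp
      qed
      finally show ?thesis by (simp add: mult_ac)
    qed
    then have "(LINT y|M. (\<Prod>i\<in>insert a S. ((\<lambda>_. k)(a := h)) i ((x(a := y)) i) ((x(a := y)) (?p i))))
        = kernel_comp M k h (x j) (x (q j)) * ?R"
      by (simp add: kernel_comp_def)
    also have "?R = (\<Prod>i\<in>S - {j}. ((\<lambda>_. k)(j := kernel_comp M k h)) i (x i) (x (q i)))"
      by (rule prod.cong) auto
    also have "kernel_comp M k h (x j) (x (q j)) * \<dots> = (\<Prod>i\<in>S. ((\<lambda>_. k)(j := kernel_comp M k h)) i (x i) (x (q i)))"
      by (subst prod.remove[OF S(1) j]) simp
    finally show "(LINT y|M. (\<Prod>i\<in>insert a S. ((\<lambda>_. k)(a := h)) i ((x(a := y)) i) ((x(a := y)) (?p i))))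
        = (\<Prod>i\<in>S. ((\<lambda>_. k)(j := kernel_comp M k h)) i (x i) (x (q i)))" .
  qed
  finally show ?thesis .
qed

text \<open>Every permutation of \<open>insert a S\<close> is \<open>transpose a b \<circ> q\<close> for a permutation \<open>q\<close> of \<open>S\<close>. For
  \<open>b = a\<close> the index \<open>a\<close> is fixed and contributes a trace. Otherwise \<open>b = q j\<close> for exactly one
  \<open>j\<close>, the sign changes, and \<open>a\<close> is integrated out.\<close>

lemma (in finite_measure) det_integral_expand:
  assumes S: "finite S" "a \<notin> S"
    and k: "bounded_kernel M k" and h: "bounded_kernel M h"
  shows "det_integral M (insert a S) ((\<lambda>_. k)(a := h)) =
     kernel_trace M h * det_integral M S (\<lambda>_. k)
     - (\<Sum>j\<in>S. det_integral M S ((\<lambda>_. k)(j := kernel_comp M k h)))"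
proof -
  let ?K = "(\<lambda>_. k)(a := h)" and ?L = "\<lambda>j. (\<lambda>_. k)(j := kernel_comp M k h)"
  let ?f = "\<lambda>p. of_int (sign p) * perm_integral M (insert a S) ?K p"
  have fin: "finite {p. p permutes S}" using S by (simp add: finite_permutations)
  have "det_integral M (insert a S) ?K = (\<Sum>b\<in>insert a S. \<Sum>q | q permutes S. ?f (Transposition.transpose a b \<circ> q))"
    unfolding det_integral_def by (rule sum_over_permutations_insert[OF S])
  also have "\<dots> = (\<Sum>q | q permutes S. ?f q) + (\<Sum>q | q permutes S. \<Sum>b\<in>S. ?f (Transposition.transpose a b \<circ> q))"
    using S by (simp add: sum.swap[of _ S])
  also have "(\<Sum>q | q permutes S. ?f q) = kernel_trace M h * det_integral M S (\<lambda>_. k)"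
    unfolding det_integral_def sum_distrib_left
    by (intro sum.cong) (auto simp: perm_integral_fixpoint[OF S _ k h])
  also have "(\<Sum>q | q permutes S. \<Sum>b\<in>S. ?f (Transposition.transpose a b \<circ> q))
      = (\<Sum>q | q permutes S. \<Sum>j\<in>S. - (of_int (sign q) * perm_integral M S (?L j) q))"
  proof (rule sum.cong[OF refl])
    fix q assume "q \<in> {q. q permutes S}"
    then have q: "q permutes S" by simp
    have "(\<Sum>b\<in>S. ?f (Transposition.transpose a b \<circ> q)) = (\<Sum>j\<in>S. ?f (Transposition.transpose a (q j) \<circ> q))"
      by (rule sum.reindex_bij_betw[OF permutes_imp_bij[OF q], symmetric])
    also have "\<dots> = (\<Sum>j\<in>S. - (of_int (sign q) * perm_integral M S (?L j) q))"
    proof (rule sum.cong[OF refl])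
      fix j assume j: "j \<in> S"
      have "q j \<noteq> a" using j S permutes_in_image[OF q] by metis
      then have "sign (Transposition.transpose a (q j) \<circ> q) = - sign q"
        using permutation_permutes q S(1)
        by (subst sign_compose) (auto simp: sign_swap_id permutation_swap_id)
      then show "?f (Transposition.transpose a (q j) \<circ> q) = - (of_int (sign q) * perm_integral M S (?L j) q)"
        using perm_integral_contract[OF S q j k h] by simp
    qed
    finally show "(\<Sum>b\<in>S. ?f (Transposition.transpose a b \<circ> q)) = \<dots>" .
  qed
  also have "\<dots> = - (\<Sum>j\<in>S. det_integral M S (?L j))"
    unfolding det_integral_def by (subst sum.swap) (simp add: sum_negf)
  finally show ?thesis by (simp only: add_uminus_conv_diff)
qed

text \<open>The coefficients of \<open>exp (- \<Sum>\<^sub>i t\<^sub>i x\<^bsup>i+1\<^esup> / (i + 1))\<close>: the recursion is the differential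
  equation \<open>A' = - (\<Sum>\<^sub>i t\<^sub>i x\<^sup>i) A\<close> read coefficientwise.\<close>

fun plemelj_coeff :: "(nat \<Rightarrow> real) \<Rightarrow> nat \<Rightarrow> real" where
  "plemelj_coeff t 0 = 1"
| "plemelj_coeff t (Suc n) = - (\<Sum>i\<le>n. t i * plemelj_coeff t (n - i)) / real (Suc n)"

text \<open>Iterating the expansion along the same cycle replaces the kernel of the distinguished row by
  ever higher iterates. The inner induction computes the determinants with such a row from those
  of smaller size, and the iterate \<open>0\<close> is \<open>k\<close> itself, which closes the outer one. That the value
  depends on \<open>S\<close> only through its cardinality comes out of the induction.\<close>

lemma (in finite_measure) det_integral_eq_plemelj:
  assumes k: "bounded_kernel M k"
  defines "t \<equiv> \<lambda>i. kernel_trace M (iterated_kernel M k i)"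
  shows "finite S \<Longrightarrow> det_integral M S (\<lambda>_. k) = (-1) ^ card S * fact (card S) * plemelj_coeff t (card S)"
proof (induction "card S" arbitrary: S rule: less_induct)
  case less
  have IH: "det_integral M S' (\<lambda>_. k) = (-1) ^ card S' * fact (card S') * plemelj_coeff t (card S')"
    if "finite S'" "card S' < card S" for S' using less that by blast
  have row: "det_integral M (insert a S') ((\<lambda>_. k)(a := iterated_kernel M k m)) =
     (-1) ^ card S' * fact (card S') * (\<Sum>i\<le>card S'. t (i + m) * plemelj_coeff t (card S' - i))"
    if "finite S'" "a \<notin> S'" "card S' < card S" for S' a m
    using that
  proof (induction "card S'" arbitrary: S' a m)
    case 0
    then have "S' = {}" by simp
    then show ?case using 0 IH[OF 0(2)]
      by (subst det_integral_expand[OF 0(2,3) k bounded_iterated_kernel[OF k]]) (simp add: t_def)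
  next
    case (Suc n)
    have "det_integral M S' ((\<lambda>_. k)(j := kernel_comp M k (iterated_kernel M k m))) =
       (-1) ^ n * fact n * (\<Sum>i\<le>n. t (Suc (i + m)) * plemelj_coeff t (n - i))" if "j \<in> S'" for j
    proof -
      have "card (S' - {j}) = n" using Suc that by simp
      then show ?thesis using Suc(1)[of "S' - {j}" j "Suc m"] Suc that by (simp add: insert_absorb)
    qed
    then have "(\<Sum>j\<in>S'. det_integral M S' ((\<lambda>_. k)(j := kernel_comp M k (iterated_kernel M k m))))
       = real (Suc n) * ((-1) ^ n * fact n * (\<Sum>i\<le>n. t (Suc (i + m)) * plemelj_coeff t (n - i)))"
      using Suc(2) by simp
    note rows = this
    let ?Q = "\<Sum>i\<le>n. t (Suc (i + m)) * plemelj_coeff t (n - i)"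
    have cn: "card S' = Suc n" using Suc(2) by simp
    have "det_integral M (insert a S') ((\<lambda>_. k)(a := iterated_kernel M k m))
       = t m * det_integral M S' (\<lambda>_. k)
         - (\<Sum>j\<in>S'. det_integral M S' ((\<lambda>_. k)(j := kernel_comp M k (iterated_kernel M k m))))"
      unfolding t_def by (rule det_integral_expand[OF Suc(3,4) k bounded_iterated_kernel[OF k]])
    also have "\<dots> = t m * ((-1) ^ Suc n * fact (Suc n) * plemelj_coeff t (Suc n)) - real (Suc n) * ((-1) ^ n * fact n * ?Q)"
      by (simp only: rows IH[OF Suc(3,5)] cn)
    also have "\<dots> = (-1) ^ Suc n * fact (Suc n) * (t m * plemelj_coeff t (Suc n) + ?Q)"
      by (simp add: algebra_simps del: plemelj_coeff.simps)
    also have "t m * plemelj_coeff t (Suc n) + ?Q = (\<Sum>i\<le>Suc n. t (i + m) * plemelj_coeff t (Suc n - i))"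
      by (subst sum.atMost_Suc_shift) simp
    finally show ?case by (simp only: cn)
  qed
  show ?case
  proof (cases "card S")
    case 0
    then have "S = {}" using less by simp
    then show ?thesis by (simp add: det_integral_def perm_integral_def
         permutes_empty lebesgue_integral_count_space_finite PiM_empty)
  next
    case (Suc n)
    then obtain a where "a \<in> S" by fastforce
    then have "card (S - {a}) = n" "insert a (S - {a}) = S" using Suc less by auto
    moreover have "(\<lambda>_. k)(a := k) = (\<lambda>_. k)" by auto
    moreover have "real (Suc n) \<noteq> 0" by simp
    ultimately show ?thesis using row[of "S - {a}" a 0] Suc less(2)
      by (simp del: of_nat_Suc fun_upd_apply)
  qed
qed

text \<open>The majorant is the coefficient of \<open>(1 - x) powr (- L)\<close>, that is, the case \<open>t\<^sub>i = - L\<close>.\<close>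

lemma plemelj_coeff_bound:
  assumes t: "\<And>i. \<bar>t i\<bar> \<le> L"
  shows "\<bar>plemelj_coeff t n\<bar> \<le> pochhammer L n / fact n"
proof (induction n rule: less_induct)
  case (less n)
  have L0: "L \<ge> 0" using t[of 0] by linarith
  let ?b = "\<lambda>n. pochhammer L n / fact n :: real"
  have sum_b: "(\<Sum>j\<le>n. L * ?b j) = real (Suc n) * ?b (Suc n)" for n
  proof (induction n)
    case 0
    show ?case by simp
  next
    case (Suc n)
    have "real (Suc (Suc n)) * ?b (Suc (Suc n)) = (L + real (Suc n)) * ?b (Suc n)"
      by (subst pochhammer_Suc, subst fact_Suc) (simp add: mult_ac del: of_nat_Suc fact_Suc)
    with Suc show ?case by (simp only: sum.atMost_Suc distrib_right)
  qed
  show ?case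
  proof (cases n)
    case 0
    then show ?thesis by simp
  next
    case (Suc m)
    have "\<bar>\<Sum>i\<le>m. t i * plemelj_coeff t (m - i)\<bar> \<le> (\<Sum>i\<le>m. L * ?b (m - i))"
    proof (rule order_trans[OF sum_abs sum_mono])
      fix i assume "i \<in> {..m}"
      then have "\<bar>plemelj_coeff t (m - i)\<bar> \<le> ?b (m - i)" using less[of "m - i"] Suc by simp
      then show "\<bar>t i * plemelj_coeff t (m - i)\<bar> \<le> L * ?b (m - i)"
        unfolding abs_mult using t[of i] L0 by (intro mult_mono) auto
    qed
    also have "\<dots> = (\<Sum>i\<le>m. L * ?b i)"
      using sum.nat_diff_reindex[of "\<lambda>i. L * ?b i" "Suc m"] by (simp add: lessThan_Suc_atMost)
    also have "\<dots> = real (Suc m) * ?b (Suc m)" by (rule sum_b)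
    finally show ?thesis unfolding Suc plemelj_coeff.simps
      by (simp add: divide_le_eq mult.commute del: of_nat_Suc)
  qed
qed

lemma plemelj_coeff_summable:
  assumes t: "\<And>i. \<bar>t i\<bar> \<le> L" and x: "\<bar>x\<bar> < 1"
  shows "summable (\<lambda>n. \<bar>plemelj_coeff t n * x ^ n\<bar>)"
proof (rule summable_comparison_test')
  have "(\<lambda>n. ((- L) gchoose n) * (- \<bar>x\<bar>) ^ n) sums (1 + (- \<bar>x\<bar>)) powr (- L)"
    using x by (intro gen_binomial_real) auto
  also have "(\<lambda>n. ((- L) gchoose n) * (- \<bar>x\<bar>) ^ n) = (\<lambda>n. pochhammer L n / fact n * \<bar>x\<bar> ^ n)"
  proof
    show "((- L) gchoose n) * (- \<bar>x\<bar>) ^ n = pochhammer L n / fact n * \<bar>x\<bar> ^ n" for n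
      by (cases "even n") (simp_all add: gbinomial_pochhammer)
  qed
  finally show "summable (\<lambda>n. pochhammer L n / fact n * \<bar>x\<bar> ^ n)" by (rule sums_summable)
  fix n
  show "norm \<bar>plemelj_coeff t n * x ^ n\<bar> \<le> pochhammer L n / fact n * \<bar>x\<bar> ^ n"
    using mult_right_mono[OF plemelj_coeff_bound[of t L n, OF t], of "\<bar>x\<bar> ^ n"]
    by (simp add: abs_mult power_abs)
qed

text \<open>With \<open>A\<close> the series on the left, \<open>G\<close> the one in the exponent and \<open>T = G'\<close>, the Cauchy product
  gives \<open>A' = - T A\<close>, so \<open>A exp G\<close> is constant.\<close>

lemma plemelj_coeff_sums_exp:
  assumes t: "\<And>i. \<bar>t i\<bar> \<le> L" and x: "\<bar>x\<bar> < 1"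
  shows "(\<Sum>n. plemelj_coeff t n * x ^ n) = exp (- (\<Sum>i. t i / real (Suc i) * x ^ Suc i))"
proof -
  let ?a = "plemelj_coeff t"
  define g where "g n = (case n of 0 \<Rightarrow> 0 | Suc i \<Rightarrow> t i / real (Suc i))" for n
  have sum_t: "summable (\<lambda>n. \<bar>t n * x ^ n\<bar>)" if "\<bar>x\<bar> < 1" for x
  proof (rule summable_comparison_test')
    show "summable (\<lambda>n. L * \<bar>x\<bar> ^ n)" using that by (intro summable_mult summable_geometric) auto
    show "norm \<bar>t n * x ^ n\<bar> \<le> L * \<bar>x\<bar> ^ n" for n
      using t[of n] by (auto simp: abs_mult power_abs intro!: mult_right_mono)
  qed
  have sum_g: "summable (\<lambda>n. g n * x ^ n)" if "\<bar>x\<bar> < 1" for x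
  proof -
    have "summable (\<lambda>n. t n / real (Suc n) * x ^ Suc n)"
    proof (rule summable_comparison_test')
      show "summable (\<lambda>n. \<bar>x\<bar> * \<bar>t n * x ^ n\<bar>)" using sum_t[OF that] by (rule summable_mult)
      fix n
      have "\<bar>t n\<bar> / real (Suc n) \<le> \<bar>t n\<bar> / 1" by (intro divide_left_mono) auto
      then have "\<bar>t n\<bar> / real (Suc n) * \<bar>x ^ Suc n\<bar> \<le> \<bar>t n\<bar> * \<bar>x ^ Suc n\<bar>" by (intro mult_right_mono) auto
      then show "norm (t n / real (Suc n) * x ^ Suc n) \<le> \<bar>x\<bar> * \<bar>t n * x ^ n\<bar>"
        by (simp add: abs_mult mult_ac)
    qed
    then show ?thesis using summable_Suc_iff[of "\<lambda>n. g n * x ^ n"] by (simp add: g_def)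
  qed
  define A where "A x = (\<Sum>n. ?a n * x ^ n)" for x
  define G where "G x = (\<Sum>n. g n * x ^ n)" for x
  define T where "T x = (\<Sum>n. t n * x ^ n)" for x
  have between: "\<exists>K::real. \<bar>K\<bar> < 1 \<and> norm x < norm K" if "\<bar>x\<bar> < 1" for x :: real
    using that by (intro exI[of _ "(1 + \<bar>x\<bar>) / 2"]) auto
  have DA: "(A has_field_derivative - T x * A x) (at x)" if x: "\<bar>x\<bar> < 1" for x
  proof -
    obtain K :: real where K: "\<bar>K\<bar> < 1" "norm x < norm K" using between[OF x] by blast
    have "(A has_field_derivative (\<Sum>n. diffs ?a n * x ^ n)) (at x)"
      unfolding A_def by (rule termdiffs_strong[OF summable_rabs_cancel[OF plemelj_coeff_summable[OF t K(1)]] K(2)])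
    also have "(\<lambda>n. diffs ?a n * x ^ n) = (\<lambda>n. - (\<Sum>i\<le>n. (t i * x ^ i) * (?a (n - i) * x ^ (n - i))))"
    proof
      fix n
      have "(\<Sum>i\<le>n. (t i * x ^ i) * (?a (n - i) * x ^ (n - i))) = (\<Sum>i\<le>n. t i * ?a (n - i)) * x ^ n"
        unfolding sum_distrib_right by (intro sum.cong) (auto simp: power_add[symmetric] mult_ac)
      then show "diffs ?a n * x ^ n = - (\<Sum>i\<le>n. (t i * x ^ i) * (?a (n - i) * x ^ (n - i)))"
        by (simp add: diffs_def del: of_nat_Suc)
    qed
    also have "(\<Sum>n. - (\<Sum>i\<le>n. (t i * x ^ i) * (?a (n - i) * x ^ (n - i)))) = - T x * A x"
    proof -
      have "(\<lambda>n. \<Sum>i\<le>n. (t i * x ^ i) * (?a (n - i) * x ^ (n - i))) sums (T x * A x)"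
        unfolding T_def A_def
        by (rule Cauchy_product_sums) (use sum_t[OF x] plemelj_coeff_summable[OF t x] in simp_all)
      from sums_unique[OF sums_minus[OF this]] show ?thesis by simp
    qed
    finally show ?thesis .
  qed
  have DG: "(G has_field_derivative T x) (at x)" if x: "\<bar>x\<bar> < 1" for x
  proof -
    obtain K :: real where K: "\<bar>K\<bar> < 1" "norm x < norm K" using between[OF x] by blast
    have "(G has_field_derivative (\<Sum>n. diffs g n * x ^ n)) (at x)"
      unfolding G_def by (rule termdiffs_strong[OF sum_g[OF K(1)] K(2)])
    also have "(\<lambda>n. diffs g n * x ^ n) = (\<lambda>n. t n * x ^ n)"
      by (simp add: diffs_def g_def del: of_nat_Suc)
    finally show ?thesis by (simp add: T_def)
  qed
  have "\<exists>c. \<forall>x\<in>{-1<..<1}. A x * exp (G x) = c"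
  proof (rule has_field_derivative_zero_constant)
    fix x :: real assume "x \<in> {-1<..<1}"
    then have "\<bar>x\<bar> < 1" by auto
    note DA[OF this] DG[OF this]
    then have "((\<lambda>x. A x * exp (G x)) has_field_derivative 0) (at x)"
      by (auto intro!: derivative_eq_intros simp: algebra_simps)
    then show "((\<lambda>x. A x * exp (G x)) has_field_derivative 0) (at x within {-1<..<1})"
      by (rule has_field_derivative_at_within)
  qed simp
  then obtain c where c: "\<And>x. x \<in> {-1<..<1} \<Longrightarrow> A x * exp (G x) = c" by blast
  have "A 0 * exp (G 0) = 1"
    by (simp add: A_def G_def g_def)
  then have "A x * exp (G x) = 1" using c[of 0] c[of x] x by (auto simp: abs_less_iff)
  then have "A x = exp (- G x)" by (simp add: exp_minus divide_simps)
  moreover have "G x = (\<Sum>i. t i / real (Suc i) * x ^ Suc i)"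
    unfolding G_def using suminf_split_head[OF sum_g[OF x]] by (simp add: g_def)
  ultimately show ?thesis by (simp add: A_def)
qed

lemma (in finite_measure) fredholm_det_eq_exp:
  assumes k: "bounded_kernel M k"
    and L: "\<And>i. \<bar>kernel_trace M (iterated_kernel M k i)\<bar> \<le> L" and x: "\<bar>x\<bar> < 1"
  shows "fredholm_det M (\<lambda>u v. x * k u v)
       = exp (- (\<Sum>i. kernel_trace M (iterated_kernel M k i) / real (Suc i) * x ^ Suc i))"
proof -
  let ?t = "\<lambda>i. kernel_trace M (iterated_kernel M k i)"
  have "(-1) ^ n / fact n * (LINT y|PiM {..<n} (\<lambda>_. M). Determinant.det (mat n n (\<lambda>(i, j). x * k (y i) (y j))))
      = plemelj_coeff ?t n * x ^ n" for n
  proof -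
    have "Determinant.det (mat n n (\<lambda>(i, j). x * k (y i) (y j)))
        = (\<Sum>p | p permutes {..<n}. of_int (sign p) * x ^ n * (\<Prod>i<n. k (y i) (y (p i))))" for y
    proof -
      have "Determinant.det (mat n n (\<lambda>(i, j). x * k (y i) (y j)))
        = (\<Sum>p | p permutes {..<n}. of_int (sign p) * (\<Prod>i<n. mat n n (\<lambda>(i, j). x * k (y i) (y j)) $$ (i, p i)))"
        by (subst det_def'[of _ n]) (simp_all add: atLeast0LessThan)
      also have "\<dots> = (\<Sum>p | p permutes {..<n}. of_int (sign p) * (\<Prod>i<n. x * k (y i) (y (p i))))"
      proof (intro sum.cong arg_cong2[where f = "(*)"] prod.cong refl)
        fix p i assume "p \<in> {p. p permutes {..<n}}" "i \<in> {..<n}"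
        then have "i < n" "p i < n" using permutes_in_image[of p "{..<n}" i] by auto
        then show "mat n n (\<lambda>(i, j). x * k (y i) (y j)) $$ (i, p i) = x * k (y i) (y (p i))" by simp
      qed
      finally show ?thesis by (simp add: prod.distrib mult_ac)
    qed
    then have "(LINT y|PiM {..<n} (\<lambda>_. M). Determinant.det (mat n n (\<lambda>(i, j). x * k (y i) (y j))))
      = (LINT y|PiM {..<n} (\<lambda>_. M). (\<Sum>p | p permutes {..<n}. of_int (sign p) * x ^ n * (\<Prod>i<n. k (y i) (y (p i)))))"
      by simp
    also have "\<dots> = (\<Sum>p | p permutes {..<n}. of_int (sign p) * x ^ n * perm_integral M {..<n} (\<lambda>_. k) p)"
      unfolding perm_integral_def
      by (subst Bochner_Integration.integral_sum) (auto intro!: integrable_perm_product k)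
    also have "\<dots> = x ^ n * det_integral M {..<n} (\<lambda>_. k)"
      by (simp add: det_integral_def sum_distrib_left mult_ac)
    also have "\<dots> = x ^ n * ((-1) ^ n * fact n * plemelj_coeff ?t n)"
      using det_integral_eq_plemelj[OF k, of "{..<n}"] by simp
    finally show ?thesis by (cases "even n") simp_all
  qed
  then show ?thesis unfolding fredholm_det_def using plemelj_coeff_sums_exp[OF L x] by simp
qed

section \<open>The geometry of square-integrable functions\<close>

lemma L2_measurable: "f \<in> L2 M \<Longrightarrow> f \<in> borel_measurable M"
  and L2_integrable_square: "f \<in> L2 M \<Longrightarrow> integrable M (\<lambda>x. (norm (f x))\<^sup>2)"
  by (simp_all add: L2_def)

lemma L2_integrable_norm_mult:
  assumes f: "f \<in> L2 M" and g: "g \<in> L2 M"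
  shows "integrable M (\<lambda>x. norm (f x) * norm (g x))"
proof (rule Bochner_Integration.integrable_bound)
  show "integrable M (\<lambda>x. (norm (f x))\<^sup>2 + (norm (g x))\<^sup>2)"
    using f g by (intro Bochner_Integration.integrable_add L2_integrable_square)
  show "(\<lambda>x. norm (f x) * norm (g x)) \<in> borel_measurable M"
    using L2_measurable[OF f] L2_measurable[OF g] by measurable
  show "AE x in M. norm (norm (f x) * norm (g x)) \<le> norm ((norm (f x))\<^sup>2 + (norm (g x))\<^sup>2)"
  proof (rule AE_I2)
    fix x
    have "2 * (norm (f x) * norm (g x)) \<le> (norm (f x))\<^sup>2 + (norm (g x))\<^sup>2"
      using sum_squares_bound[of "norm (f x)" "norm (g x)"] by simp
    moreover have "0 \<le> norm (f x) * norm (g x)" by simp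
    ultimately have "norm (f x) * norm (g x) \<le> (norm (f x))\<^sup>2 + (norm (g x))\<^sup>2" by linarith
    then show "norm (norm (f x) * norm (g x)) \<le> norm ((norm (f x))\<^sup>2 + (norm (g x))\<^sup>2)"
      by simp
  qed
qed

lemma L2_integrable_cnj_mult:
  assumes f: "f \<in> L2 M" and g: "g \<in> L2 M"
  shows "integrable M (\<lambda>x. cnj (f x) * g x)"
proof (rule Bochner_Integration.integrable_bound[OF L2_integrable_norm_mult[OF f g]])
  have "cnj \<in> borel_measurable borel" by (intro borel_measurable_continuous_onI continuous_intros)
  then have "(\<lambda>x. cnj (f x)) \<in> borel_measurable M"
    using L2_measurable[OF f] by (rule measurable_compose[rotated])
  then show "(\<lambda>x. cnj (f x) * g x) \<in> borel_measurable M"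
    using L2_measurable[OF g] by (rule borel_measurable_times)
qed (simp add: norm_mult)

lemma L2_cmult: 
  assumes "f \<in> L2 M" shows "(\<lambda>x. c * f x) \<in> L2 M"
  using assms by (auto simp: L2_def norm_mult power_mult_distrib)

lemma L2_add:
  assumes f: "f \<in> L2 M" and g: "g \<in> L2 M"
  shows "(\<lambda>x. f x + g x) \<in> L2 M"
  unfolding L2_def
proof (intro CollectI conjI)
  show m: "(\<lambda>x. f x + g x) \<in> borel_measurable M" using L2_measurable[OF f] L2_measurable[OF g] by measurable
  show "integrable M (\<lambda>x. (norm (f x + g x))\<^sup>2)"
  proof (rule Bochner_Integration.integrable_bound)
    show "integrable M (\<lambda>x. 2 * (norm (f x))\<^sup>2 + 2 * (norm (g x))\<^sup>2)"
      using f g by (intro Bochner_Integration.integrable_add integrable_mult_right L2_integrable_square)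
    show "(\<lambda>x. (norm (f x + g x))\<^sup>2) \<in> borel_measurable M" using m by measurable
    show "AE x in M. norm ((norm (f x + g x))\<^sup>2) \<le> norm (2 * (norm (f x))\<^sup>2 + 2 * (norm (g x))\<^sup>2)"
    proof (rule AE_I2)
      fix x
      have "(norm (f x + g x))\<^sup>2 \<le> (norm (f x) + norm (g x))\<^sup>2"
        by (intro power_mono norm_triangle_ineq) simp
      also have "\<dots> \<le> 2 * (norm (f x))\<^sup>2 + 2 * (norm (g x))\<^sup>2"
        using sum_squares_bound[of "norm (f x)" "norm (g x)"] by (simp add: power2_sum)
      finally show "norm ((norm (f x + g x))\<^sup>2) \<le> norm (2 * (norm (f x))\<^sup>2 + 2 * (norm (g x))\<^sup>2)"
        by simp
    qed
  qed
qed

lemma L2_zero: "(\<lambda>x. 0) \<in> L2 M" by (simp add: L2_def)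

lemma L2_sum: "(\<And>i. i \<in> F \<Longrightarrow> f i \<in> L2 M) \<Longrightarrow> (\<lambda>x. \<Sum>i\<in>F. f i x) \<in> L2 M"
  by (induction F rule: infinite_finite_induct) (auto simp: L2_zero L2_add)

lemma L2_diff: "f \<in> L2 M \<Longrightarrow> g \<in> L2 M \<Longrightarrow> (\<lambda>x. f x - g x) \<in> L2 M"
  using L2_add[of f M "\<lambda>x. (-1) * g x"] L2_cmult[of g M "-1"] by simp

lemma L2_inner_add_right:
  "f \<in> L2 M \<Longrightarrow> g \<in> L2 M \<Longrightarrow> h \<in> L2 M \<Longrightarrow>
   L2_inner M f (\<lambda>x. g x + h x) = L2_inner M f g + L2_inner M f h"
  by (simp add: L2_inner_def distrib_left L2_integrable_cnj_mult)

lemma L2_inner_diff_right: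
  "f \<in> L2 M \<Longrightarrow> g \<in> L2 M \<Longrightarrow> h \<in> L2 M \<Longrightarrow>
   L2_inner M f (\<lambda>x. g x - h x) = L2_inner M f g - L2_inner M f h"
  by (simp add: L2_inner_def right_diff_distrib L2_integrable_cnj_mult)

lemma L2_inner_cmult_right: "L2_inner M f (\<lambda>x. c * g x) = c * L2_inner M f g"
  by (simp add: L2_inner_def mult.left_commute[of _ c])

lemma L2_inner_commute: "L2_inner M f g = cnj (L2_inner M g f)"
proof -
  have "cnj (L2_inner M g f) = (LINT x|M. cnj (cnj (g x) * f x))"
    unfolding L2_inner_def by (rule Bochner_Integration.integral_cnj[symmetric])
  also have "\<dots> = L2_inner M f g"
    unfolding L2_inner_def by (rule Bochner_Integration.integral_cong) (auto simp: mult.commute)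
  finally show ?thesis by simp
qed

lemma L2_inner_sum_right:
  "f \<in> L2 M \<Longrightarrow> (\<And>i. i \<in> F \<Longrightarrow> g i \<in> L2 M) \<Longrightarrow>
   L2_inner M f (\<lambda>x. \<Sum>i\<in>F. g i x) = (\<Sum>i\<in>F. L2_inner M f (g i))"
proof (induction F rule: infinite_finite_induct)
  case (insert a F)
  then show ?case using L2_inner_add_right[of f M "g a" "\<lambda>x. \<Sum>i\<in>F. g i x"] L2_sum[of F g M] by simp
qed (simp_all add: L2_inner_def)

lemma L2_norm_nonneg: "L2_norm M f \<ge> 0"
  by (simp add: L2_norm_def)

lemma L2_norm_power2: "(L2_norm M f)\<^sup>2 = (LINT x|M. (norm (f x))\<^sup>2)"
  by (simp add: L2_norm_def)

lemma L2_inner_self: "L2_inner M f f = of_real ((L2_norm M f)\<^sup>2)"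
proof -
  have "cnj (f x) * f x = of_real ((norm (f x))\<^sup>2)" for x
    by (simp only: mult.commute[of "cnj (f x)"] complex_norm_square)
  then show ?thesis unfolding L2_inner_def L2_norm_power2 by (simp only: integral_complex_of_real)
qed

lemma L2_norm_cmult: "L2_norm M (\<lambda>x. c * f x) = norm c * L2_norm M f"
  by (simp add: L2_norm_def norm_mult power_mult_distrib real_sqrt_mult)

text \<open>The integral of \<open>(\<parallel>g\<parallel> \<bar>f\<bar> - \<parallel>f\<parallel> \<bar>g\<bar>)\<^sup>2\<close> is nonnegative. Dividing by
  \<open>\<parallel>f\<parallel> \<parallel>g\<parallel>\<close> is possible unless one of the functions vanishes almost everywhere.\<close>

lemma L2_integral_norm_mult_le:
  assumes f: "f \<in> L2 M" and g: "g \<in> L2 M"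
  shows "(LINT x|M. norm (f x) * norm (g x)) \<le> L2_norm M f * L2_norm M g"
proof -
  let ?A = "L2_norm M f" and ?B = "L2_norm M g" and ?I = "LINT x|M. norm (f x) * norm (g x)"
  have zero: "(LINT x|M. norm (f x) * norm (g x)) = 0" if "f \<in> L2 M" "L2_norm M f = 0" for f g :: "'a \<Rightarrow> complex"
  proof -
    have "AE x in M. (norm (f x))\<^sup>2 = 0"
      using that by (subst integral_nonneg_eq_0_iff_AE[symmetric]) (auto simp: L2_integrable_square L2_norm_def)
    then have "AE x in M. norm (f x) * norm (g x) = 0" by eventually_elim simp
    then show ?thesis by (rule integral_eq_zero_AE)
  qed
  show ?thesis
  proof (cases "?A = 0 \<or> ?B = 0")
    case True
    then have "?I = 0" using zero[OF f, of g] zero[OF g, of f] by (auto simp: mult.commute)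
    then show ?thesis using True by auto
  next
    case False
    then have AB: "?A * ?B > 0" using L2_norm_nonneg[of M f] L2_norm_nonneg[of M g] by (simp add: less_le)
    have "0 \<le> (LINT x|M. (?B * norm (f x) - ?A * norm (g x))\<^sup>2)" by simp
    also have "(\<lambda>x. (?B * norm (f x) - ?A * norm (g x))\<^sup>2)
       = (\<lambda>x. ?B\<^sup>2 * (norm (f x))\<^sup>2 + ?A\<^sup>2 * (norm (g x))\<^sup>2 - 2 * (?A * ?B) * (norm (f x) * norm (g x)))"
      by (simp add: power2_eq_square algebra_simps fun_eq_iff)
    also have "integral\<^sup>L M \<dots> = ?B\<^sup>2 * ?A\<^sup>2 + ?A\<^sup>2 * ?B\<^sup>2 - 2 * (?A * ?B) * ?I"
      using L2_integrable_square[OF f] L2_integrable_square[OF g] L2_integrable_norm_mult[OF f g]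
      by (simp add: L2_norm_power2)
    finally have "(?A * ?B) * ?I \<le> (?A * ?B) * (?A * ?B)" by (simp add: power2_eq_square algebra_simps)
    then show ?thesis using AB by (simp add: mult_le_cancel_left)
  qed
qed

lemma L2_Cauchy_Schwarz:
  assumes f: "f \<in> L2 M" and g: "g \<in> L2 M"
  shows "norm (L2_inner M f g) \<le> L2_norm M f * L2_norm M g"
proof -
  have "norm (L2_inner M f g) \<le> (LINT x|M. norm (cnj (f x) * g x))"
    unfolding L2_inner_def by (rule integral_norm_bound)
  then show ?thesis using L2_integral_norm_mult_le[OF f g] by (simp add: norm_mult)
qed

lemma L2_norm_add_power2:
  assumes f: "f \<in> L2 M" and g: "g \<in> L2 M"
  shows "(L2_norm M (\<lambda>x. f x + g x))\<^sup>2 = (L2_norm M f)\<^sup>2 + 2 * Re (L2_inner M f g) + (L2_norm M g)\<^sup>2"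
proof -
  have "complex_of_real ((L2_norm M (\<lambda>x. f x + g x))\<^sup>2) = L2_inner M (\<lambda>x. f x + g x) (\<lambda>x. f x + g x)"
    by (rule L2_inner_self[symmetric])
  also have "\<dots> = L2_inner M (\<lambda>x. f x + g x) f + L2_inner M (\<lambda>x. f x + g x) g"
    using f g by (intro L2_inner_add_right L2_add)
  also have "\<dots> = cnj (L2_inner M f f + L2_inner M f g) + cnj (L2_inner M g f + L2_inner M g g)"
    using f g by (subst (1 2) L2_inner_commute) (simp add: L2_inner_add_right)
  also have "\<dots> = of_real ((L2_norm M f)\<^sup>2) + (L2_inner M f g + cnj (L2_inner M f g)) + of_real ((L2_norm M g)\<^sup>2)"
    by (simp add: L2_inner_self L2_inner_commute[of M g f])
  also have "\<dots> = of_real ((L2_norm M f)\<^sup>2 + 2 * Re (L2_inner M f g) + (L2_norm M g)\<^sup>2)"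
    by (simp add: complex_add_cnj)
  finally show ?thesis by (simp only: of_real_eq_iff)
qed

lemma L2_norm_triangle:
  assumes f: "f \<in> L2 M" and g: "g \<in> L2 M"
  shows "L2_norm M (\<lambda>x. f x + g x) \<le> L2_norm M f + L2_norm M g"
proof (rule power2_le_imp_le)
  have "Re (L2_inner M f g) \<le> L2_norm M f * L2_norm M g"
    using complex_Re_le_cmod L2_Cauchy_Schwarz[OF f g] by (rule order_trans)
  then show "(L2_norm M (\<lambda>x. f x + g x))\<^sup>2 \<le> (L2_norm M f + L2_norm M g)\<^sup>2"
    by (simp add: L2_norm_add_power2[OF f g] power2_sum)
qed (simp add: L2_norm_nonneg)

definition orthonormal_on :: "'a measure \<Rightarrow> 'i set \<Rightarrow> ('i \<Rightarrow> 'a \<Rightarrow> complex) \<Rightarrow> bool" where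
  "orthonormal_on M I e \<longleftrightarrow> (\<forall>i\<in>I. e i \<in> L2 M) \<and>
     (\<forall>i\<in>I. \<forall>j\<in>I. L2_inner M (e i) (e j) = (if i = j then 1 else 0))"

definition residual :: "'a measure \<Rightarrow> ('i \<Rightarrow> 'a \<Rightarrow> complex) \<Rightarrow> 'i set \<Rightarrow> ('a \<Rightarrow> complex) \<Rightarrow> 'a \<Rightarrow> complex" where
  "residual M e F f = (\<lambda>x. f x - (\<Sum>i\<in>F. L2_inner M (e i) f * e i x))"

lemma residual_in_L2: "orthonormal_on M F e \<Longrightarrow> f \<in> L2 M \<Longrightarrow> residual M e F f \<in> L2 M"
  unfolding residual_def orthonormal_on_def by (intro L2_diff L2_sum L2_cmult) auto

lemma L2_norm_residual:
  assumes e: "orthonormal_on M F e" and F: "finite F" and f: "f \<in> L2 M"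
  shows "(L2_norm M (residual M e F f))\<^sup>2 = (L2_norm M f)\<^sup>2 - (\<Sum>i\<in>F. (norm (L2_inner M (e i) f))\<^sup>2)"
proof -
  let ?p = "\<lambda>x. \<Sum>i\<in>F. L2_inner M (e i) f * e i x"
  have eL: "e i \<in> L2 M" if "i \<in> F" for i using e that by (auto simp: orthonormal_on_def)
  have p: "?p \<in> L2 M" by (intro L2_sum L2_cmult eL)
  have r: "residual M e F f \<in> L2 M" using residual_in_L2[OF e f] .
  have er: "L2_inner M (e j) (residual M e F f) = 0" if j: "j \<in> F" for j
  proof -
    have "L2_inner M (e j) ?p = (\<Sum>i\<in>F. L2_inner M (e i) f * L2_inner M (e j) (e i))"
      using eL j by (subst L2_inner_sum_right) (auto intro: L2_cmult simp: L2_inner_cmult_right)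
    also have "\<dots> = (\<Sum>i\<in>F. if j = i then L2_inner M (e i) f else 0)"
      using e j by (intro sum.cong) (auto simp: orthonormal_on_def)
    also have "\<dots> = L2_inner M (e j) f" using F j by simp
    finally show ?thesis unfolding residual_def
      by (subst L2_inner_diff_right) (use eL j f p in auto)
  qed
  have rp: "L2_inner M (residual M e F f) ?p = 0"
    using r eL er by (subst L2_inner_sum_right)
      (auto intro: L2_cmult simp: L2_inner_cmult_right L2_inner_commute[of M "residual M e F f"])
  have "complex_of_real ((L2_norm M (residual M e F f))\<^sup>2) = L2_inner M (residual M e F f) (\<lambda>x. f x - ?p x)"
    by (simp only: L2_inner_self[symmetric]) (simp only: residual_def)
  also have "\<dots> = L2_inner M (residual M e F f) f"
    using r f p rp by (simp add: L2_inner_diff_right)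
  also have "\<dots> = cnj (L2_inner M f (\<lambda>x. f x - ?p x))"
    by (subst L2_inner_commute) (simp add: residual_def)
  also have "\<dots> = cnj (L2_inner M f f - (\<Sum>i\<in>F. L2_inner M (e i) f * L2_inner M f (e i)))"
    using f p eL by (simp add: L2_inner_diff_right L2_inner_sum_right L2_cmult L2_inner_cmult_right)
  also have "(\<Sum>i\<in>F. L2_inner M (e i) f * L2_inner M f (e i)) = of_real (\<Sum>i\<in>F. (norm (L2_inner M (e i) f))\<^sup>2)"
    by (simp add: L2_inner_commute[of M f] complex_norm_square del: of_real_power)
  finally have "complex_of_real ((L2_norm M (residual M e F f))\<^sup>2)
      = of_real ((L2_norm M f)\<^sup>2 - (\<Sum>i\<in>F. (norm (L2_inner M (e i) f))\<^sup>2))"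
    by (simp add: L2_inner_self)
  then show ?thesis by (simp only: of_real_eq_iff)
qed

lemma L2_Bessel:
  assumes "orthonormal_on M F e" "finite F" "f \<in> L2 M"
  shows "(\<Sum>i\<in>F. (norm (L2_inner M (e i) f))\<^sup>2) \<le> (L2_norm M f)\<^sup>2"
  using L2_norm_residual[OF assms] zero_le_power2[of "L2_norm M (residual M e F f)"] by linarith

lemma L2_norm_residual_le:
  assumes "orthonormal_on M F e" "finite F" "f \<in> L2 M"
  shows "L2_norm M (residual M e F f) \<le> L2_norm M f"
proof (rule power2_le_imp_le)
  have "(\<Sum>i\<in>F. (norm (L2_inner M (e i) f))\<^sup>2) \<ge> 0" by (intro sum_nonneg) simp
  then show "(L2_norm M (residual M e F f))\<^sup>2 \<le> (L2_norm M f)\<^sup>2"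
    unfolding L2_norm_residual[OF assms] by linarith
qed (rule L2_norm_nonneg)

lemma L2_orthonormal_basis_iff:
  "L2_orthonormal_basis M e \<longleftrightarrow> orthonormal_on M UNIV e \<and>
     (\<forall>f\<in>L2 M. (\<lambda>N. L2_norm M (residual M e {..<N} f)) \<longlonglongrightarrow> 0)"
  by (auto simp: L2_orthonormal_basis_def orthonormal_on_def residual_def)

lemma orthonormal_on_subset: "orthonormal_on M I e \<Longrightarrow> J \<subseteq> I \<Longrightarrow> orthonormal_on M J e"
  unfolding orthonormal_on_def by (meson subsetD)

lemma L2_Parseval:
  assumes e: "L2_orthonormal_basis M e" and f: "f \<in> L2 M" and g: "g \<in> L2 M"
  shows "(\<lambda>n. L2_inner M f (e n) * L2_inner M (e n) g) sums L2_inner M f g"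
  unfolding sums_def
proof (rule LIM_zero_cancel, rule Lim_null_comparison)
  have on: "orthonormal_on M {..<N} e" for N
    using e orthonormal_on_subset[of M UNIV e] by (auto simp: L2_orthonormal_basis_iff)
  have eL: "e n \<in> L2 M" for n using on[of "Suc n"] by (auto simp: orthonormal_on_def)
  have "norm ((\<Sum>n<N. L2_inner M f (e n) * L2_inner M (e n) g) - L2_inner M f g)
      \<le> L2_norm M f * L2_norm M (residual M e {..<N} g)" for N
  proof -
    have "L2_inner M f (\<lambda>x. \<Sum>n<N. L2_inner M (e n) g * e n x) = (\<Sum>n<N. L2_inner M (e n) g * L2_inner M f (e n))"
      using f eL by (subst L2_inner_sum_right) (auto intro: L2_cmult simp: L2_inner_cmult_right)
    then have "L2_inner M f (residual M e {..<N} g) = L2_inner M f g - (\<Sum>n<N. L2_inner M f (e n) * L2_inner M (e n) g)"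
      unfolding residual_def using f g eL
      by (subst L2_inner_diff_right) (auto intro!: L2_sum L2_cmult sum.cong)
    then have "norm ((\<Sum>n<N. L2_inner M f (e n) * L2_inner M (e n) g) - L2_inner M f g)
      = norm (L2_inner M f (residual M e {..<N} g))"
      by (simp only: norm_minus_commute)
    also have "\<dots> \<le> L2_norm M f * L2_norm M (residual M e {..<N} g)"
      by (rule L2_Cauchy_Schwarz[OF f residual_in_L2[OF on g]])
    finally show ?thesis .
  qed
  then show "\<forall>\<^sub>F N in sequentially. norm ((\<Sum>n<N. L2_inner M f (e n) * L2_inner M (e n) g) - L2_inner M f g)
      \<le> L2_norm M f * L2_norm M (residual M e {..<N} g)"
    by simp
  have "(\<lambda>N. L2_norm M (residual M e {..<N} g)) \<longlonglongrightarrow> 0"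
    using e g by (simp add: L2_orthonormal_basis_iff)
  then show "(\<lambda>N. L2_norm M f * L2_norm M (residual M e {..<N} g)) \<longlonglongrightarrow> 0"
    by (rule tendsto_mult_right_zero)
qed

text \<open>The partial sums in Parseval's identity are bounded independently of the number of terms; this
  is the majorant for interchanging the sum over a basis with an integral over a parameter.\<close>

lemma L2_partial_Parseval_bound:
  assumes e: "orthonormal_on M F e" and F: "finite F" and f: "f \<in> L2 M" and g: "g \<in> L2 M"
  shows "norm (\<Sum>n\<in>F. L2_inner M f (e n) * L2_inner M (e n) g) \<le> L2_norm M f * L2_norm M g"
proof -
  have "norm (\<Sum>n\<in>F. L2_inner M f (e n) * L2_inner M (e n) g)
      \<le> (\<Sum>n\<in>F. \<bar>norm (L2_inner M (e n) f)\<bar> * \<bar>norm (L2_inner M (e n) g)\<bar>)"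
    by (rule order_trans[OF norm_sum]) (simp add: norm_mult L2_inner_commute[of M f])
  also have "\<dots> \<le> L2_set (\<lambda>n. norm (L2_inner M (e n) f)) F * L2_set (\<lambda>n. norm (L2_inner M (e n) g)) F"
    by (rule L2_set_mult_ineq)
  also have "\<dots> \<le> L2_norm M f * L2_norm M g"
    unfolding L2_set_def using L2_Bessel[OF e F f] L2_Bessel[OF e F g]
    by (intro mult_mono real_le_lsqrt) (auto simp: L2_norm_nonneg sum_nonneg)
  finally show ?thesis .
qed

text \<open>The closed span of an orthonormal sequence. Membership is convergence of the orthogonal expansion
  itself, which is the form in which completeness of a basis has to be established.\<close>

definition expandable :: "'a measure \<Rightarrow> (nat \<Rightarrow> 'a \<Rightarrow> complex) \<Rightarrow> ('a \<Rightarrow> complex) set" where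
  "expandable M e = {f \<in> L2 M. (\<lambda>N. L2_norm M (residual M e {..<N} f)) \<longlonglongrightarrow> 0}"

lemma residual_add:
  assumes "orthonormal_on M F e" "f \<in> L2 M" "g \<in> L2 M"
  shows "residual M e F (\<lambda>x. f x + g x) = (\<lambda>x. residual M e F f x + residual M e F g x)"
proof -
  have "L2_inner M (e i) (\<lambda>x. f x + g x) = L2_inner M (e i) f + L2_inner M (e i) g" if "i \<in> F" for i
    using assms that by (intro L2_inner_add_right) (auto simp: orthonormal_on_def)
  then show ?thesis by (simp add: residual_def distrib_right sum.distrib fun_eq_iff)
qed

lemma residual_cmult:
  "residual M e F (\<lambda>x. c * f x) = (\<lambda>x. c * residual M e F f x)"
  by (simp add: residual_def L2_inner_cmult_right sum_distrib_left right_diff_distrib mult_ac)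

context
  fixes M :: "'a measure" and e :: "nat \<Rightarrow> 'a \<Rightarrow> complex"
  assumes e: "orthonormal_on M UNIV e"
begin

lemma orthonormal_segment: "orthonormal_on M {..<N::nat} e"
  using e by (rule orthonormal_on_subset) simp

lemma expandable_add:
  assumes "f \<in> expandable M e" "g \<in> expandable M e"
  shows "(\<lambda>x. f x + g x) \<in> expandable M e"
proof -
  have fg: "f \<in> L2 M" "g \<in> L2 M" using assms by (auto simp: expandable_def)
  have "(\<lambda>N. L2_norm M (residual M e {..<N} (\<lambda>x. f x + g x))) \<longlonglongrightarrow> 0"
  proof (rule Lim_null_comparison)
    show "\<forall>\<^sub>F N in sequentially. norm (L2_norm M (residual M e {..<N} (\<lambda>x. f x + g x)))
        \<le> L2_norm M (residual M e {..<N} f) + L2_norm M (residual M e {..<N} g)"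
      using L2_norm_triangle[OF residual_in_L2[OF orthonormal_segment fg(1)] residual_in_L2[OF orthonormal_segment fg(2)]]
      by (simp add: residual_add[OF orthonormal_segment fg] L2_norm_nonneg)
    show "(\<lambda>N. L2_norm M (residual M e {..<N} f) + L2_norm M (residual M e {..<N} g)) \<longlonglongrightarrow> 0"
      using assms by (intro tendsto_add_zero) (auto simp: expandable_def)
  qed
  then show ?thesis using fg by (simp add: expandable_def L2_add)
qed

lemma expandable_cmult: "f \<in> expandable M e \<Longrightarrow> (\<lambda>x. c * f x) \<in> expandable M e"
  by (auto simp: expandable_def L2_cmult residual_cmult L2_norm_cmult intro: tendsto_mult_right_zero)

lemma expandable_zero: "(\<lambda>x. 0) \<in> expandable M e"
  by (simp add: expandable_def L2_zero residual_def L2_inner_def L2_norm_def)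

lemma expandable_sum: "(\<And>i. i \<in> F \<Longrightarrow> f i \<in> expandable M e) \<Longrightarrow> (\<lambda>x. \<Sum>i\<in>F. f i x) \<in> expandable M e"
  by (induction F rule: infinite_finite_induct) (auto simp: expandable_zero intro: expandable_add)

lemma expandable_diff: "f \<in> expandable M e \<Longrightarrow> g \<in> expandable M e \<Longrightarrow> (\<lambda>x. f x - g x) \<in> expandable M e"
  using expandable_add[of f "\<lambda>x. (-1) * g x"] expandable_cmult[of g "-1"] by simp

lemma expandable_basis: "e n \<in> expandable M e"
proof -
  have "residual M e {..<N} (e n) = (\<lambda>x. 0)" if "N > n" for N
  proof -
    have "(\<Sum>i<N. L2_inner M (e i) (e n) * e i x) = e n x" for x
    proof -
      have "(\<Sum>i<N. L2_inner M (e i) (e n) * e i x) = (\<Sum>i<N. if i = n then e i x else 0)"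
        using e by (intro sum.cong) (auto simp: orthonormal_on_def)
      then show ?thesis using that by simp
    qed
    then show ?thesis by (simp add: residual_def)
  qed
  then have "\<forall>\<^sub>F N in sequentially. L2_norm M (residual M e {..<N} (e n)) = 0"
    by (intro eventually_mono[OF eventually_gt_at_top[of n]]) (simp add: L2_norm_def)
  then show ?thesis using e by (auto simp: expandable_def orthonormal_on_def intro: tendsto_eventually)
qed

lemma expandable_limit:
  assumes f: "f \<in> L2 M" and g: "\<And>k. g k \<in> expandable M e"
    and lim: "(\<lambda>k. L2_norm M (\<lambda>x. f x - g k x)) \<longlonglongrightarrow> (0::real)"
  shows "f \<in> expandable M e"
proof -
  have gL: "g k \<in> L2 M" for k using g by (auto simp: expandable_def)
  have le: "L2_norm M (residual M e {..<N} f) \<le> L2_norm M (\<lambda>x. f x - g k x) + L2_norm M (residual M e {..<N} (g k))" for N k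
  proof -
    have d: "(\<lambda>x. f x - g k x) \<in> L2 M" using f gL by (rule L2_diff)
    have "L2_norm M (residual M e {..<N} f)
       = L2_norm M (\<lambda>x. residual M e {..<N} (\<lambda>x. f x - g k x) x + residual M e {..<N} (g k) x)"
      by (subst residual_add[OF orthonormal_segment d gL, symmetric]) simp
    also have "\<dots> \<le> L2_norm M (residual M e {..<N} (\<lambda>x. f x - g k x)) + L2_norm M (residual M e {..<N} (g k))"
      by (rule L2_norm_triangle[OF residual_in_L2[OF orthonormal_segment d] residual_in_L2[OF orthonormal_segment gL]])
    also have "L2_norm M (residual M e {..<N} (\<lambda>x. f x - g k x)) \<le> L2_norm M (\<lambda>x. f x - g k x)"
      by (rule L2_norm_residual_le[OF orthonormal_segment _ d]) simp
    finally show ?thesis by simp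
  qed
  have "(\<lambda>N. L2_norm M (residual M e {..<N} f)) \<longlonglongrightarrow> 0"
  proof (rule LIMSEQ_I)
    fix r :: real assume r: "r > 0"
    have "r / 2 > 0" using r by simp
    from LIMSEQ_D[OF lim this] obtain k where k': "\<forall>n\<ge>k. norm (L2_norm M (\<lambda>x. f x - g n x) - 0) < r / 2" ..
    have "norm (L2_norm M (\<lambda>x. f x - g k x) - 0) < r / 2" by (rule k'[rule_format]) simp
    then have k: "L2_norm M (\<lambda>x. f x - g k x) < r / 2" by (simp only: real_norm_def diff_0_right abs_less_iff)
    have "(\<lambda>N. L2_norm M (residual M e {..<N} (g k))) \<longlonglongrightarrow> 0" using g by (simp add: expandable_def)
    from LIMSEQ_D[OF this \<open>r / 2 > 0\<close>] obtain N0
      where N0: "\<forall>N\<ge>N0. norm (L2_norm M (residual M e {..<N} (g k)) - 0) < r / 2" ..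
    have "norm (L2_norm M (residual M e {..<N} f) - 0) < r" if "N \<ge> N0" for N
    proof -
      have "norm (L2_norm M (residual M e {..<N} (g k)) - 0) < r / 2" by (rule N0[rule_format, OF that])
      then have "L2_norm M (residual M e {..<N} (g k)) < r / 2"
        by (simp only: real_norm_def diff_0_right abs_less_iff)
      then have "L2_norm M (residual M e {..<N} f) < r" using le[of N k] k by linarith
      then show ?thesis by (simp add: L2_norm_nonneg)
    qed
    then show "\<exists>N0. \<forall>N\<ge>N0. norm (L2_norm M (residual M e {..<N} f) - 0) < r" by blast
  qed
  then show ?thesis using f by (simp add: expandable_def)
qed

lemma L2_orthonormal_basisI: "L2 M \<subseteq> expandable M e \<Longrightarrow> L2_orthonormal_basis M e"
  using e by (auto simp: L2_orthonormal_basis_iff expandable_def)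

end

section \<open>An orthonormal basis of cosines\<close>

lemma (in finite_measure) L2_of_bounded:
  assumes "f \<in> borel_measurable M" "\<And>x. x \<in> space M \<Longrightarrow> norm (f x) \<le> B"
  shows "f \<in> L2 M"
  unfolding L2_def using assms
  by (auto intro!: integrable_const_bound[where B = "B\<^sup>2"] AE_I2 power_mono)

lemma (in finite_measure) L2_norm_le_sup:
  assumes "f \<in> borel_measurable M" "\<And>x. x \<in> space M \<Longrightarrow> norm (f x) \<le> B" "B \<ge> 0"
  shows "L2_norm M f \<le> B * sqrt (measure M (space M))"
proof -
  have "(LINT x|M. (norm (f x))\<^sup>2) \<le> (LINT x|M. B\<^sup>2)"
    using L2_integrable_square[OF L2_of_bounded[OF assms(1,2)]] assms
    by (intro integral_mono) (auto intro!: power_mono)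
  then have "L2_norm M f \<le> sqrt (B\<^sup>2 * measure M (space M))"
    by (simp add: L2_norm_def mult.commute)
  then show ?thesis using assms(3) by (simp add: real_sqrt_mult)
qed

lemma L2_norm_tendsto_zero:
  assumes "\<And>k. f k \<in> borel_measurable M" "integrable M w"
    and "\<And>k x. x \<in> space M \<Longrightarrow> (norm (f k x))\<^sup>2 \<le> w x"
    and "\<And>x. x \<in> space M \<Longrightarrow> (\<lambda>k. f k x) \<longlonglongrightarrow> 0"
  shows "(\<lambda>k. L2_norm M (f k)) \<longlonglongrightarrow> 0"
proof -
  have "(\<lambda>k. LINT x|M. (norm (f k x))\<^sup>2) \<longlonglongrightarrow> (LINT x|M. 0)"
  proof (rule integral_dominated_convergence[where w = w])
    show "(\<lambda>x. (norm (f k x))\<^sup>2) \<in> borel_measurable M" for k using assms(1)[of k] by measurable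
    show "AE x in M. (\<lambda>k. (norm (f k x))\<^sup>2) \<longlonglongrightarrow> 0"
    proof (rule AE_I2)
      fix x assume "x \<in> space M"
      from tendsto_power[OF tendsto_norm[OF assms(4)[OF this]], of 2]
      show "(\<lambda>k. (norm (f k x))\<^sup>2) \<longlonglongrightarrow> 0" by simp
    qed
  qed (use assms in auto)
  from tendsto_real_sqrt[OF this] show ?thesis by (simp add: L2_norm_def)
qed

abbreviation (input) lebesgue_on_open :: "real \<Rightarrow> real \<Rightarrow> real measure" where
  "lebesgue_on_open a b \<equiv> restrict_space lborel {a<..<b}"

lemma finite_measure_interval: "finite_measure (lebesgue_on_open a b)"
  using emeasure_bounded_finite[of "{a<..<b}"]
  by (intro finite_measureI) (auto simp: emeasure_restrict_space space_restrict_space)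

lemma measure_interval: "a \<le> b \<Longrightarrow> measure (lebesgue_on_open a b) (space (lebesgue_on_open a b)) = b - a"
  by (simp add: measure_restrict_space space_restrict_space)

lemma borel_measurable_interval:
  "f \<in> borel_measurable borel \<Longrightarrow> f \<in> borel_measurable (lebesgue_on_open a b)"
  by (rule measurable_restrict_space1) simp

lemma integral_interval_FTC:
  fixes f F :: "real \<Rightarrow> real"
  assumes "a \<le> b" "continuous_on UNIV f" "\<And>x. (F has_real_derivative f x) (at x)"
  shows "(LINT x|lebesgue_on_open a b. f x) = F b - F a"
proof -
  have "(LINT x|lebesgue_on_open a b. f x) = (LBINT x=ereal a..ereal b. f x)"
    using assms(1) by (simp add: integral_restrict_space interval_lebesgue_integral_def set_lebesgue_integral_def)
  also have "\<dots> = F b - F a"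
    using assms by (intro interval_integral_FTC_finite)
      (auto intro: continuous_on_subset has_field_derivative_at_within simp flip: has_real_derivative_iff_has_vector_derivative)
  finally show ?thesis .
qed

lemma integral_cos_multiple:
  assumes "l > 0"
  shows "(LINT x|lebesgue_on_open 0 l. cos (of_int k * pi * x / l)) = (if k = 0 then l else 0)"
proof (cases "k = 0")
  case True
  then show ?thesis using measure_interval[of 0 l] assms by simp
next
  case False
  let ?c = "of_int k * pi / l"
  have c: "?c \<noteq> 0" using False assms by simp
  have "(LINT x|lebesgue_on_open 0 l. cos (?c * x)) = sin (?c * l) / ?c - sin (?c * 0) / ?c"
    using assms c by (intro integral_interval_FTC) (auto intro!: continuous_intros derivative_eq_intros)
  moreover have "sin (?c * l) = 0" using assms sin_integer_2pi by (simp add: sin_zero_iff_int2)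
  ultimately show ?thesis using False by (simp add: mult.commute mult.left_commute)
qed

text \<open>Cosines rather than exponentials: they are indexed by \<^typ>\<open>nat\<close>, and \<open>cos (\<pi> x / l)\<close> is injective
  on \<open>[0, l]\<close>, so polynomials in it approximate all continuous functions, without a boundary
  condition.\<close>

definition cosine_basis :: "real \<Rightarrow> nat \<Rightarrow> real \<Rightarrow> complex" where
  "cosine_basis l n x = of_real (sqrt ((if n = 0 then 1 else 2) / l) * cos (real n * pi * x / l))"

lemma cosine_basis_orthonormal:
  assumes l: "l > 0"
  shows "orthonormal_on (lebesgue_on_open 0 l) UNIV (cosine_basis l)"
  unfolding orthonormal_on_def
proof (intro conjI ballI)
  interpret finite_measure "lebesgue_on_open 0 l" by (rule finite_measure_interval)
  let ?M = "lebesgue_on_open 0 l"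
  let ?a = "\<lambda>n::nat. sqrt ((if n = 0 then 1 else 2) / l)"
  have meas: "cosine_basis l n \<in> borel_measurable ?M" for n
    unfolding cosine_basis_def by (intro borel_measurable_interval borel_measurable_continuous_onI continuous_intros) (use l in auto)
  show "cosine_basis l n \<in> L2 ?M" for n
    by (rule L2_of_bounded[OF meas, of _ "?a n"]) (use l in \<open>auto simp: cosine_basis_def norm_mult abs_mult mult_left_le\<close>)
  fix i j :: nat
  have int_cos: "integrable ?M (\<lambda>x. cos (of_int k * pi * x / l))" for k
    by (intro integrable_const_bound[where B = 1] AE_I2 borel_measurable_interval borel_measurable_continuous_onI continuous_intros)
       (use l in auto)
  have "L2_inner ?M (cosine_basis l i) (cosine_basis l j)
     = (LINT x|?M. complex_of_real (?a i * ?a j * ((cos (of_int (int i - int j) * pi * x / l) + cos (of_int (int i + int j) * pi * x / l)) / 2)))"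
    unfolding L2_inner_def
  proof (rule Bochner_Integration.integral_cong[OF refl])
    fix x
    have "cos (real i * pi * x / l) * cos (real j * pi * x / l)
       = (cos (of_int (int i - int j) * pi * x / l) + cos (of_int (int i + int j) * pi * x / l)) / 2"
      by (subst cos_times_cos) (simp add: algebra_simps add_divide_distrib diff_divide_distrib)
    then show "cnj (cosine_basis l i x) * cosine_basis l j x = 
       complex_of_real (?a i * ?a j * ((cos (of_int (int i - int j) * pi * x / l) + cos (of_int (int i + int j) * pi * x / l)) / 2))"
      by (simp add: cosine_basis_def mult_ac del: of_real_divide flip: of_real_mult)
  qed
  also have "\<dots> = complex_of_real (?a i * ?a j * (((if int i - int j = 0 then l else 0) + (if int i + int j = 0 then l else 0)) / 2))"
    using int_cos[of "int i - int j"] int_cos[of "int i + int j"] integral_cos_multiple[OF l]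
    by (simp only: integral_complex_of_real integral_mult_right_zero integral_divide_zero Bochner_Integration.integral_add)
  also have "?a i * ?a j * (((if int i - int j = 0 then l else 0) + (if int i + int j = 0 then l else 0)) / 2) = (if i = j then 1 else 0)"
    using l by auto
  also have "complex_of_real \<dots> = (if i = j then 1 else 0)" by simp
  finally show "L2_inner ?M (cosine_basis l i) (cosine_basis l j) = (if i = j then 1 else 0)" .
qed

lemma expandable_cong:
  assumes e: "orthonormal_on M UNIV e" and f: "f \<in> expandable M e" and g: "g \<in> borel_measurable M"
    and "\<And>x. x \<in> space M \<Longrightarrow> g x = f x"
  shows "g \<in> expandable M e"
proof (rule expandable_limit[OF e _ f])
  have "f \<in> L2 M" using f by (simp add: expandable_def)
  moreover have "integrable M (\<lambda>x. (norm (g x))\<^sup>2) \<longleftrightarrow> integrable M (\<lambda>x. (norm (f x))\<^sup>2)"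
    by (rule Bochner_Integration.integrable_cong) (simp_all add: assms(4))
  ultimately show "g \<in> L2 M" using g by (simp add: L2_def)
  have "(LINT x|M. (norm (g x - f x))\<^sup>2) = (LINT x|M. 0)"
    by (rule Bochner_Integration.integral_cong) (simp_all add: assms(4))
  then show "(\<lambda>k. L2_norm M (\<lambda>x. g x - f x)) \<longlonglongrightarrow> 0" by (simp add: L2_norm_def)
qed

text \<open>Simple functions with \<open>\<bar>F\<^sub>i\<bar> \<le> 2 \<bar>f\<bar>\<close> converge to \<open>f\<close> pointwise, hence in the mean by dominated
  convergence.\<close>

lemma (in finite_measure) L2_subset_expandable:
  assumes e: "orthonormal_on M UNIV e"
    and sets: "\<And>A. A \<in> sets M \<Longrightarrow> (\<lambda>x. indicator A x) \<in> expandable M e"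
  shows "L2 M \<subseteq> expandable M e"
proof
  fix f assume f: "f \<in> L2 M"
  obtain F where F: "\<And>i. simple_function M (F i)" "\<And>x. x \<in> space M \<Longrightarrow> (\<lambda>i. F i x) \<longlonglongrightarrow> f x"
    "\<And>i x. x \<in> space M \<Longrightarrow> dist (F i x) 0 \<le> 2 * dist (f x) 0"
    using borel_measurable_implies_sequence_metric[OF L2_measurable[OF f], of 0] by blast
  have Fm: "F i \<in> borel_measurable M" for i using F(1) by (rule borel_measurable_simple_function)
  have "F i \<in> expandable M e" for i
  proof (rule expandable_cong[OF e _ Fm])
    show "(\<lambda>x. \<Sum>y\<in>F i ` space M. y * indicator (F i -` {y} \<inter> space M) x) \<in> expandable M e"
      using simple_functionD(2)[OF F(1)] by (intro expandable_sum expandable_cmult sets e)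
    fix x assume "x \<in> space M"
    then have "F i x = (\<Sum>y\<in>F i ` space M. indicator (F i -` {y} \<inter> space M) x *\<^sub>R y)"
      by (rule simple_function_indicator_representation_banach[OF F(1)])
    also have "\<dots> = (\<Sum>y\<in>F i ` space M. y * indicator (F i -` {y} \<inter> space M) x)"
      by (rule sum.cong) (simp_all add: indicator_def)
    finally show "F i x = (\<Sum>y\<in>F i ` space M. y * indicator (F i -` {y} \<inter> space M) x)" .
  qed
  then show "f \<in> expandable M e"
  proof (rule expandable_limit[OF e f])
    show "(\<lambda>k. L2_norm M (\<lambda>x. f x - F k x)) \<longlonglongrightarrow> 0"
    proof (rule L2_norm_tendsto_zero[where w = "\<lambda>x. 9 * (norm (f x))\<^sup>2"])
      show "(\<lambda>x. f x - F k x) \<in> borel_measurable M" for k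
        using L2_measurable[OF f] Fm by (rule borel_measurable_diff)
      show "integrable M (\<lambda>x. 9 * (norm (f x))\<^sup>2)" using L2_integrable_square[OF f] by simp
      fix x assume x: "x \<in> space M"
      have le3: "norm (f x - F k x) \<le> 3 * norm (f x)" for k
        using norm_triangle_ineq4[of "f x" "F k x"] F(3)[OF x, of k] by simp
      show "(norm (f x - F k x))\<^sup>2 \<le> 9 * (norm (f x))\<^sup>2" for k
        using power_mono[OF le3[of k], of 2] by (simp add: power_mult_distrib)
      show "(\<lambda>k. f x - F k x) \<longlonglongrightarrow> 0"
        using tendsto_diff[OF tendsto_const F(2)[OF x], of "f x"] by simp
    qed
  qed
qed

context
  fixes l :: real assumes l: "l > 0"
begin

interpretation finite_measure "lebesgue_on_open 0 l" by (rule finite_measure_interval)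

abbreviation (input) cos_span :: "(real \<Rightarrow> complex) set" where
  "cos_span \<equiv> expandable (lebesgue_on_open 0 l) (cosine_basis l)"

lemmas cos_on = cosine_basis_orthonormal[OF l]

lemma cos_expandable: "(\<lambda>x. complex_of_real (cos (real n * pi * x / l))) \<in> cos_span"
proof -
  let ?a = "sqrt ((if n = 0 then 1 else 2) / l)"
  have "(\<lambda>x. complex_of_real (1 / ?a) * cosine_basis l n x) \<in> cos_span"
    by (intro expandable_cmult[OF cos_on] expandable_basis[OF cos_on])
  also have "(\<lambda>x. complex_of_real (1 / ?a) * cosine_basis l n x) = (\<lambda>x. complex_of_real (cos (real n * pi * x / l)))"
    using l by (auto simp: cosine_basis_def)
  finally show ?thesis .
qed

text \<open>The factor \<open>cos (n \<pi> x / l)\<close> is there for the induction: multiplication by \<open>cos (\<pi> x / l)\<close> turns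
  it into the mean of the cosines of orders \<open>n + 1\<close> and \<open>\<bar>n - 1\<bar>\<close>.\<close>

lemma cos_power_expandable:
  "(\<lambda>x. complex_of_real (cos (pi * x / l) ^ i * cos (real n * pi * x / l))) \<in> cos_span"
proof (induction i arbitrary: n)
  case 0
  then show ?case using cos_expandable by simp
next
  case (Suc i)
  define n' where "n' = (if n = 0 then 1 else n - 1)"
  have *: "cos (pi * x / l) * cos (real n * pi * x / l)
     = (cos (real (Suc n) * pi * x / l) + cos (real n' * pi * x / l)) / 2" for x
  proof (cases n)
    case 0
    then show ?thesis by (simp add: n'_def)
  next
    case (Suc m)
    have "cos (real n * pi * x / l) * cos (pi * x / l) = (cos (real n * pi * x / l - pi * x / l) + cos (real n * pi * x / l + pi * x / l)) / 2"
      by (rule cos_times_cos)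
    also have "real n * pi * x / l - pi * x / l = real n' * pi * x / l"
      by (simp add: n'_def Suc diff_divide_distrib[symmetric] algebra_simps)
    also have "real n * pi * x / l + pi * x / l = real (Suc n) * pi * x / l"
      by (simp add: add_divide_distrib[symmetric] algebra_simps)
    finally show ?thesis by (simp add: mult.commute add.commute)
  qed
  have "(\<lambda>x. complex_of_real (1/2) * (complex_of_real (cos (pi * x / l) ^ i * cos (real (Suc n) * pi * x / l))
       + complex_of_real (cos (pi * x / l) ^ i * cos (real n' * pi * x / l)))) \<in> cos_span"
    by (intro expandable_cmult[OF cos_on] expandable_add[OF cos_on] Suc)
  also have "(\<lambda>x. complex_of_real (1/2) * (complex_of_real (cos (pi * x / l) ^ i * cos (real (Suc n) * pi * x / l))
       + complex_of_real (cos (pi * x / l) ^ i * cos (real n' * pi * x / l))))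
     = (\<lambda>x. complex_of_real (cos (pi * x / l) ^ Suc i * cos (real n * pi * x / l)))"
  proof
    fix x
    have "cos (pi * x / l) ^ Suc i * cos (real n * pi * x / l) = cos (pi * x / l) ^ i * (cos (pi * x / l) * cos (real n * pi * x / l))"
      by simp
    also have "\<dots> = (1/2) * (cos (pi * x / l) ^ i * cos (real (Suc n) * pi * x / l) + cos (pi * x / l) ^ i * cos (real n' * pi * x / l))"
      unfolding * by (simp add: algebra_simps)
    finally show "complex_of_real (1/2) * (complex_of_real (cos (pi * x / l) ^ i * cos (real (Suc n) * pi * x / l))
       + complex_of_real (cos (pi * x / l) ^ i * cos (real n' * pi * x / l)))
       = complex_of_real (cos (pi * x / l) ^ Suc i * cos (real n * pi * x / l))"
      by (simp only: of_real_mult of_real_add)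
  qed
  finally show ?case .
qed

text \<open>Weierstrass' theorem for \<open>g\<close> as a function of \<open>u = cos (\<pi> x / l)\<close>.\<close>

lemma continuous_expandable:
  assumes g: "continuous_on UNIV (g :: real \<Rightarrow> real)"
  shows "(\<lambda>x. complex_of_real (g x)) \<in> cos_span"
proof -
  let ?M = "lebesgue_on_open 0 l"
  have "\<exists>p. (\<lambda>x. complex_of_real (p x)) \<in> cos_span \<and> (\<forall>x\<in>space ?M. \<bar>g x - p x\<bar> \<le> 1 / real (Suc k))" for k
  proof -
    have "continuous_on {-1..1} (\<lambda>u. g (l / pi * arccos u))"
      by (intro continuous_on_compose2[OF g] continuous_intros) auto
    then obtain q where q: "real_polynomial_function q"
      "\<And>u. u \<in> {-1..1} \<Longrightarrow> \<bar>g (l / pi * arccos u) - q u\<bar> < 1 / real (Suc k)"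
      by (rule Stone_Weierstrass_real_polynomial_function[rotated 1, of "{-1..1}" _ "1 / real (Suc k)"]) auto
    obtain a n where an: "q = (\<lambda>x. \<Sum>i\<le>n. a i * x ^ i)"
      using q(1) unfolding real_polynomial_function_iff_sum by blast
    have "(\<lambda>x. \<Sum>i\<le>n. complex_of_real (a i) * complex_of_real (cos (pi * x / l) ^ i * cos (real 0 * pi * x / l))) \<in> cos_span"
      by (intro expandable_sum[OF cos_on] expandable_cmult[OF cos_on] cos_power_expandable)
    then have "(\<lambda>x. complex_of_real (q (cos (pi * x / l)))) \<in> cos_span" by (simp add: an)
    moreover have "\<bar>g x - q (cos (pi * x / l))\<bar> \<le> 1 / real (Suc k)" if x: "x \<in> space ?M" for x
    proof -
      have "0 \<le> pi * x / l" "pi * x / l \<le> pi" using x l by (auto simp: space_restrict_space divide_simps)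
      then have "arccos (cos (pi * x / l)) = pi * x / l" by (rule arccos_cos)
      then have "l / pi * arccos (cos (pi * x / l)) = x" using l by simp
      then show ?thesis using q(2)[of "cos (pi * x / l)"] by simp
    qed
    ultimately show ?thesis by (intro exI[of _ "\<lambda>x. q (cos (pi * x / l))"] conjI ballI)
  qed
  then obtain p where p: "\<And>k. (\<lambda>x. complex_of_real (p k x)) \<in> cos_span"
    "\<And>k x. x \<in> space ?M \<Longrightarrow> \<bar>g x - p k x\<bar> \<le> 1 / real (Suc k)"
    by metis
  have gm: "(\<lambda>x. complex_of_real (g x)) \<in> borel_measurable ?M"
    by (intro borel_measurable_interval borel_measurable_continuous_onI continuous_intros g)
  have pm: "(\<lambda>x. complex_of_real (p k x)) \<in> borel_measurable ?M" for k
    using p(1)[of k] by (simp add: expandable_def L2_def)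
  have bound: "norm (complex_of_real (g x) - complex_of_real (p k x)) \<le> 1 / real (Suc k)" if "x \<in> space ?M" for x k
    using p(2)[OF that, of k] by (simp only: of_real_diff[symmetric] norm_of_real)
  show ?thesis
  proof (rule expandable_limit[OF cos_on _ p(1)])
    have "continuous_on {0..l} g" using g by (rule continuous_on_subset) simp
    then have "bounded (g ` {0..l})" by (intro compact_imp_bounded compact_continuous_image) auto
    then obtain B where "\<forall>y\<in>g ` {0..l}. norm y \<le> B" unfolding bounded_iff by blast
    then show "(\<lambda>x. complex_of_real (g x)) \<in> L2 ?M"
      by (intro L2_of_bounded[OF gm, of B]) (auto simp: space_restrict_space)
    have "L2_norm ?M (\<lambda>x. complex_of_real (g x) - complex_of_real (p k x)) \<le> 1 / real (Suc k) * sqrt (measure ?M (space ?M))" for k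
      by (rule L2_norm_le_sup[OF borel_measurable_diff[OF gm pm] bound]) auto
    then show "(\<lambda>k. L2_norm ?M (\<lambda>x. complex_of_real (g x) - complex_of_real (p k x))) \<longlonglongrightarrow> 0"
      by (intro Lim_null_comparison[OF _ tendsto_mult_left_zero[OF LIMSEQ_Suc[OF lim_const_over_n[of 1]]]] always_eventually allI)
         (simp add: L2_norm_nonneg)
  qed
qed

text \<open>The indicator of an interval is a pointwise limit of continuous trapezoids; \<open>d\<close> below is
  positive exactly outside the interval.\<close>

lemma interval_expandable: "(\<lambda>x. indicator {a..b} x) \<in> cos_span"
proof -
  let ?M = "lebesgue_on_open 0 l"
  define d where "d x = max (x - b) (a - x)" for x
  define g where "g k x = max 0 (min 1 (1 - real k * d x))" for k x
  have gc: "continuous_on UNIV (g k)" for k unfolding g_def d_def by (intro continuous_intros)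
  have gm: "(\<lambda>x. complex_of_real (g k x)) \<in> borel_measurable ?M" for k
    by (intro borel_measurable_interval borel_measurable_continuous_onI continuous_intros gc)
  have im: "(\<lambda>x. indicator {a..b} x :: complex) \<in> borel_measurable ?M"
    by (intro borel_measurable_interval) simp
  have lim: "(\<lambda>k. complex_of_real (g k x)) \<longlonglongrightarrow> indicator {a..b} x" for x
  proof (cases "x \<in> {a..b}")
    case True
    then have "d x \<le> 0" by (auto simp: d_def)
    then have "g k x = 1" for k by (simp add: g_def mult_nonneg_nonpos)
    then show ?thesis using True by simp
  next
    case False
    then have dx: "d x > 0" by (auto simp: d_def)
    then obtain k0 where k0: "1 < real k0 * d x" using reals_Archimedean3[of "d x"] by auto
    have "g k x = 0" if "k \<ge> k0" for k
    proof -
      have "real k0 * d x \<le> real k * d x" using that dx by (intro mult_right_mono) auto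
      then show ?thesis using k0 by (simp add: g_def)
    qed
    then show ?thesis using False
      by (intro tendsto_eventually) (auto simp: eventually_sequentially)
  qed
  have le1: "norm (indicator {a..b} x - complex_of_real (g k x)) \<le> 1" for k x
  proof -
    have "\<bar>indicator {a..b} x - g k x\<bar> \<le> 1" by (auto simp: g_def indicator_def)
    moreover have "indicator {a..b} x - complex_of_real (g k x) = of_real (indicator {a..b} x - g k x)"
      by (simp add: indicator_def)
    ultimately show ?thesis by (simp only: norm_of_real)
  qed
  show ?thesis
  proof (rule expandable_limit[OF cos_on _ continuous_expandable[OF gc]])
    show "(\<lambda>x. indicator {a..b} x) \<in> L2 ?M"
      by (rule L2_of_bounded[OF im, of 1]) (auto simp: indicator_def)
    show "(\<lambda>k. L2_norm ?M (\<lambda>x. indicator {a..b} x - complex_of_real (g k x))) \<longlonglongrightarrow> 0"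
    proof (rule L2_norm_tendsto_zero[where w = "\<lambda>_. 1"])
      show "(\<lambda>x. indicator {a..b} x - complex_of_real (g k x)) \<in> borel_measurable ?M" for k
        by (rule borel_measurable_diff[OF im gm])
      show "(norm (indicator {a..b} x - complex_of_real (g k x)))\<^sup>2 \<le> 1" for k x
        using le1[of x k] by (simp add: power_le_one)
      show "(\<lambda>k. indicator {a..b} x - complex_of_real (g k x)) \<longlonglongrightarrow> 0" for x
        using tendsto_diff[OF tendsto_const lim[of x], of "indicator {a..b} x"] by simp
    qed simp
  qed
qed

lemma borel_set_expandable:
  assumes "A \<in> sets (borel :: real measure)"
  shows "(\<lambda>x. indicator A x) \<in> cos_span"
proof -
  let ?M = "lebesgue_on_open 0 l"
  show ?thesis using assms
  proof (induction A rule: borel_set_induct)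
    case empty
    show ?case using expandable_zero[OF cos_on] by simp
  next
    case (interval a b)
    show ?case by (rule interval_expandable)
  next
    case (compl A)
    have "(\<lambda>x. complex_of_real 1 - indicator A x) \<in> cos_span"
      by (intro expandable_diff[OF cos_on] compl continuous_expandable) simp
    also have "(\<lambda>x. complex_of_real 1 - indicator A x) = indicator (- A)"
      by (auto simp: indicator_def)
    finally show ?case .
  next
    case (union A)
    note A = union(2)
    have im: "(\<lambda>x. indicator B x :: complex) \<in> borel_measurable ?M" if "B \<in> sets borel" for B
      by (intro borel_measurable_interval) (use that in simp)
    define s where "s k x = (\<Sum>i<k. indicator (A i) x :: complex)" for k x
    have s: "s k x = indicator (\<Union>i<k. A i) x" for k x
      unfolding s_def using disjoint_family_on_mono[OF subset_UNIV union(1)]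
      by (intro indicator_UN_disjoint[symmetric]) simp_all
    have s_ex: "s k \<in> cos_span" for k
      unfolding s_def by (rule expandable_sum[OF cos_on]) (rule union(3))
    have sm: "s k \<in> borel_measurable ?M" for k using s_ex[of k] by (simp add: expandable_def L2_def)
    have um: "(\<lambda>x. indicator (\<Union>i. A i) x :: complex) \<in> borel_measurable ?M" by (rule im[OF sets.countable_UN]) (use A in blast)
    show ?case
    proof (rule expandable_limit[OF cos_on _ s_ex])
      show "(\<lambda>x. indicator (\<Union>i. A i) x) \<in> L2 ?M"
        by (rule L2_of_bounded[OF um, of 1]) (simp add: indicator_def)
      show "(\<lambda>k. L2_norm ?M (\<lambda>x. indicator (\<Union>i. A i) x - s k x)) \<longlonglongrightarrow> 0"
      proof (rule L2_norm_tendsto_zero[where w = "\<lambda>_. 1"])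
        show "(\<lambda>x. indicator (\<Union>i. A i) x - s k x) \<in> borel_measurable ?M" for k
          by (rule borel_measurable_diff[OF um sm])
        have diff: "indicator (\<Union>i. A i) x - s k x = indicator ((\<Union>i. A i) - (\<Union>i<k. A i)) x" for k x
        proof -
          have *: "indicator U x - indicator V x = (indicator (U - V) x :: complex)" if "V \<subseteq> U" for U V
            using that by (auto simp: indicator_def)
          show ?thesis unfolding s by (rule *) auto
        qed
        have "(norm (indicator B x :: complex))\<^sup>2 \<le> 1" for B x by (simp add: indicator_def)
        then show "(norm (indicator (\<Union>i. A i) x - s k x))\<^sup>2 \<le> 1" for k x unfolding diff .
        fix x
        have "\<exists>k0. \<forall>k\<ge>k0. x \<notin> (\<Union>i. A i) - (\<Union>i<k. A i)"
        proof (cases "x \<in> (\<Union>i. A i)")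
          case True
          then obtain i where i: "x \<in> A i" by blast
          have "x \<in> (\<Union>i<k. A i)" if "k \<ge> Suc i" for k using that i by (intro UN_I[of i]) auto
          then show ?thesis by (intro exI[of _ "Suc i"]) simp
        qed simp
        then obtain k0 where k0: "\<forall>k\<ge>k0. x \<notin> (\<Union>i. A i) - (\<Union>i<k. A i)" ..
        have "indicator (\<Union>i. A i) x - s k x = 0" if "k \<ge> k0" for k
          unfolding diff indicator_eq_0_iff by (rule k0[rule_format, OF that])
        then show "(\<lambda>k. indicator (\<Union>i. A i) x - s k x) \<longlonglongrightarrow> 0"
          by (intro tendsto_eventually eventually_sequentiallyI[of k0])
      qed simp
    qed
  qed
qed

lemma cosine_basis_complete: "L2_orthonormal_basis (lebesgue_on_open 0 l) (cosine_basis l)"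
proof (rule L2_orthonormal_basisI[OF cos_on L2_subset_expandable[OF cos_on]])
  fix A assume "A \<in> sets (lebesgue_on_open 0 l)"
  then have "A \<in> sets borel" by (auto simp: sets_restrict_space)
  then show "(\<lambda>x. indicator A x) \<in> cos_span" by (rule borel_set_expandable)
qed

end

section \<open>The band-limiting operator\<close>

lemma Fubini_bounded:
  fixes g :: "'a \<Rightarrow> complex" and k :: "'a \<Rightarrow> 'b \<Rightarrow> complex"
  assumes M1: "finite_measure M1" and M2: "finite_measure M2" and g: "integrable M1 g"
    and k: "case_prod k \<in> borel_measurable (M1 \<Otimes>\<^sub>M M2)"
    and B: "\<And>x y. x \<in> space M1 \<Longrightarrow> y \<in> space M2 \<Longrightarrow> norm (k x y) \<le> B"
  shows "(LINT x|M1. LINT y|M2. g x * k x y) = (LINT y|M2. LINT x|M1. g x * k x y)"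
proof -
  interpret M1: finite_measure M1 by fact
  interpret M2: finite_measure M2 by fact
  interpret pair_sigma_finite M1 M2 by unfold_locales
  have gm: "g \<in> borel_measurable M1" using g by simp
  have gp: "(\<lambda>p. g (fst p)) \<in> borel_measurable (M1 \<Otimes>\<^sub>M M2)"
    using measurable_compose[OF measurable_fst gm] .
  have int: "integrable (M1 \<Otimes>\<^sub>M M2) (\<lambda>p. norm (g (fst p)) * B)"
  proof (rule Fubini_integrable)
    show "(\<lambda>p. norm (g (fst p)) * B) \<in> borel_measurable (M1 \<Otimes>\<^sub>M M2)" using gp by measurable
    show "integrable M1 (\<lambda>x. LINT y|M2. norm (norm (g (fst (x, y))) * B))"
      using integrable_norm[OF g] by (simp add: abs_mult)
    show "AE x in M1. integrable M2 (\<lambda>y. norm (g (fst (x, y))) * B)" by simp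
  qed
  have "integrable (M1 \<Otimes>\<^sub>M M2) (\<lambda>(x, y). g x * k x y)"
  proof (rule Bochner_Integration.integrable_bound[OF int])
    show "(\<lambda>(x, y). g x * k x y) \<in> borel_measurable (M1 \<Otimes>\<^sub>M M2)"
      using borel_measurable_times[OF gp k] by (simp add: case_prod_beta')
    show "AE p in M1 \<Otimes>\<^sub>M M2. norm (case p of (x, y) \<Rightarrow> g x * k x y) \<le> norm (norm (g (fst p)) * B)"
    proof (rule AE_I2)
      fix p assume "p \<in> space (M1 \<Otimes>\<^sub>M M2)"
      then obtain x y where p: "p = (x, y)" "x \<in> space M1" "y \<in> space M2"
        by (cases p) (auto simp: space_pair_measure)
      have "norm (g x * k x y) \<le> norm (g x) * B"
        unfolding norm_mult using B[OF p(2,3)] by (rule mult_left_mono) simp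
      then show "norm (case p of (x, y) \<Rightarrow> g x * k x y) \<le> norm (norm (g (fst p)) * B)"
        using p(1) by simp
    qed
  qed
  from Fubini_integral[OF this] show ?thesis by simp
qed

lemma sinc_pi_measurable: "sinc_pi \<in> borel_measurable borel"
  unfolding sinc_pi_def by measurable

lemma sinc_pi_bound: "\<bar>sinc_pi t\<bar> \<le> 1"
  using abs_sin_x_le_abs_x[of "pi * t"] by (simp add: sinc_pi_def divide_le_eq)

lemma integral_cis_eq_sinc:
  "complex_of_real (sinc_pi t) = (LINT \<xi>|lebesgue_on_open (-1/2) (1/2). cis (2 * pi * \<xi> * t))"
proof -
  let ?I = "lebesgue_on_open (-1/2) (1/2)"
  interpret finite_measure ?I by (rule finite_measure_interval)
  have int: "integrable ?I (\<lambda>\<xi>. cis (2 * pi * \<xi> * t))"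
    by (intro integrable_const_bound[where B = 1] AE_I2 borel_measurable_interval borel_measurable_continuous_onI continuous_intros)
       simp
  have "(LINT \<xi>|?I. cos (2 * pi * \<xi> * t)) = sinc_pi t"
  proof (cases "t = 0")
    case True
    then show ?thesis using measure_interval[of "-1/2" "1/2"] by (simp add: sinc_pi_def)
  next
    case False
    have "(LINT \<xi>|?I. cos (2 * pi * \<xi> * t)) = sin (2 * pi * (1/2) * t) / (2 * pi * t) - sin (2 * pi * (-1/2) * t) / (2 * pi * t)"
      using False by (intro integral_interval_FTC) (auto intro!: continuous_intros derivative_eq_intros)
    then show ?thesis using False by (simp add: sinc_pi_def divide_simps)
  qed
  moreover have "(LINT \<xi>|?I. sin (2 * pi * \<xi> * t)) = 0"
  proof (cases "t = 0")
    case False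
    have "(LINT \<xi>|?I. sin (2 * pi * \<xi> * t)) = - cos (2 * pi * (1/2) * t) / (2 * pi * t) - (- cos (2 * pi * (-1/2) * t) / (2 * pi * t))"
      using False by (intro integral_interval_FTC) (auto intro!: continuous_intros derivative_eq_intros)
    then show ?thesis by simp
  qed simp
  ultimately show ?thesis
    using integral_Re[OF int] integral_Im[OF int] by (simp add: complex_eq_iff)
qed

definition plane_wave :: "real \<Rightarrow> real \<Rightarrow> complex" where
  "plane_wave \<xi> x = cis (2 * pi * \<xi> * x)"

lemma norm_plane_wave [simp]: "norm (plane_wave \<xi> x) = 1"
  by (simp add: plane_wave_def)

lemma plane_wave_mult_cnj: "plane_wave \<xi> x * cnj (plane_wave \<eta> y) = cis (2 * pi * (\<xi> * x - \<eta> * y))"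
  by (simp add: plane_wave_def cis_cnj cis_mult algebra_simps)

lemma plane_wave_measurable:
  assumes "f \<in> borel_measurable N" "g \<in> borel_measurable N"
  shows "(\<lambda>p. plane_wave (f p) (g p)) \<in> borel_measurable N"
proof -
  have "cis \<in> borel_measurable borel" by (intro borel_measurable_continuous_onI continuous_intros)
  then show ?thesis unfolding plane_wave_def using assms
    by (intro measurable_compose[of _ N borel cis]) measurable
qed

lemma interval_ident_measurable:
  assumes "f \<in> measurable N (lebesgue_on_open a b)"
  shows "f \<in> borel_measurable N"
proof -
  have "(\<lambda>x. x) \<in> borel_measurable (lebesgue_on_open a b)" by (rule borel_measurable_interval) simp
  from measurable_compose[OF assms this] show ?thesis .
qed

text \<open>Below, \<open>X\<close> is the time interval and \<open>I\<close> the frequency band.\<close>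

locale band_limiting =
  fixes l :: real assumes l: "l > 0"
begin

abbreviation (input) "X \<equiv> lebesgue_on_open 0 l"
abbreviation (input) "I \<equiv> lebesgue_on_open (-1/2) (1/2)"

sublocale X: finite_measure X by (rule finite_measure_interval)
sublocale I: finite_measure I by (rule finite_measure_interval)

lemma space_X: "space X = {0<..<l}" by (simp add: space_restrict_space)

lemma measure_X: "measure X (space X) = l" using measure_interval[of 0 l] l by simp

lemma measure_I: "measure I (space I) = 1" using measure_interval[of "-1/2" "1/2"] by simp

lemma L2_integrable: "f \<in> L2 X \<Longrightarrow> integrable X f"
proof -
  assume f: "f \<in> L2 X"
  have "(\<lambda>x. 1) \<in> L2 X" by (rule X.L2_of_bounded[of _ 1]) auto
  from L2_integrable_cnj_mult[OF this f] show "integrable X f" by simp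
qed

text \<open>The Fourier transform of \<open>f\<close>, cut off to \<open>(0, l)\<close>, at the frequency \<open>\<xi>\<close>.\<close>

definition band_coeff :: "(real \<Rightarrow> complex) \<Rightarrow> real \<Rightarrow> complex" where
  "band_coeff f \<xi> = L2_inner X (plane_wave \<xi>) f"

lemma plane_wave_L2: "plane_wave \<xi> \<in> L2 X"
  by (rule X.L2_of_bounded[of _ 1]) (auto intro!: plane_wave_measurable borel_measurable_interval)

lemma L2_norm_plane_wave: "L2_norm X (plane_wave \<xi>) = sqrt l"
  using measure_X by (simp add: L2_norm_def)

lemma cnj_measurable: "f \<in> borel_measurable N \<Longrightarrow> (\<lambda>x. cnj (f x)) \<in> borel_measurable N"
proof -
  have "cnj \<in> borel_measurable borel" by (intro borel_measurable_continuous_onI continuous_intros)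
  then show "f \<in> borel_measurable N \<Longrightarrow> (\<lambda>x. cnj (f x)) \<in> borel_measurable N"
    by (rule measurable_compose[rotated])
qed

lemma band_coeff_measurable:
  assumes f: "f \<in> L2 X" shows "band_coeff f \<in> borel_measurable borel"
proof -
  have "(\<lambda>\<xi>. LINT x|X. cnj (plane_wave \<xi> x) * f x) \<in> borel_measurable borel"
  proof (rule X.borel_measurable_lebesgue_integral)
    have "(\<lambda>p. cnj (plane_wave (fst p) (snd p)) * f (snd p)) \<in> borel_measurable (borel \<Otimes>\<^sub>M X)"
      by (intro borel_measurable_times cnj_measurable plane_wave_measurable
          measurable_compose[OF measurable_snd L2_measurable[OF f]] measurable_fst
          interval_ident_measurable[OF measurable_snd])
    then show "(\<lambda>(\<xi>, x). cnj (plane_wave \<xi> x) * f x) \<in> borel_measurable (borel \<Otimes>\<^sub>M X)"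
      by (simp add: case_prod_beta')
  qed
  then show ?thesis unfolding band_coeff_def L2_inner_def .
qed

lemma band_coeff_bound: "norm (band_coeff f \<xi>) \<le> (LINT x|X. norm (f x))"
proof -
  have "norm (band_coeff f \<xi>) \<le> (LINT x|X. norm (cnj (plane_wave \<xi> x) * f x))"
    unfolding band_coeff_def L2_inner_def by (rule integral_norm_bound)
  then show ?thesis by (simp add: norm_mult)
qed

lemma band_coeff_L2: "f \<in> L2 X \<Longrightarrow> band_coeff f \<in> L2 I"
  by (rule I.L2_of_bounded[OF borel_measurable_interval[OF band_coeff_measurable] band_coeff_bound])

lemma S_op_eq:
  "S_op l f x = indicator {0<..<l} x * (LINT y|X. complex_of_real (sinc_pi (x - y)) * f y)"
  by (simp add: S_op_def P_op_def Q_op_def integral_restrict_space mult_ac scaleR_conv_of_real of_real_indicator)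

lemma S_op_joint_measurable:
  assumes "case_prod F \<in> borel_measurable (N \<Otimes>\<^sub>M X)"
  shows "(\<lambda>(\<xi>, x). S_op l (F \<xi>) x) \<in> borel_measurable (N \<Otimes>\<^sub>M X)"
proof -
  have "(\<lambda>p. LINT y|X. complex_of_real (sinc_pi (snd p - y)) * F (fst p) y) \<in> borel_measurable (N \<Otimes>\<^sub>M X)"
  proof (rule X.borel_measurable_lebesgue_integral)
    have 1: "(\<lambda>q. case_prod F (fst (fst q), snd q)) \<in> borel_measurable ((N \<Otimes>\<^sub>M X) \<Otimes>\<^sub>M X)"
      by (rule measurable_compose[OF _ assms]) measurable
    have "(\<lambda>q. snd (fst q)) \<in> measurable ((N \<Otimes>\<^sub>M X) \<Otimes>\<^sub>M X) X" by measurable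
    note a = interval_ident_measurable[OF this]
    have "(\<lambda>q. snd q) \<in> measurable ((N \<Otimes>\<^sub>M X) \<Otimes>\<^sub>M X) X" by measurable
    note b = interval_ident_measurable[OF this]
    have "(\<lambda>q. sinc_pi (snd (fst q) - snd q)) \<in> borel_measurable ((N \<Otimes>\<^sub>M X) \<Otimes>\<^sub>M X)"
      by (rule measurable_compose[OF borel_measurable_diff[OF a b] sinc_pi_measurable])
    then have "(\<lambda>q. complex_of_real (sinc_pi (snd (fst q) - snd q))) \<in> borel_measurable ((N \<Otimes>\<^sub>M X) \<Otimes>\<^sub>M X)"
      by (rule measurable_compose) simp
    from borel_measurable_times[OF this 1]
    show "(\<lambda>(p, y). complex_of_real (sinc_pi (snd p - y)) * F (fst p) y) \<in> borel_measurable ((N \<Otimes>\<^sub>M X) \<Otimes>\<^sub>M X)"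
      by (simp add: case_prod_beta')
  qed
  moreover have "(\<lambda>p. indicator {0<..<l} (snd p) :: complex) \<in> borel_measurable (N \<Otimes>\<^sub>M X)"
    by (rule measurable_compose[OF interval_ident_measurable[OF measurable_snd]]) simp
  ultimately show ?thesis unfolding S_op_eq case_prod_beta' by (intro borel_measurable_times)
qed

lemma S_op_measurable:
  assumes "f \<in> borel_measurable X" shows "S_op l f \<in> borel_measurable X"
proof -
  have "(\<lambda>(u::unit, x). f x) \<in> borel_measurable (count_space UNIV \<Otimes>\<^sub>M X)"
    using measurable_compose[OF measurable_snd assms] by (simp add: case_prod_beta')
  from S_op_joint_measurable[OF this]
  have "(\<lambda>(u::unit, x). S_op l f x) \<in> borel_measurable (count_space UNIV \<Otimes>\<^sub>M X)" .
  from measurable_compose[OF measurable_Pair1'[of "()" "count_space UNIV" X] this]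
  show ?thesis by simp
qed

lemma S_op_bound:
  assumes "integrable X f"
  shows "norm (S_op l f x) \<le> (LINT y|X. norm (f y))"
proof -
  have "norm (LINT y|X. complex_of_real (sinc_pi (x - y)) * f y) \<le> (LINT y|X. norm (complex_of_real (sinc_pi (x - y)) * f y))"
    by (rule integral_norm_bound)
  also have "\<dots> \<le> (LINT y|X. norm (f y))"
    using sinc_pi_bound assms by (intro integral_mono') (auto simp: norm_mult intro!: mult_left_le_one_le)
  finally show ?thesis by (simp add: S_op_eq indicator_def)
qed

lemma S_op_L2: "f \<in> L2 X \<Longrightarrow> S_op l f \<in> L2 X"
  by (rule X.L2_of_bounded[OF S_op_measurable[OF L2_measurable] S_op_bound[OF L2_integrable]])

lemma S_op_eq_band_integral:
  assumes f: "f \<in> L2 X" and x: "x \<in> space X"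
  shows "S_op l f x = (LINT \<xi>|I. band_coeff f \<xi> * plane_wave \<xi> x)"
proof -
  have "S_op l f x = (LINT y|X. (LINT \<xi>|I. f y * cis (2 * pi * \<xi> * (x - y))))"
    using x by (simp add: S_op_eq space_X integral_cis_eq_sinc mult.commute)
  also have "\<dots> = (LINT \<xi>|I. LINT y|X. f y * cis (2 * pi * \<xi> * (x - y)))"
  proof (rule Fubini_bounded[OF X.finite_measure_axioms I.finite_measure_axioms L2_integrable[OF f], of _ 1])
    have "(\<lambda>p. plane_wave (snd p) (x - fst p)) \<in> borel_measurable (X \<Otimes>\<^sub>M I)"
      by (intro plane_wave_measurable borel_measurable_diff borel_measurable_const
          interval_ident_measurable[OF measurable_fst] interval_ident_measurable[OF measurable_snd])
    then show "(\<lambda>(y, \<xi>). cis (2 * pi * \<xi> * (x - y))) \<in> borel_measurable (X \<Otimes>\<^sub>M I)"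
      by (simp add: plane_wave_def case_prod_beta')
  qed simp
  also have "\<dots> = (LINT \<xi>|I. band_coeff f \<xi> * plane_wave \<xi> x)"
  proof (rule Bochner_Integration.integral_cong[OF refl])
    fix \<xi>
    have eq: "f y * cis (2 * pi * \<xi> * (x - y)) = (cnj (plane_wave \<xi> y) * f y) * plane_wave \<xi> x" for y
      using plane_wave_mult_cnj[of \<xi> x \<xi> y] by (simp add: algebra_simps)
    show "(LINT y|X. f y * cis (2 * pi * \<xi> * (x - y))) = band_coeff f \<xi> * plane_wave \<xi> x"
      unfolding eq band_coeff_def L2_inner_def by (rule integral_mult_left_zero)
  qed
  finally show ?thesis .
qed

text \<open>The factorisation \<open>S = F\<^sup>*F\<close>, where \<open>F\<close> is \<open>band_coeff\<close> on the band: by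
  lemma \<open>integral_cis_eq_sinc\<close> the sinc kernel is the superposition of the plane waves in the band.\<close>

lemma S_op_inner:
  assumes f: "f \<in> L2 X" and g: "g \<in> L2 X"
  shows "L2_inner X g (S_op l f) = L2_inner I (band_coeff g) (band_coeff f)"
proof -
  have "L2_inner X g (S_op l f) = (LINT x|X. LINT \<xi>|I. cnj (g x) * (band_coeff f \<xi> * plane_wave \<xi> x))"
    unfolding L2_inner_def
    by (rule Bochner_Integration.integral_cong[OF refl]) (simp add: S_op_eq_band_integral[OF f])
  also have "\<dots> = (LINT \<xi>|I. LINT x|X. cnj (g x) * (band_coeff f \<xi> * plane_wave \<xi> x))"
  proof (rule Fubini_bounded[OF X.finite_measure_axioms I.finite_measure_axioms, of _ _ "LINT x|X. norm (f x)"])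
    show "integrable X (\<lambda>x. cnj (g x))" using L2_integrable[OF g] by simp
    have "(\<lambda>p. band_coeff f (snd p) * plane_wave (snd p) (fst p)) \<in> borel_measurable (X \<Otimes>\<^sub>M I)"
      by (intro borel_measurable_times plane_wave_measurable
          measurable_compose[OF interval_ident_measurable[OF measurable_snd] band_coeff_measurable[OF f]]
          interval_ident_measurable[OF measurable_fst] interval_ident_measurable[OF measurable_snd])
    then show "(\<lambda>(x, \<xi>). band_coeff f \<xi> * plane_wave \<xi> x) \<in> borel_measurable (X \<Otimes>\<^sub>M I)"
      by (simp add: case_prod_beta')
    show "norm (band_coeff f \<xi> * plane_wave \<xi> x) \<le> (LINT x|X. norm (f x))" for x \<xi>
      using band_coeff_bound by (simp add: norm_mult)
  qed
  also have "\<dots> = L2_inner I (band_coeff g) (band_coeff f)"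
    unfolding L2_inner_def
  proof (rule Bochner_Integration.integral_cong[OF refl])
    fix \<xi>
    have "(LINT x|X. cnj (g x) * (band_coeff f \<xi> * plane_wave \<xi> x)) = (LINT x|X. (cnj (g x) * plane_wave \<xi> x) * band_coeff f \<xi>)"
      by (rule Bochner_Integration.integral_cong) (simp_all add: mult_ac)
    also have "\<dots> = L2_inner X g (plane_wave \<xi>) * band_coeff f \<xi>"
      unfolding L2_inner_def by (rule integral_mult_left_zero)
    finally have "(LINT x|X. cnj (g x) * (band_coeff f \<xi> * plane_wave \<xi> x)) = L2_inner X g (plane_wave \<xi>) * band_coeff f \<xi>" .
    then show "(LINT x|X. cnj (g x) * (band_coeff f \<xi> * plane_wave \<xi> x)) = cnj (band_coeff g \<xi>) * band_coeff f \<xi>"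
      by (simp only: band_coeff_def L2_inner_commute[of X g])
  qed
  finally show ?thesis .
qed

lemma S_op_selfadjoint:
  assumes "f \<in> L2 X" "g \<in> L2 X"
  shows "L2_inner X (S_op l g) f = L2_inner X g (S_op l f)"
  using S_op_inner[OF assms] S_op_inner[OF assms(2,1)]
  by (simp only: L2_inner_commute[of X "S_op l g" f] L2_inner_commute[of I "band_coeff f"] complex_cnj_cnj)

text \<open>Frequencies that differ by a multiple of \<open>1/l\<close> give orthogonal waves on an interval of length
  \<open>l\<close>, whatever the offset \<open>\<theta>\<close> is.\<close>

lemma shifted_plane_waves_orthonormal:
  "orthonormal_on X UNIV (\<lambda>n::nat. \<lambda>x. complex_of_real (1 / sqrt l) * plane_wave (\<theta> + real n / l) x)"
  unfolding orthonormal_on_def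
proof (intro conjI ballI L2_cmult plane_wave_L2)
  fix m n :: nat
  let ?e = "\<lambda>n::nat. \<lambda>x. complex_of_real (1 / sqrt l) * plane_wave (\<theta> + real n / l) x"
  define c where "c = (if n = m then l else 0 :: real)"
  have "(LINT x|X. cis (2 * pi * ((real n - real m) / l) * x)) = complex_of_real c"
  proof -
    let ?a = "2 * pi * ((real n - real m) / l)"
    have int: "integrable X (\<lambda>x. cis (?a * x))"
      by (intro X.integrable_const_bound[where B = 1] AE_I2 borel_measurable_interval borel_measurable_continuous_onI continuous_intros)
         simp
    have "(LINT x|X. cos (?a * x)) = c"
    proof (cases "n = m")
      case False
      then have a: "?a \<noteq> 0" using l by simp
      have "(LINT x|X. cos (?a * x)) = sin (?a * l) / ?a - sin (?a * 0) / ?a"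
        using l a by (intro integral_interval_FTC) (auto intro!: continuous_intros derivative_eq_intros)
      also have "?a * l = of_int (2 * (int n - int m)) * pi" using l by simp
      also have "sin \<dots> = 0" by (subst sin_zero_iff_int2) blast
      finally show ?thesis using False by (simp add: c_def)
    qed (use measure_X in \<open>simp add: c_def\<close>)
    moreover have "(LINT x|X. sin (?a * x)) = 0"
    proof (cases "n = m")
      case False
      then have a: "?a \<noteq> 0" using l by simp
      have "(LINT x|X. sin (?a * x)) = - cos (?a * l) / ?a - (- cos (?a * 0) / ?a)"
        using l a by (intro integral_interval_FTC) (auto intro!: continuous_intros derivative_eq_intros)
      also have "?a * l = 2 * pi * of_int (int n - int m)" using l by simp
      also have "cos \<dots> = 1" by (rule cos_int_2pin)
      finally show ?thesis by simp
    qed simp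
    ultimately show ?thesis
      using integral_Re[OF int] integral_Im[OF int] by (simp add: complex_eq_iff)
  qed
  moreover have "cnj (?e m x) * ?e n x = complex_of_real (1 / l) * cis (2 * pi * ((real n - real m) / l) * x)" for x
  proof -
    have "cnj (?e m x) * ?e n x = complex_of_real (1 / sqrt l * (1 / sqrt l)) *
        (plane_wave (\<theta> + real n / l) x * cnj (plane_wave (\<theta> + real m / l) x))"
      by (simp only: complex_cnj_mult complex_cnj_complex_of_real of_real_mult mult_ac)
    also have "1 / sqrt l * (1 / sqrt l) = 1 / l" using l by (simp add: real_sqrt_mult_self)
    also have "plane_wave (\<theta> + real n / l) x * cnj (plane_wave (\<theta> + real m / l) x)
        = cis (2 * pi * ((real n - real m) / l) * x)"
      unfolding plane_wave_mult_cnj by (rule arg_cong[where f = cis]) (simp add: algebra_simps diff_divide_distrib)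
    finally show ?thesis .
  qed
  ultimately have "L2_inner X (?e m) (?e n) = complex_of_real (1 / l) * complex_of_real c"
    unfolding L2_inner_def by (simp only: integral_mult_right_zero)
  then show "L2_inner X (?e m) (?e n) = (if m = n then 1 else 0)" using l by (simp add: c_def)
qed

lemma band_coeff_shifted_Bessel:
  assumes f: "f \<in> L2 X"
  shows "(\<Sum>n<N. (norm (band_coeff f (\<theta> + real n / l)))\<^sup>2) \<le> l * (L2_norm X f)\<^sup>2"
proof -
  let ?e = "\<lambda>n::nat. \<lambda>x. complex_of_real (1 / sqrt l) * plane_wave (\<theta> + real n / l) x"
  have on: "orthonormal_on X {..<N} ?e"
    by (rule orthonormal_on_subset[OF shifted_plane_waves_orthonormal]) simp
  have "(norm (L2_inner X (?e n) f))\<^sup>2 = (norm (band_coeff f (\<theta> + real n / l)))\<^sup>2 / l" for n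
  proof -
    have "L2_inner X (?e n) f = cnj (L2_inner X f (?e n))" by (rule L2_inner_commute)
    also have "\<dots> = complex_of_real (1 / sqrt l) * band_coeff f (\<theta> + real n / l)"
      by (simp only: L2_inner_cmult_right band_coeff_def L2_inner_commute[of X "plane_wave _" f]
          complex_cnj_mult complex_cnj_complex_of_real)
    finally show ?thesis using l by (simp add: norm_mult norm_divide power_divide)
  qed
  then have "(\<Sum>n<N. (norm (band_coeff f (\<theta> + real n / l)))\<^sup>2) / l \<le> (L2_norm X f)\<^sup>2"
    using L2_Bessel[OF on _ f] by (simp add: sum_divide_distrib)
  then show ?thesis using l by (simp add: divide_le_eq mult.commute)
qed

text \<open>\<open>F\<close> is a contraction. The band is covered by \<open>N = \<lceil>l\<rceil>\<close> intervals of length \<open>1/l\<close>; translating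
  them onto \<open>[0, 1/l)\<close> turns the integral of \<open>\<bar>F f\<bar>\<^sup>2\<close> into an average over \<open>\<theta>\<close> of the sums in
  Bessel's inequality for the shifted plane waves.\<close>

lemma band_coeff_norm_le:
  assumes f: "f \<in> L2 X"
  shows "L2_norm I (band_coeff f) \<le> L2_norm X f"
proof -
  define H where "H \<xi> = (norm (band_coeff f \<xi>))\<^sup>2" for \<xi>
  define B where "B = (LINT x|X. norm (f x))\<^sup>2"
  have H: "H \<in> borel_measurable borel" "\<And>\<xi>. 0 \<le> H \<xi>" "\<And>\<xi>. H \<xi> \<le> B"
    unfolding H_def B_def using band_coeff_measurable[OF f] by (auto intro!: power_mono band_coeff_bound)
  have int: "integrable lborel (\<lambda>\<xi>. indicator {a..<b} \<xi> * H (c + \<xi>))" for a b c :: real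
  proof (rule Bochner_Integration.integrable_bound)
    show "integrable lborel (\<lambda>\<xi>. indicator {a..<b} \<xi> * B)"
      using emeasure_bounded_finite[of "{a..<b}"] by (intro integrable_mult_left integrable_real_indicator) auto
    show "(\<lambda>\<xi>. indicator {a..<b} \<xi> * H (c + \<xi>)) \<in> borel_measurable lborel"
      using H(1) by measurable
    show "AE \<xi> in lborel. norm (indicator {a..<b} \<xi> * H (c + \<xi>)) \<le> norm (indicator {a..<b} \<xi> * B)"
    proof (rule AE_I2)
      fix \<xi>
      have "\<bar>H (c + \<xi>)\<bar> \<le> \<bar>B\<bar>" using H(2)[of "c + \<xi>"] H(3)[of "c + \<xi>"] by linarith
      then show "norm (indicator {a..<b} \<xi> * H (c + \<xi>)) \<le> norm (indicator {a..<b} \<xi> * B)"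
        by (simp add: abs_mult mult_left_mono)
    qed
  qed
  define N where "N = nat \<lceil>l\<rceil>"
  define a where "a n = - 1/2 + real n / l" for n :: nat
  have shift: "(LINT \<xi>|lborel. indicator {a n..<a (Suc n)} \<xi> * H \<xi>) = (LINT \<theta>|lborel. indicator {0..<1/l} \<theta> * H (a n + \<theta>))" for n
  proof -
    have "a (Suc n) = a n + 1 / l" by (simp add: a_def add_divide_distrib)
    then have "indicator {a n..<a (Suc n)} (a n + 1 * \<theta>) = (indicator {0..<1/l} \<theta> :: real)" for \<theta>
      by (auto simp: indicator_def)
    then show ?thesis
      using lborel_integral_real_affine[of 1 "\<lambda>\<xi>. indicator {a n..<a (Suc n)} \<xi> * H \<xi>" "a n"] by simp
  qed
  have cover: "indicator {-1/2<..<1/2} \<xi> * H \<xi> \<le> (\<Sum>n<N. indicator {a n..<a (Suc n)} \<xi> * H \<xi>)" for \<xi>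
  proof (cases "\<xi> \<in> {-1/2<..<1/2}")
    case True
    define n where "n = nat \<lfloor>(\<xi> + 1/2) * l\<rfloor>"
    have pos: "0 < (\<xi> + 1/2) * l" "(\<xi> + 1/2) * l < l" using True l by auto
    have n1: "real n \<le> (\<xi> + 1/2) * l" "(\<xi> + 1/2) * l < real n + 1"
      using pos(1) by (auto simp: n_def)
    then have "real n < l" using pos by linarith
    then have "n < N" unfolding N_def by linarith
    have "\<xi> \<in> {a n..<a (Suc n)}" using n1 l by (simp add: a_def field_simps)
    then have "indicator {-1/2<..<1/2} \<xi> * H \<xi> = indicator {a n..<a (Suc n)} \<xi> * H \<xi>" using True by simp
    also have "\<dots> \<le> (\<Sum>n<N. indicator {a n..<a (Suc n)} \<xi> * H \<xi>)"
      using \<open>n < N\<close> H(2) by (intro member_le_sum) auto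
    finally show ?thesis .
  next
    case False
    then show ?thesis using H(2) by (auto intro!: sum_nonneg)
  qed
  have "(L2_norm I (band_coeff f))\<^sup>2 = (LINT \<xi>|lborel. indicator {-1/2<..<1/2} \<xi> * H \<xi>)"
    unfolding L2_norm_power2 H_def by (simp add: integral_restrict_space)
  also have "\<dots> \<le> (LINT \<xi>|lborel. (\<Sum>n<N. indicator {a n..<a (Suc n)} \<xi> * H \<xi>))"
  proof (rule integral_mono'[OF Bochner_Integration.integrable_sum cover])
    show "integrable lborel (\<lambda>\<xi>. indicator {a n..<a (Suc n)} \<xi> * H \<xi>)" for n
      using int[of _ _ 0] by simp
    show "0 \<le> (\<Sum>n<N. indicator {a n..<a (Suc n)} \<xi> * H \<xi>)" for \<xi>
      using H(2) by (intro sum_nonneg) auto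
  qed
  also have "\<dots> = (\<Sum>n<N. LINT \<theta>|lborel. indicator {0..<1/l} \<theta> * H (a n + \<theta>))"
    using int[of _ _ 0] by (subst Bochner_Integration.integral_sum) (auto simp: shift)
  also have "\<dots> = (LINT \<theta>|lborel. (\<Sum>n<N. indicator {0..<1/l} \<theta> * H (a n + \<theta>)))"
    using int by (subst Bochner_Integration.integral_sum) auto
  also have "\<dots> \<le> (LINT \<theta>|lborel. indicator {0..<1/l} \<theta> * (l * (L2_norm X f)\<^sup>2))"
  proof (rule integral_mono)
    show "integrable lborel (\<lambda>\<theta>. (\<Sum>n<N. indicator {0..<1/l} \<theta> * H (a n + \<theta>)))"
      using int by (intro Bochner_Integration.integrable_sum) auto
    show "integrable lborel (\<lambda>\<theta>. indicator {0..<1/l} \<theta> * (l * (L2_norm X f)\<^sup>2))"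
      using emeasure_bounded_finite[of "{0..<1/l}"] by (intro integrable_mult_left integrable_real_indicator) auto
    fix \<theta> :: real
    have "- 1/2 + \<theta> + real n / l = a n + \<theta>" for n by (simp add: a_def)
    then have "(\<Sum>n<N. H (a n + \<theta>)) \<le> l * (L2_norm X f)\<^sup>2"
      using band_coeff_shifted_Bessel[OF f, of "- 1/2 + \<theta>" N] by (simp only: H_def)
    then show "(\<Sum>n<N. indicator {0..<1/l} \<theta> * H (a n + \<theta>)) \<le> indicator {0..<1/l} \<theta> * (l * (L2_norm X f)\<^sup>2)"
      by (simp add: sum_distrib_left[symmetric] mult_left_mono)
  qed
  also have "\<dots> = (L2_norm X f)\<^sup>2" using l by simp
  finally show ?thesis by (rule power2_le_imp_le[OF _ L2_norm_nonneg])
qed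

text \<open>\<open>\<parallel>S f\<parallel>\<^sup>2 = \<langle>F S f, F f\<rangle> \<le> \<parallel>S f\<parallel> \<parallel>f\<parallel>\<close>.\<close>

lemma S_op_contraction:
  assumes f: "f \<in> L2 X"
  shows "L2_norm X (S_op l f) \<le> L2_norm X f"
proof -
  let ?s = "L2_norm X (S_op l f)"
  have "complex_of_real (?s\<^sup>2) = L2_inner I (band_coeff (S_op l f)) (band_coeff f)"
    unfolding L2_inner_self[symmetric] by (rule S_op_inner[OF f S_op_L2[OF f]])
  then have "?s\<^sup>2 = norm (L2_inner I (band_coeff (S_op l f)) (band_coeff f))"
    by (metis abs_power2 norm_of_real)
  also have "\<dots> \<le> L2_norm I (band_coeff (S_op l f)) * L2_norm I (band_coeff f)"
    by (intro L2_Cauchy_Schwarz band_coeff_L2 S_op_L2 f)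
  also have "\<dots> \<le> ?s * L2_norm X f"
    by (intro mult_mono band_coeff_norm_le S_op_L2 f L2_norm_nonneg)
  finally have "?s * ?s \<le> ?s * L2_norm X f" by (simp add: power2_eq_square)
  then show ?thesis using L2_norm_nonneg[of X "S_op l f"] L2_norm_nonneg[of X f]
    by (cases "?s = 0") (auto simp: mult_le_cancel_left)
qed

end

section \<open>Traces of powers\<close>

text \<open>The trace of \<open>S\<^bsup>j+1\<^esup> = F\<^sup>* (F S\<^sup>j)\<close>, cyclically permuted to that of \<open>F S\<^sup>j F\<^sup>*\<close>,
  an integral operator on the band whose kernel is \<open>\<langle>\<phi>\<^sub>\<xi>, S\<^sup>j \<phi>\<^sub>\<eta>\<rangle>\<close>.\<close>

definition band_trace :: "real \<Rightarrow> nat \<Rightarrow> complex" where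
  "band_trace l j = (LINT \<xi>|lebesgue_on_open (-1/2) (1/2).
     L2_inner (lebesgue_on_open 0 l) (plane_wave \<xi>) ((S_op l ^^ j) (plane_wave \<xi>)))"

context band_limiting
begin

lemma S_power_L2: "f \<in> L2 X \<Longrightarrow> (S_op l ^^ j) f \<in> L2 X"
  by (induction j) (simp_all add: S_op_L2)

lemma S_power_contraction: "f \<in> L2 X \<Longrightarrow> L2_norm X ((S_op l ^^ j) f) \<le> L2_norm X f"
proof (induction j)
  case (Suc j)
  then show ?case using S_op_contraction[OF S_power_L2[OF Suc.prems], of j] by simp
qed simp

lemma S_power_selfadjoint:
  "f \<in> L2 X \<Longrightarrow> g \<in> L2 X \<Longrightarrow> L2_inner X ((S_op l ^^ j) g) f = L2_inner X g ((S_op l ^^ j) f)"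
proof (induction j arbitrary: f)
  case (Suc j)
  have "L2_inner X ((S_op l ^^ Suc j) g) f = L2_inner X ((S_op l ^^ j) g) (S_op l f)"
    using S_op_selfadjoint[OF Suc.prems(1) S_power_L2[OF Suc.prems(2)]] by simp
  also have "\<dots> = L2_inner X g ((S_op l ^^ j) (S_op l f))"
    by (rule Suc.IH[OF S_op_L2[OF Suc.prems(1)] Suc.prems(2)])
  also have "(S_op l ^^ j) (S_op l f) = (S_op l ^^ Suc j) f" by (simp add: funpow_swap1)
  finally show ?case .
qed simp

lemma plane_wave_inner_bound: "norm (L2_inner X (plane_wave \<xi>) ((S_op l ^^ j) (plane_wave \<xi>))) \<le> l"
proof -
  note pw = plane_wave_L2[of \<xi>]
  have "norm (L2_inner X (plane_wave \<xi>) ((S_op l ^^ j) (plane_wave \<xi>)))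
     \<le> L2_norm X (plane_wave \<xi>) * L2_norm X ((S_op l ^^ j) (plane_wave \<xi>))"
    by (rule L2_Cauchy_Schwarz[OF pw S_power_L2[OF pw]])
  also have "\<dots> \<le> L2_norm X (plane_wave \<xi>) * L2_norm X (plane_wave \<xi>)"
    by (intro mult_left_mono S_power_contraction pw L2_norm_nonneg)
  also have "\<dots> = l" using L2_norm_plane_wave l by simp
  finally show ?thesis .
qed

lemma band_trace_bound: "norm (band_trace l j) \<le> l"
proof -
  have "norm (band_trace l j) \<le> (LINT \<xi>|I. norm (L2_inner X (plane_wave \<xi>) ((S_op l ^^ j) (plane_wave \<xi>))))"
    unfolding band_trace_def by (rule integral_norm_bound)
  also have "\<dots> \<le> (LINT \<xi>|I. l)"
    using plane_wave_inner_bound l by (intro integral_mono' I.integrable_const) auto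
  finally show ?thesis using measure_I by simp
qed

text \<open>For fixed \<open>\<xi>\<close> the sum over \<open>n\<close> is Parseval's identity for \<open>S\<^sup>j \<phi>\<^sub>\<xi>\<close> and \<open>\<phi>\<^sub>\<xi>\<close>; its partial sums
  are at most \<open>\<parallel>\<phi>\<^sub>\<xi>\<parallel>\<^sup>2 = l\<close>, so the integral over the band may be taken term by term.\<close>

lemma basis_trace_sums:
  assumes e: "L2_orthonormal_basis X e"
  shows "(\<lambda>n. L2_inner X (e n) ((S_op l ^^ Suc j) (e n))) sums band_trace l j"
proof -
  have on: "orthonormal_on X {..<N} e" for N
    using e orthonormal_on_subset[of X UNIV e] by (auto simp: L2_orthonormal_basis_iff)
  have eL: "e n \<in> L2 X" for n using on[of "Suc n"] by (auto simp: orthonormal_on_def)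
  define s where "s n \<xi> = cnj (band_coeff (e n) \<xi>) * band_coeff ((S_op l ^^ j) (e n)) \<xi>" for n \<xi>
  define t where "t \<xi> = L2_inner X (plane_wave \<xi>) ((S_op l ^^ j) (plane_wave \<xi>))" for \<xi>
  have s_eq: "s n \<xi> = L2_inner X ((S_op l ^^ j) (plane_wave \<xi>)) (e n) * L2_inner X (e n) (plane_wave \<xi>)" for n \<xi>
  proof -
    have "L2_inner X ((S_op l ^^ j) (plane_wave \<xi>)) (e n) = L2_inner X (plane_wave \<xi>) ((S_op l ^^ j) (e n))"
      by (rule S_power_selfadjoint[OF eL plane_wave_L2])
    then show ?thesis
      unfolding s_def band_coeff_def L2_inner_commute[of X "e n" "plane_wave \<xi>"]
      by (simp only: mult.commute)
  qed
  have t_eq: "t \<xi> = L2_inner X ((S_op l ^^ j) (plane_wave \<xi>)) (plane_wave \<xi>)" for \<xi>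
    unfolding t_def by (rule S_power_selfadjoint[OF plane_wave_L2 plane_wave_L2, symmetric])
  have s_int: "integrable I (s n)" and s_inner: "L2_inner X (e n) ((S_op l ^^ Suc j) (e n)) = (LINT \<xi>|I. s n \<xi>)" for n
  proof -
    show "integrable I (s n)" unfolding s_def
      by (intro L2_integrable_cnj_mult band_coeff_L2 S_power_L2 eL)
    have "L2_inner X (e n) ((S_op l ^^ Suc j) (e n)) = L2_inner X (e n) (S_op l ((S_op l ^^ j) (e n)))" by simp
    also have "\<dots> = L2_inner I (band_coeff (e n)) (band_coeff ((S_op l ^^ j) (e n)))"
      by (rule S_op_inner[OF S_power_L2[OF eL] eL])
    also have "\<dots> = (LINT \<xi>|I. s n \<xi>)" unfolding s_def L2_inner_def ..
    finally show "L2_inner X (e n) ((S_op l ^^ Suc j) (e n)) = (LINT \<xi>|I. s n \<xi>)" .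
  qed
  have s_sums: "(\<lambda>n. s n \<xi>) sums t \<xi>" for \<xi>
    unfolding s_eq t_eq by (intro L2_Parseval[OF e] S_power_L2 plane_wave_L2)
  have s_bound: "norm (\<Sum>n<N. s n \<xi>) \<le> l" for N \<xi>
  proof -
    have "norm (\<Sum>n<N. s n \<xi>) \<le> L2_norm X ((S_op l ^^ j) (plane_wave \<xi>)) * L2_norm X (plane_wave \<xi>)"
      unfolding s_eq by (intro L2_partial_Parseval_bound[OF on] S_power_L2 plane_wave_L2) simp
    also have "\<dots> \<le> L2_norm X (plane_wave \<xi>) * L2_norm X (plane_wave \<xi>)"
      by (intro mult_right_mono S_power_contraction plane_wave_L2 L2_norm_nonneg)
    finally show ?thesis using L2_norm_plane_wave l by simp
  qed
  have sm: "(\<lambda>\<xi>. \<Sum>n<N. s n \<xi>) \<in> borel_measurable I" for N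
    using s_int by (intro borel_measurable_sum) auto
  have lim: "(\<lambda>N. \<Sum>n<N. s n \<xi>) \<longlonglongrightarrow> t \<xi>" for \<xi> using s_sums by (simp add: sums_def)
  have "(\<lambda>N. LINT \<xi>|I. (\<Sum>n<N. s n \<xi>)) \<longlonglongrightarrow> (LINT \<xi>|I. t \<xi>)"
  proof (rule integral_dominated_convergence[where w = "\<lambda>_. l"])
    show "t \<in> borel_measurable I" by (rule borel_measurable_LIMSEQ_metric[OF sm lim])
    show "integrable I (\<lambda>_. l)" by (rule I.integrable_const)
  qed (use sm lim s_bound in auto)
  also have "(\<lambda>N. LINT \<xi>|I. (\<Sum>n<N. s n \<xi>)) = (\<lambda>N. \<Sum>n<N. LINT \<xi>|I. s n \<xi>)"
    using s_int by (intro ext Bochner_Integration.integral_sum)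
  finally show ?thesis unfolding sums_def s_inner band_trace_def t_def .
qed

lemma S_power_wave_measurable:
  "(\<lambda>(\<xi>, x). (S_op l ^^ j) (plane_wave \<xi>) x) \<in> borel_measurable (I \<Otimes>\<^sub>M X)"
proof (induction j)
  case 0
  have "(\<lambda>p. plane_wave (fst p) (snd p)) \<in> borel_measurable (I \<Otimes>\<^sub>M X)"
    by (intro plane_wave_measurable interval_ident_measurable[OF measurable_fst] interval_ident_measurable[OF measurable_snd])
  then show ?case by (simp add: case_prod_beta')
next
  case (Suc j)
  from S_op_joint_measurable[OF this] show ?case by simp
qed

lemma S_power_wave_bound: "norm ((S_op l ^^ j) (plane_wave \<xi>) x) \<le> l ^ j"
proof (induction j arbitrary: x)
  case (Suc j)
  have "norm ((S_op l ^^ Suc j) (plane_wave \<xi>) x) \<le> (LINT y|X. norm ((S_op l ^^ j) (plane_wave \<xi>) y))"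
    using S_op_bound[OF L2_integrable[OF S_power_L2[OF plane_wave_L2]]] by simp
  also have "\<dots> \<le> (LINT y|X. l ^ j)" using Suc l by (intro integral_mono') auto
  also have "\<dots> = l ^ Suc j" using measure_interval[of 0 l] l by simp
  finally show ?case .
qed simp

abbreviation (input) "sinc_kernel \<equiv> (\<lambda>x y. sinc_pi (x - y))"

text \<open>The kernel of \<open>S\<^bsup>j+1\<^esup>\<close> arises by applying \<open>S\<^sup>j\<close> to the first argument of
  \<open>sinc (x - y) = \<integral> \<phi>\<^sub>\<xi>(x) \<phi>\<^sub>\<xi>(y)\<^sup>* d\<xi>\<close>, where the star denotes conjugation.\<close>

lemma iterated_kernel_eq_band_integral:
  assumes "x \<in> space X"
  shows "complex_of_real (iterated_kernel X sinc_kernel j x y)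
       = (LINT \<xi>|I. (S_op l ^^ j) (plane_wave \<xi>) x * cnj (plane_wave \<xi> y))"
  using assms
proof (induction j arbitrary: x)
  case 0
  show ?case by (simp add: integral_cis_eq_sinc plane_wave_mult_cnj algebra_simps)
next
  case (Suc j)
  have x: "x \<in> {0<..<l}" using Suc.prems by (simp add: space_restrict_space)
  let ?F = "\<lambda>\<xi> z. (S_op l ^^ j) (plane_wave \<xi>) z"
  have "complex_of_real (iterated_kernel X sinc_kernel (Suc j) x y)
      = (LINT z|X. complex_of_real (sinc_pi (x - z)) * complex_of_real (iterated_kernel X sinc_kernel j z y))"
    by (simp add: kernel_comp_def flip: integral_complex_of_real)
  also have "\<dots> = (LINT z|X. LINT \<xi>|I. complex_of_real (sinc_pi (x - z)) * (?F \<xi> z * cnj (plane_wave \<xi> y)))"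
    by (rule Bochner_Integration.integral_cong[OF refl]) (simp add: Suc.IH)
  also have "\<dots> = (LINT \<xi>|I. LINT z|X. complex_of_real (sinc_pi (x - z)) * (?F \<xi> z * cnj (plane_wave \<xi> y)))"
  proof (rule Fubini_bounded[OF X.finite_measure_axioms I.finite_measure_axioms, of _ _ "l ^ j"])
    have "(\<lambda>z. sinc_pi (x - z)) \<in> borel_measurable X"
      by (intro borel_measurable_interval measurable_compose[OF _ sinc_pi_measurable]) simp
    then have "(\<lambda>z. complex_of_real (sinc_pi (x - z))) \<in> borel_measurable X" by (rule measurable_compose) simp
    then show "integrable X (\<lambda>z. complex_of_real (sinc_pi (x - z)))"
      using sinc_pi_bound by (intro X.integrable_const_bound[where B = 1]) auto
    have 1: "(\<lambda>p. ?F (snd p) (fst p)) \<in> borel_measurable (X \<Otimes>\<^sub>M I)"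
      using measurable_compose[OF measurable_pair_swap' S_power_wave_measurable[of j]] by (simp add: case_prod_beta')
    have 2: "(\<lambda>p. cnj (plane_wave (snd p) y)) \<in> borel_measurable (X \<Otimes>\<^sub>M I)"
      by (intro cnj_measurable plane_wave_measurable interval_ident_measurable[OF measurable_snd]) simp
    from borel_measurable_times[OF 1 2]
    show "(\<lambda>(z, \<xi>). ?F \<xi> z * cnj (plane_wave \<xi> y)) \<in> borel_measurable (X \<Otimes>\<^sub>M I)"
      by (simp add: case_prod_beta')
    show "norm (?F \<xi> z * cnj (plane_wave \<xi> y)) \<le> l ^ j" for \<xi> z
      using S_power_wave_bound by (simp add: norm_mult)
  qed
  also have "\<dots> = (LINT \<xi>|I. (S_op l ^^ Suc j) (plane_wave \<xi>) x * cnj (plane_wave \<xi> y))"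
  proof (rule Bochner_Integration.integral_cong[OF refl])
    fix \<xi>
    have "(LINT z|X. complex_of_real (sinc_pi (x - z)) * (?F \<xi> z * cnj (plane_wave \<xi> y)))
        = (LINT z|X. (complex_of_real (sinc_pi (x - z)) * ?F \<xi> z) * cnj (plane_wave \<xi> y))"
      by (simp only: mult.assoc)
    also have "\<dots> = (LINT z|X. complex_of_real (sinc_pi (x - z)) * ?F \<xi> z) * cnj (plane_wave \<xi> y)"
      by (rule integral_mult_left_zero)
    finally show "(LINT z|X. complex_of_real (sinc_pi (x - z)) * (?F \<xi> z * cnj (plane_wave \<xi> y)))
        = (S_op l ^^ Suc j) (plane_wave \<xi>) x * cnj (plane_wave \<xi> y)"
      using x by (simp add: S_op_eq)
  qed
  finally show ?case .
qed

lemma kernel_trace_eq_band_trace: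
  "complex_of_real (kernel_trace X (iterated_kernel X sinc_kernel j)) = band_trace l j"
proof -
  let ?F = "\<lambda>\<xi> z. (S_op l ^^ j) (plane_wave \<xi>) z"
  have "complex_of_real (kernel_trace X (iterated_kernel X sinc_kernel j))
      = (LINT x|X. complex_of_real (iterated_kernel X sinc_kernel j x x))"
    by (simp add: kernel_trace_def)
  also have "\<dots> = (LINT x|X. LINT \<xi>|I. 1 * (?F \<xi> x * cnj (plane_wave \<xi> x)))"
    by (rule Bochner_Integration.integral_cong[OF refl]) (simp add: iterated_kernel_eq_band_integral)
  also have "\<dots> = (LINT \<xi>|I. LINT x|X. 1 * (?F \<xi> x * cnj (plane_wave \<xi> x)))"
  proof (rule Fubini_bounded[OF X.finite_measure_axioms I.finite_measure_axioms, of _ _ "l ^ j"])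
    have 1: "(\<lambda>p. ?F (snd p) (fst p)) \<in> borel_measurable (X \<Otimes>\<^sub>M I)"
      using measurable_compose[OF measurable_pair_swap' S_power_wave_measurable[of j]] by (simp add: case_prod_beta')
    have 2: "(\<lambda>p. cnj (plane_wave (snd p) (fst p))) \<in> borel_measurable (X \<Otimes>\<^sub>M I)"
      by (intro cnj_measurable plane_wave_measurable interval_ident_measurable[OF measurable_snd]
          interval_ident_measurable[OF measurable_fst])
    from borel_measurable_times[OF 1 2]
    show "(\<lambda>(x, \<xi>). ?F \<xi> x * cnj (plane_wave \<xi> x)) \<in> borel_measurable (X \<Otimes>\<^sub>M I)"
      by (simp add: case_prod_beta')
    show "norm (?F \<xi> x * cnj (plane_wave \<xi> x)) \<le> l ^ j" for \<xi> x
      using S_power_wave_bound by (simp add: norm_mult)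
  qed simp
  also have "\<dots> = band_trace l j"
    by (simp add: band_trace_def L2_inner_def mult.commute)
  finally show ?thesis .
qed

lemma S_op_add:
  assumes "f \<in> L2 X" "g \<in> L2 X"
  shows "S_op l (\<lambda>x. f x + g x) = (\<lambda>x. S_op l f x + S_op l g x)"
proof
  fix x
  have int: "integrable X (\<lambda>y. complex_of_real (sinc_pi (x - y)) * f y)" if f: "f \<in> L2 X" for f
  proof -
    have "(\<lambda>z. sinc_pi (x - z)) \<in> borel_measurable X"
      by (intro borel_measurable_interval measurable_compose[OF _ sinc_pi_measurable]) simp
    then have "(\<lambda>z. complex_of_real (sinc_pi (x - z))) \<in> borel_measurable X" by (rule measurable_compose) simp
    then have "(\<lambda>z. complex_of_real (sinc_pi (x - z))) \<in> L2 X"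
      using sinc_pi_bound by (intro X.L2_of_bounded[where B = 1]) auto
    from L2_integrable_cnj_mult[OF this f] show ?thesis by simp
  qed
  show "S_op l (\<lambda>x. f x + g x) x = S_op l f x + S_op l g x"
    using int[OF assms(1)] int[OF assms(2)] by (simp add: S_op_eq distrib_left)
qed

lemma S_op_cmult: "S_op l (\<lambda>x. c * f x) = (\<lambda>x. c * S_op l f x)"
  by (simp add: S_op_eq fun_eq_iff mult.left_commute[of _ c])

lemma S_op_sum:
  "(\<And>i. i \<in> F \<Longrightarrow> f i \<in> L2 X) \<Longrightarrow> S_op l (\<lambda>x. \<Sum>i\<in>F. f i x) = (\<lambda>x. \<Sum>i\<in>F. S_op l (f i) x)"
proof (induction F rule: infinite_finite_induct)
  case (insert a F)
  then show ?case using S_op_add[of "f a" "\<lambda>x. \<Sum>i\<in>F. f i x"] L2_sum[of F f X] by simp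
qed (simp_all add: S_op_eq fun_eq_iff)

lemma S_minus_S2_power:
  assumes f: "f \<in> L2 X"
  shows "(S_minus_S2 l ^^ m) f = (\<lambda>x. \<Sum>j\<le>m. (-1) ^ j * of_nat (m choose j) * (S_op l ^^ (m + j)) f x)"
proof (induction m)
  case (Suc m)
  let ?g = "\<lambda>j. (S_op l ^^ (m + j)) f"
  let ?c = "\<lambda>j. (-1) ^ j * of_nat (m choose j) :: complex"
  have gL: "?g j \<in> L2 X" for j by (rule S_power_L2[OF f])
  have S: "S_op l (\<lambda>x. \<Sum>j\<le>m. ?c j * (S_op l ^^ (k + j)) f x) = (\<lambda>x. \<Sum>j\<le>m. ?c j * (S_op l ^^ (Suc k + j)) f x)" for k
    by (subst S_op_sum) (auto intro!: L2_cmult S_power_L2 f simp: S_op_cmult)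
  have "(S_minus_S2 l ^^ Suc m) f = S_minus_S2 l (\<lambda>x. \<Sum>j\<le>m. ?c j * ?g j x)" using Suc by simp
  also have "\<dots> = (\<lambda>x. (\<Sum>j\<le>m. ?c j * (S_op l ^^ (Suc m + j)) f x) - (\<Sum>j\<le>m. ?c j * (S_op l ^^ (Suc m + Suc j)) f x))"
    unfolding S_minus_S2_def S by simp
  also have "\<dots> = (\<lambda>x. \<Sum>j\<le>Suc m. (-1) ^ j * of_nat (Suc m choose j) * (S_op l ^^ (Suc m + j)) f x)"
    by (simp only: alternating_binomial_Suc)
  finally show ?case .
qed simp

text \<open>Every basis gives the same sum; that it is the only number with this property uses that a basis
  exists.\<close>

lemma op_trace_S_minus_S2:
  assumes m: "m \<ge> 1"
  shows "op_trace X (S_minus_S2 l ^^ m) = (\<Sum>j\<le>m. (-1) ^ j * of_nat (m choose j) * band_trace l (m + j - 1))"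
proof -
  let ?t = "\<Sum>j\<le>m. (-1) ^ j * of_nat (m choose j) * band_trace l (m + j - 1)"
  have sums: "(\<lambda>n. L2_inner X (e n) ((S_minus_S2 l ^^ m) (e n))) sums ?t" if e: "L2_orthonormal_basis X e" for e
  proof -
    have eL: "e n \<in> L2 X" for n using e by (simp add: L2_orthonormal_basis_def)
    have "L2_inner X (e n) ((S_minus_S2 l ^^ m) (e n))
       = (\<Sum>j\<le>m. (-1) ^ j * of_nat (m choose j) * L2_inner X (e n) ((S_op l ^^ Suc (m + j - 1)) (e n)))" for n
      unfolding S_minus_S2_power[OF eL] using m
      by (subst L2_inner_sum_right[OF eL]) (auto intro!: L2_cmult S_power_L2 eL simp: L2_inner_cmult_right simp del: funpow.simps)
    then show ?thesis by (simp only:) (intro sums_sum sums_mult basis_trace_sums e)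
  qed
  show ?thesis unfolding op_trace_def
  proof (rule the_equality)
    show "\<forall>e. L2_orthonormal_basis X e \<longrightarrow> (\<lambda>n. L2_inner X (e n) ((S_minus_S2 l ^^ m) (e n))) sums ?t"
      using sums by blast
    fix t assume "\<forall>e. L2_orthonormal_basis X e \<longrightarrow> (\<lambda>n. L2_inner X (e n) ((S_minus_S2 l ^^ m) (e n))) sums t"
    then show "t = ?t" using cosine_basis_complete[OF l] sums sums_unique2 by blast
  qed
qed

section \<open>Dilation to the sine kernel\<close>

lemma integral_affine_interval:
  fixes F :: "real \<Rightarrow> real"
  shows "(LINT x|X. F x) = (l / 2) * (LINT u|lebesgue_on_open (-1) 1. F (l / 2 * (u + 1)))"
proof -
  have "indicator {0<..<l} (l / 2 + l / 2 * u) = (indicator {-1<..<1} u :: real)" for u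
  proof -
    have eq: "l / 2 + l / 2 * u = l / 2 * (1 + u)" by (simp only: distrib_left mult_1_right)
    have "0 < l / 2 * (1 + u) \<longleftrightarrow> -1 < u" using l by (auto simp: zero_less_mult_iff)
    moreover have "l / 2 * (1 + u) < l / 2 * 2 \<longleftrightarrow> u < 1" using l by (subst mult_less_cancel_left) auto
    moreover have "l / 2 * 2 = l" by simp
    ultimately show ?thesis unfolding eq indicator_def greaterThanLessThan_iff by (simp only:)
  qed
  then show ?thesis
    using lborel_integral_real_affine[of "l / 2" "\<lambda>x. indicator {0<..<l} x * F x" "l / 2"] l
    by (simp add: integral_restrict_space distrib_left add.commute)
qed

lemma sine_kernel_eq_sinc:
  "sine_kernel (pi * l / 2) u v = l / 2 * sinc_pi (l / 2 * (u + 1) - l / 2 * (v + 1))"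
proof -
  have eq: "l / 2 * (u + 1) - l / 2 * (v + 1) = l / 2 * (u - v)" by (simp only: right_diff_distrib[symmetric]) simp
  show ?thesis
  proof (cases "u = v")
    case False
    then have "l / 2 * (u - v) \<noteq> 0" using l by simp
    then show ?thesis unfolding eq using False l by (simp add: sine_kernel_def sinc_pi_def mult_ac)
  qed (simp add: sine_kernel_def sinc_pi_def)
qed

lemma iterated_sine_kernel:
  "iterated_kernel (lebesgue_on_open (-1) 1) (sine_kernel (pi * l / 2)) j u v
     = (l / 2) * iterated_kernel X sinc_kernel j (l / 2 * (u + 1)) (l / 2 * (v + 1))"
proof (induction j arbitrary: u v)
  case 0
  show ?case by (simp only: iterated_kernel.simps sine_kernel_eq_sinc)
next
  case (Suc j)
  let ?F = "\<lambda>z. sinc_pi (l / 2 * (u + 1) - z) * iterated_kernel X sinc_kernel j z (l / 2 * (v + 1))"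
  have "iterated_kernel (lebesgue_on_open (-1) 1) (sine_kernel (pi * l / 2)) (Suc j) u v
      = (LINT z|lebesgue_on_open (-1) 1. (l / 2 * (l / 2)) * ?F (l / 2 * (z + 1)))"
    by (simp only: iterated_kernel.simps kernel_comp_def Suc sine_kernel_eq_sinc mult_ac)
  also have "\<dots> = (l / 2 * (l / 2)) * (LINT z|lebesgue_on_open (-1) 1. ?F (l / 2 * (z + 1)))"
    by (rule integral_mult_right_zero)
  also have "\<dots> = l / 2 * (LINT z|X. ?F z)"
    unfolding integral_affine_interval[of ?F] by (simp only: mult.assoc)
  finally show ?case by (simp only: iterated_kernel.simps kernel_comp_def)
qed

lemma kernel_trace_sine_kernel:
  "kernel_trace (lebesgue_on_open (-1) 1) (iterated_kernel (lebesgue_on_open (-1) 1) (sine_kernel (pi * l / 2)) j)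
     = kernel_trace X (iterated_kernel X sinc_kernel j)"
  unfolding kernel_trace_def iterated_sine_kernel integral_affine_interval[of "\<lambda>x. iterated_kernel X sinc_kernel j x x"]
  by (rule integral_mult_right_zero)

lemma bounded_sine_kernel: "bounded_kernel (lebesgue_on_open (-1) 1) (sine_kernel (pi * l / 2))"
  unfolding bounded_kernel_def
proof (intro conjI exI[of _ "l / 2"] ballI)
  let ?N = "lebesgue_on_open (-1) 1"
  have "(\<lambda>p. fst p) \<in> borel_measurable (?N \<Otimes>\<^sub>M ?N)" "(\<lambda>p. snd p) \<in> borel_measurable (?N \<Otimes>\<^sub>M ?N)"
    by (rule interval_ident_measurable[OF measurable_fst] interval_ident_measurable[OF measurable_snd])+
  then have "(\<lambda>p. l / 2 * (fst p + 1) - l / 2 * (snd p + 1)) \<in> borel_measurable (?N \<Otimes>\<^sub>M ?N)" by measurable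
  from measurable_compose[OF this sinc_pi_measurable]
  have "(\<lambda>p. l / 2 * sinc_pi (l / 2 * (fst p + 1) - l / 2 * (snd p + 1))) \<in> borel_measurable (?N \<Otimes>\<^sub>M ?N)"
    by (intro borel_measurable_times borel_measurable_const)
  then show "case_prod (sine_kernel (pi * l / 2)) \<in> borel_measurable (?N \<Otimes>\<^sub>M ?N)"
    by (simp only: case_prod_beta' sine_kernel_eq_sinc)
  show "\<bar>sine_kernel (pi * l / 2) u v\<bar> \<le> l / 2" for u v
    unfolding sine_kernel_eq_sinc using l sinc_pi_bound by (simp add: abs_mult mult_left_le)
qed

lemma sine_kernel_trace_bound:
  "\<bar>kernel_trace (lebesgue_on_open (-1) 1) (iterated_kernel (lebesgue_on_open (-1) 1) (sine_kernel (pi * l / 2)) j)\<bar> \<le> l"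
  unfolding kernel_trace_sine_kernel
  using band_trace_bound[of j] unfolding kernel_trace_eq_band_trace[symmetric] norm_of_real .

lemma ln_fredholm_det_sine_kernel:
  assumes "\<bar>\<sigma>\<bar> < 1"
  shows "ln (fredholm_det (lebesgue_on_open (-1) 1) (\<lambda>x y. \<sigma> * sine_kernel (pi * l / 2) x y))
     = - (\<Sum>i. kernel_trace (lebesgue_on_open (-1) 1) (iterated_kernel (lebesgue_on_open (-1) 1) (sine_kernel (pi * l / 2)) i)
            / real (Suc i) * \<sigma> ^ Suc i)"
  using finite_measure.fredholm_det_eq_exp[OF finite_measure_interval bounded_sine_kernel sine_kernel_trace_bound assms]
  by (simp only: ln_exp)

lemma op_trace_eq_kernel_traces:
  assumes "m \<ge> 1"
  shows "op_trace X (S_minus_S2 l ^^ m) = complex_of_real (\<Sum>j\<le>m. (-1) ^ j * real (m choose j) *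
     kernel_trace (lebesgue_on_open (-1) 1) (iterated_kernel (lebesgue_on_open (-1) 1) (sine_kernel (pi * l / 2)) (m - 1 + j)))"
proof -
  have "m + j - 1 = m - 1 + j" for j using assms by simp
  then show ?thesis
    unfolding op_trace_S_minus_S2[OF assms] kernel_trace_sine_kernel
    by (simp add: kernel_trace_eq_band_trace[symmetric])
qed

end

section \<open>The trace asymptotics\<close>

theorem proposition6p3:
  assumes basor_widom:
    "\<And>A :: real set. compact A \<Longrightarrow> A \<subseteq> {..<1} \<Longrightarrow>
       \<exists>C. \<forall>\<^sub>F s in at_top. \<forall>\<sigma>\<in>A.
         (let z = - ln (1 - \<sigma>) / (2 * pi) in
          norm (complex_of_real
                  (ln (fredholm_det (restrict_space lborel {-1<..<1}) (\<lambda>x y. \<sigma> * sine_kernel s x y)))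
                - (complex_of_real (2 * s / pi * ln (1 - \<sigma>)
                                    + (ln (1 - \<sigma>))\<^sup>2 / (2 * pi\<^sup>2) * ln (4 * s))
                   + 2 * ln (Barnes_G (1 + \<i> * complex_of_real z)
                             * Barnes_G (1 - \<i> * complex_of_real z))))
          \<le> C * (ln s / s))"
  shows "(\<forall>m::nat. m \<ge> 1 \<longrightarrow>
            Beta (real m) (real m) = (fact (m - 1))\<^sup>2 / fact (2 * m - 1) \<and>
            (\<exists>C. \<forall>l::real. l \<ge> 1 \<longrightarrow>
               norm (op_trace (restrict_space lborel {0<..<l}) (S_minus_S2 l ^^ m)
                     - complex_of_real (Beta (real m) (real m) / pi\<^sup>2 * ln l)) \<le> C)) \<and>
         Beta (1::real) 1 = 1 \<and> Beta (2::real) 2 = 1 / 6 \<and> Beta (3::real) 3 = 1 / 30"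
proof -
  let ?N = "lebesgue_on_open (-1) 1"
  define \<tau> where "\<tau> i s = kernel_trace ?N (iterated_kernel ?N (sine_kernel s) i)" for i s
  have scale: "pi * (2 * s / pi) / 2 = s" for s :: real by simp
  have tau_le: "\<bar>\<tau> i s\<bar> \<le> 2 * s / pi" if "s > 0" for i s
  proof -
    interpret band_limiting "2 * s / pi" by unfold_locales (use that in simp)
    show ?thesis using sine_kernel_trace_bound[of i] unfolding scale \<tau>_def .
  qed
  define c where "c \<sigma> = (let z = - ln (1 - \<sigma>) / (2 * pi) in
      2 * ln (Barnes_G (1 + \<i> * complex_of_real z) * Barnes_G (1 - \<i> * complex_of_real z)))" for \<sigma> :: real
  have "{0..1/2::real} \<subseteq> {..<1}" by auto
  from basor_widom[OF compact_Icc this] obtain C where C: "\<forall>\<^sub>F s in at_top. \<forall>\<sigma>\<in>{0..1/2}.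
      norm (complex_of_real (ln (fredholm_det ?N (\<lambda>x y. \<sigma> * sine_kernel s x y)))
        - (complex_of_real (2 * s / pi * ln (1 - \<sigma>) + (ln (1 - \<sigma>))\<^sup>2 / (2 * pi\<^sup>2) * ln (4 * s)) + c \<sigma>))
      \<le> C * (ln s / s)"
    unfolding c_def Let_def by blast
  have asym: "\<forall>\<^sub>F s in at_top. \<forall>\<sigma>\<in>{0..1/2}.
      norm (complex_of_real (- (\<Sum>i. \<tau> i s / real (Suc i) * \<sigma> ^ Suc i))
        - (complex_of_real (2 * s / pi * ln (1 - \<sigma>) + (ln (1 - \<sigma>))\<^sup>2 / (2 * pi\<^sup>2) * ln (4 * s)) + c \<sigma>))
      \<le> C * (ln s / s)"
    using C eventually_gt_at_top[of 0]
  proof eventually_elim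
    case (elim s)
    interpret band_limiting "2 * s / pi" by unfold_locales (use elim in simp)
    show ?case
    proof
      fix \<sigma> :: real assume \<sigma>: "\<sigma> \<in> {0..1/2}"
      then have "\<bar>\<sigma>\<bar> < 1" by auto
      from ln_fredholm_det_sine_kernel[OF this]
      have "ln (fredholm_det ?N (\<lambda>x y. \<sigma> * sine_kernel s x y)) = - (\<Sum>i. \<tau> i s / real (Suc i) * \<sigma> ^ Suc i)"
        unfolding scale \<tau>_def .
      with bspec[OF elim(1) \<sigma>] show "norm (complex_of_real (- (\<Sum>i. \<tau> i s / real (Suc i) * \<sigma> ^ Suc i))
        - (complex_of_real (2 * s / pi * ln (1 - \<sigma>) + (ln (1 - \<sigma>))\<^sup>2 / (2 * pi\<^sup>2) * ln (4 * s)) + c \<sigma>))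
      \<le> C * (ln s / s)" by (simp only:)
    qed
  qed
  have "\<exists>B. \<forall>s\<ge>pi/2. \<bar>\<tau> i s - 2 * s / pi + harm i / pi\<^sup>2 * ln (4 * s)\<bar> \<le> B" for i
    by (rule traces_from_determinant_asymptotics[OF tau_le asym]) simp_all
  then obtain B where B: "\<And>i s. s \<ge> pi / 2 \<Longrightarrow> \<bar>\<tau> i s - 2 * s / pi + harm i / pi\<^sup>2 * ln (4 * s)\<bar> \<le> B i"
    by metis
  have main: "\<exists>C. \<forall>l::real. l \<ge> 1 \<longrightarrow>
      norm (op_trace (restrict_space lborel {0<..<l}) (S_minus_S2 l ^^ m)
        - complex_of_real (Beta (real m) (real m) / pi\<^sup>2 * ln l)) \<le> C" if m: "m \<ge> 1" for m
  proof (intro exI allI impI)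
    fix l :: real assume l1: "l \<ge> 1"
    interpret band_limiting l by unfold_locales (use l1 in simp)
    define s where "s = pi * l / 2"
    define \<beta> where "\<beta> = Beta (real m) (real m)"
    define b where "b j = (-1) ^ j * real (m choose j)" for j
    define u where "u i = \<tau> i s - l + harm i / pi\<^sup>2 * ln (4 * s)" for i
    have s: "s \<ge> pi / 2" "2 * s / pi = l" using l1 by (simp_all add: s_def)
    have u_le: "\<bar>u i\<bar> \<le> B i" for i using B[OF s(1), of i] unfolding u_def s(2) .
    have b0: "(\<Sum>j\<le>m. b j) = 0" unfolding b_def by (rule alternating_binomial_sum[OF m])
    have b1: "(\<Sum>j\<le>m. b j * harm (m - 1 + j)) = - \<beta>"
    proof -
      have "m - 1 + m = 2 * m - 1" using m by simp
      then show ?thesis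
        unfolding b_def \<beta>_def alternating_harm[OF m] Beta_diagonal[OF m] by (simp only: power2_eq_square)
    qed
    have "(\<Sum>j\<le>m. b j * \<tau> (m - 1 + j) s)
        = (\<Sum>j\<le>m. b j * u (m - 1 + j) + l * b j - ln (4 * s) / pi\<^sup>2 * (b j * harm (m - 1 + j)))"
      by (intro sum.cong refl) (simp add: u_def algebra_simps)
    also have "\<dots> = (\<Sum>j\<le>m. b j * u (m - 1 + j)) + l * (\<Sum>j\<le>m. b j) - ln (4 * s) / pi\<^sup>2 * (\<Sum>j\<le>m. b j * harm (m - 1 + j))"
      by (simp only: sum.distrib sum_subtractf sum_distrib_left)
    also have "\<dots> = (\<Sum>j\<le>m. b j * u (m - 1 + j)) + \<beta> / pi\<^sup>2 * ln (4 * s)" unfolding b0 b1 by simp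
    also have "ln (4 * s) = ln (2 * pi) + ln l"
    proof -
      have "4 * s = (2 * pi) * l" by (simp add: s_def)
      then show ?thesis using l1 by (simp only:) (subst ln_mult, auto)
    qed
    finally have "op_trace (restrict_space lborel {0<..<l}) (S_minus_S2 l ^^ m) - complex_of_real (\<beta> / pi\<^sup>2 * ln l)
        = complex_of_real ((\<Sum>j\<le>m. b j * u (m - 1 + j)) + \<beta> / pi\<^sup>2 * ln (2 * pi))"
      unfolding op_trace_eq_kernel_traces[OF m] b_def \<tau>_def s_def by (simp add: distrib_left)
    then have "norm (op_trace (restrict_space lborel {0<..<l}) (S_minus_S2 l ^^ m) - complex_of_real (\<beta> / pi\<^sup>2 * ln l))
        = \<bar>(\<Sum>j\<le>m. b j * u (m - 1 + j)) + \<beta> / pi\<^sup>2 * ln (2 * pi)\<bar>" by (simp only: norm_of_real)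
    also have "\<dots> \<le> \<bar>\<Sum>j\<le>m. b j * u (m - 1 + j)\<bar> + \<bar>\<beta> / pi\<^sup>2 * ln (2 * pi)\<bar>" by (rule abs_triangle_ineq)
    also have "\<bar>\<Sum>j\<le>m. b j * u (m - 1 + j)\<bar> \<le> (\<Sum>j\<le>m. real (m choose j) * B (m - 1 + j))"
    proof (rule order_trans[OF sum_abs sum_mono])
      fix j
      have "\<bar>b j * u (m - 1 + j)\<bar> = real (m choose j) * \<bar>u (m - 1 + j)\<bar>" by (simp add: b_def abs_mult)
      then show "\<bar>b j * u (m - 1 + j)\<bar> \<le> real (m choose j) * B (m - 1 + j)"
        using u_le by (simp add: mult_left_mono)
    qed
    finally show "norm (op_trace (restrict_space lborel {0<..<l}) (S_minus_S2 l ^^ m)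
        - complex_of_real (Beta (real m) (real m) / pi\<^sup>2 * ln l))
        \<le> (\<Sum>j\<le>m. real (m choose j) * B (m - 1 + j)) + \<bar>Beta (real m) (real m) / pi\<^sup>2 * ln (2 * pi)\<bar>"
      by (simp add: \<beta>_def)
  qed
  have "Beta (1::real) 1 = 1" "Beta (2::real) 2 = 1 / 6" "Beta (3::real) 3 = 1 / 30"
    using Beta_diagonal[of 1] Beta_diagonal[of 2] Beta_diagonal[of 3] by (simp_all add: fact_numeral)
  with main Beta_diagonal show ?thesis by blast
qed

end
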